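(* Let $B=(B_t)_{t\ge 0}$ be a standard one-dimensional Brownian motion started at $0$, let $a>0$, and let $T_a=\inf\{t\ge 0: B_t=a\}$. For $m\ge 0$ (real) set $$A_a^{(m)}=\frac{1}{T_a^{1+m/2}}\int_0^{T_a}|B_s|^m\,\mathrm{sgn}(B_s)\,ds .$$ Then $A_a^{(m)}$ is centered only for $m=1$; more precisely, $\mathbb{E}[A_a^{(m)}]<0$ for $0\le m<1$, $\mathbb{E}[A_a^{(1)}]=0$, and $\mathbb{E}[A_a^{(m)}]>0$ for $m>1$.
   Context: $\mathrm{sgn}$ denotes the sign function. By Brownian scaling, the law of $A_a^{(m)}$ does not depend on $a>0$. *)

theory Defs
  imports "HOL-Probability.Probability"
begin

text \<open>
  The index type is \<^typ>\<open>real\<close>; only the values \<open>B t\<close> with \<open>t \<ge> 0\<close> are constrained.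
  Every path is continuous; an exceptional null set of discontinuous paths would spoil the
  measurability of path functionals on a probability space that need not be complete.
\<close>

locale standard_brownian_motion = prob_space M
  for M :: "'w measure" and B :: "real \<Rightarrow> 'w \<Rightarrow> real" +
  assumes measurable_B: "\<And>t. 0 \<le> t \<Longrightarrow> B t \<in> borel_measurable M"
    and starts_at_0: "AE \<omega> in M. B 0 \<omega> = 0"
    and continuous_paths: "\<And>\<omega>. \<omega> \<in> space M \<Longrightarrow> continuous_on {0..} (\<lambda>t. B t \<omega>)"
    and normal_increments: "\<And>s t. 0 \<le> s \<Longrightarrow> s < t \<Longrightarrow>
      distributed M lborel (\<lambda>\<omega>. B t \<omega> - B s \<omega>) (normal_density 0 (sqrt (t - s)))"
    and independent_increments: "\<And>(t :: nat \<Rightarrow> real) n.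
      0 \<le> t 0 \<Longrightarrow> (\<And>i. i < n \<Longrightarrow> t i < t (Suc i)) \<Longrightarrow>
      indep_vars (\<lambda>_. borel) (\<lambda>i \<omega>. B (t (Suc i)) \<omega> - B (t i) \<omega>) {..<n}"

text \<open>
  Brownian motion hits every level almost surely, so the infimum is real-valued; on the null
  event that the set is empty it is the fixed, irrelevant real number \<open>Inf {}\<close>.
\<close>

definition hitting_time :: "(real \<Rightarrow> 'w \<Rightarrow> real) \<Rightarrow> real \<Rightarrow> 'w \<Rightarrow> real" where
  "hitting_time B a \<omega> = Inf {t. 0 \<le> t \<and> B t \<omega> = a}"

text \<open>
  For \<open>m = 0\<close> the convention \<open>0 powr 0 = 0\<close> is harmless, since \<open>sgn 0 = 0\<close>.
\<close>

definition signed_power_average ::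
    "(real \<Rightarrow> 'w \<Rightarrow> real) \<Rightarrow> real \<Rightarrow> real \<Rightarrow> 'w \<Rightarrow> real" where
  "signed_power_average B a m \<omega> =
     1 / hitting_time B a \<omega> powr (1 + m / 2) *
     (LINT s:{0..hitting_time B a \<omega>}|lborel. \<bar>B s \<omega>\<bar> powr m * sgn (B s \<omega>))"

end

theory Submission
  imports Defs "HOL-Real_Asymp.Real_Asymp"
begin

text \<open>
  Write \<open>T\<close> for the hitting time of \<open>a\<close> and \<open>f x = \<bar>x\<bar> powr m * sgn x\<close>.  The negative power of \<open>T\<close>
  is a mixture of exponentials: the integral of \<open>\<theta> powr (m + 1) * exp (- \<theta>\<^sup>2 T / 2)\<close> over \<open>\<theta> > 0\<close> is a
  finite positive multiple of \<open>T powr (- (1 + m / 2))\<close> (\<open>gauss_mellin\<close>).  It therefore suffices to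
  know, for every \<open>\<theta> > 0\<close>, the measure that sends \<open>g\<close> to the expectation of
  \<open>exp (- \<theta>\<^sup>2 T / 2)\<close> times the integral of \<open>g (B s)\<close> over \<open>s \<in> {0..T}\<close>.

  That measure is found through its Fourier transform.  Since \<open>exp (\<theta> B t - \<theta>\<^sup>2 t / 2)\<close> is a
  martingale with value \<open>exp (\<theta> a - \<theta>\<^sup>2 T / 2)\<close> at time \<open>T\<close>, weighting by \<open>exp (- \<theta>\<^sup>2 T / 2)\<close> amounts,
  up to the factor \<open>exp (- \<theta> a)\<close>, to adding the drift \<open>\<theta>\<close>.  Optional stopping of
  \<open>exp ((\<theta> + \<i> \<mu>) B t - \<theta>\<^sup>2 t / 2)\<close>, which drifts at the relative rate \<open>\<kappa> = \<i> \<mu> \<theta> - \<mu>\<^sup>2 / 2\<close>, gives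
  \<open>exp (- \<theta> a) * (exp (\<i> \<mu> a) - 1) / \<kappa>\<close> for the Fourier transform (\<open>stopped_fourier\<close>).  This is
  \<open>exp (- \<theta> a) * a / \<theta>\<close> times the characteristic function of \<open>a U - Z / (2 \<theta>)\<close>, where \<open>U\<close> is
  uniform on \<open>{0..1}\<close> and \<open>Z\<close> is exponential and independent of \<open>U\<close>; uniqueness of characteristic
  functions identifies the measure (\<open>occupation_identity\<close>).

  Now \<open>f\<close> is homogeneous of degree \<open>m\<close>, so the integration over \<open>\<theta>\<close> turns \<open>a \<theta>\<close> into a further
  exponential variable \<open>R\<close>: the expectation in question is a positive multiple of the expectation
  of \<open>f (R U - Z / 2)\<close> (\<open>scaled_occupation_moment\<close>, applied to the positive and the negative part of
  \<open>f\<close>).  Given \<open>U = u\<close>, the absence of memory of the exponential law makes both parts explicit, and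
  what remains is a positive multiple of \<open>balance m\<close>, the integral of
  \<open>((2 u) powr (m + 1) - 1) / (1 + 2 u)\<close> over \<open>u \<in> {0..1}\<close>.

  Finally \<open>y powr m\<close> is concave in \<open>y\<close> for \<open>m \<le> 1\<close> and convex for \<open>m \<ge> 1\<close>.  Replacing it by its
  tangent \<open>1 + m (y - 1)\<close> at \<open>y = 1\<close> changes \<open>balance m\<close> into \<open>(1 - m) (1 - ln 3)\<close> and bounds it from
  above for \<open>m \<le> 1\<close> and from below for \<open>m \<ge> 1\<close>.  As \<open>ln 3 > 1\<close>, the three signs follow
  (\<open>balance_sign\<close>).

  Optional stopping is needed only for the exponential martingales, and it is obtained from the
  Gaussian random walk that a path traces on the dyadic points of \<open>{0..t}\<close>, where it is a telescoping
  sum (\<open>walk_optional_stopping\<close>).  Two limits lead to Brownian motion.  Refining the grid at a fixed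
  level \<open>c < a\<close> and a fixed horizon needs control of the overshoot, which a second moment bound
  supplies (\<open>exit_limit_identity\<close>).  Letting the level increase to \<open>a\<close> and the horizon to infinity
  is then dominated convergence, because the stopped path does not exceed \<open>a\<close> (\<open>stopped_identity\<close>).
\<close>

section \<open>Exponential moments of Gaussian increments\<close>

text \<open>
  The substitution \<open>x = \<theta> h + sqrt h z\<close> completes the square in the real part of the exponent; what is
  left is the characteristic function of the standard normal law at \<open>\<mu> * sqrt h\<close>.
\<close>

lemma (in prob_space) gaussian_exp_moment:
  fixes X :: "'a \<Rightarrow> real" and h \<theta> \<mu> :: real
  assumes X: "distributed M lborel X (normal_density 0 (sqrt h))" and h: "h > 0"
  shows "has_bochner_integral M (\<lambda>\<omega>. exp (Complex \<theta> \<mu> * complex_of_real (X \<omega>)))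
           (exp ((Complex \<theta> \<mu>)\<^sup>2 * h / 2))"
proof -
  let ?\<zeta> = "Complex \<theta> \<mu>"
  have meas[measurable]: "X \<in> borel_measurable M"
    using distributed_measurable[OF X] by simp
  have std: "has_bochner_integral lborel (\<lambda>z. std_normal_density z *\<^sub>R iexp (t * z)) (exp (- (t\<^sup>2) / 2))" for t
  proof -
    have i: "integrable std_normal_distribution (\<lambda>z. iexp (t * z))"
      by (rule finite_measure.integrable_const_bound[where B=1])
         (auto intro!: prob_space.finite_measure[OF prob_space_normal_density])
    have 1: "integrable lborel (\<lambda>z. std_normal_density z *\<^sub>R iexp (t * z))"
      using i by (subst (asm) integrable_density) auto
    have "(LINT z|lborel. std_normal_density z *\<^sub>R iexp (t * z)) = char std_normal_distribution t"
      unfolding char_def by (subst integral_density) auto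
    then show ?thesis using 1
      by (simp add: char_std_normal_distribution has_bochner_integral_iff exp_of_real)
  qed
  have fac: "sqrt h *\<^sub>R (normal_density 0 (sqrt h) (\<theta> * h + sqrt h * z) *\<^sub>R exp (?\<zeta> * complex_of_real (\<theta> * h + sqrt h * z)))
     = exp (\<theta>\<^sup>2 * h / 2 + \<i> * \<mu> * \<theta> * h) * (std_normal_density z *\<^sub>R iexp (\<mu> * sqrt h * z))" for z
  proof -
    have a: "sqrt h * normal_density 0 (sqrt h) (\<theta> * h + sqrt h * z)
        = std_normal_density z * exp (- \<theta>\<^sup>2 * h / 2 - \<theta> * sqrt h * z)"
    proof -
      have "(\<theta> * h + sqrt h * z)\<^sup>2 / (2*h) = \<theta>\<^sup>2 * h / 2 + \<theta> * sqrt h * z + z\<^sup>2/2"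
        using h by (simp add: power2_eq_square field_simps)
      then show ?thesis using h
        by (simp add: normal_density_def std_normal_density_def real_sqrt_mult flip: exp_add)
    qed
    have b: "?\<zeta> * complex_of_real (\<theta> * h + sqrt h * z) =
       complex_of_real (\<theta>\<^sup>2 * h + \<theta> * sqrt h * z) + \<i> * \<mu> * \<theta> * h + \<i> * (\<mu> * sqrt h * z)"
      by (simp add: complex_eq_iff power2_eq_square algebra_simps)
    have "sqrt h *\<^sub>R (normal_density 0 (sqrt h) (\<theta> * h + sqrt h * z) *\<^sub>R exp (?\<zeta> * complex_of_real (\<theta> * h + sqrt h * z)))
       = complex_of_real (std_normal_density z) * (exp (complex_of_real (- \<theta>\<^sup>2 * h / 2 - \<theta> * sqrt h * z)) *
          exp (?\<zeta> * complex_of_real (\<theta> * h + sqrt h * z)))"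
      unfolding scaleR_scaleR a exp_of_real by (simp add: scaleR_conv_of_real)
    also have "\<dots> = complex_of_real (std_normal_density z) * (exp (\<theta>\<^sup>2 * h / 2 + \<i> * \<mu> * \<theta> * h) * iexp (\<mu> * sqrt h * z))"
      unfolding b by (simp flip: exp_add add: algebra_simps)
    finally show ?thesis by (simp add: scaleR_conv_of_real)
  qed
  have I: "has_bochner_integral lborel
     (\<lambda>z. exp (\<theta>\<^sup>2 * h / 2 + \<i> * \<mu> * \<theta> * h) * (std_normal_density z *\<^sub>R iexp (\<mu> * sqrt h * z)))
     (exp (?\<zeta>\<^sup>2 * h / 2))"
  proof -
    have "exp (\<theta>\<^sup>2 * h / 2 + \<i> * \<mu> * \<theta> * h) * complex_of_real (exp (- ((\<mu> * sqrt h)\<^sup>2) / 2)) = exp (?\<zeta>\<^sup>2 * h / 2)"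
    proof -
      have "\<theta>\<^sup>2 * h / 2 + \<i> * \<mu> * \<theta> * h + complex_of_real (- ((\<mu> * sqrt h)\<^sup>2) / 2) = ?\<zeta>\<^sup>2 * h / 2"
        using h by (simp add: complex_eq_iff power2_eq_square algebra_simps)
      then show ?thesis by (metis exp_add exp_of_real)
    qed
    then show ?thesis
      using has_bochner_integral_mult_right[OF std[of "\<mu> * sqrt h"]] by metis
  qed
  have "has_bochner_integral lborel (\<lambda>x. normal_density 0 (sqrt h) x *\<^sub>R exp (?\<zeta> * complex_of_real x)) (exp (?\<zeta>\<^sup>2 * h / 2))"
  proof -
    have h': "sqrt h \<noteq> 0" "(1 / \<bar>sqrt h\<bar>) * sqrt h = 1" using h by auto
    have "has_bochner_integral lborel (\<lambda>z. (1/\<bar>sqrt h\<bar>) *\<^sub>R (sqrt h *\<^sub>R (normal_density 0 (sqrt h) (\<theta> * h + sqrt h * z) *\<^sub>R exp (?\<zeta> * complex_of_real (\<theta> * h + sqrt h * z)))))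
       ((1/\<bar>sqrt h\<bar>) *\<^sub>R exp (?\<zeta>\<^sup>2 * h / 2))"
      using I unfolding fac by (rule has_bochner_integral_scaleR_right)
    then have "has_bochner_integral lborel (\<lambda>z. normal_density 0 (sqrt h) (\<theta> * h + sqrt h * z) *\<^sub>R exp (?\<zeta> * complex_of_real (\<theta> * h + sqrt h * z)))
       (exp (?\<zeta>\<^sup>2 * h / 2) /\<^sub>R \<bar>sqrt h\<bar>)"
      unfolding scaleR_scaleR[of "1 / \<bar>sqrt h\<bar>" "sqrt h"] h'(2) scaleR_one by (simp only: inverse_eq_divide)
    then show ?thesis
      by (rule lborel_has_bochner_integral_real_affine_iff[THEN iffD2, OF h'(1)])
  qed
  then have "has_bochner_integral (distr M lborel X) (\<lambda>x. exp (?\<zeta> * complex_of_real x)) (exp (?\<zeta>\<^sup>2 * h / 2))"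
    unfolding distributed_distr_eq_density[OF X]
    by (intro has_bochner_integral_density) auto
  then show ?thesis
    by (subst (asm) has_bochner_integral_iff) (simp add: has_bochner_integral_iff integrable_distr_eq integral_distr)
qed

section \<open>Optional stopping for a Gaussian random walk\<close>

definition walk :: "(nat \<Rightarrow> real) \<Rightarrow> nat \<Rightarrow> real" where
  "walk x k = (\<Sum>i<k. x i)"

definition below :: "real \<Rightarrow> (nat \<Rightarrow> real) \<Rightarrow> nat \<Rightarrow> bool" where
  "below c x k \<longleftrightarrow> (\<forall>i\<le>k. walk x i < c)"

text \<open>
  The first index at which the walk is at least \<open>c\<close>, capped at \<open>n\<close>.  As a count of the indices that
  precede the exit it satisfies a recursion in \<open>n\<close>, and being above \<open>k\<close> depends on the past of \<open>k\<close> only.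
\<close>

definition exit_index :: "real \<Rightarrow> nat \<Rightarrow> (nat \<Rightarrow> real) \<Rightarrow> nat" where
  "exit_index c n x = card {k. k < n \<and> below c x k}"

lemma walk_Suc: "walk x (Suc k) = walk x k + x k"
  by (simp add: walk_def)

lemma below_mono: "below c x n \<Longrightarrow> k \<le> n \<Longrightarrow> below c x k"
  by (auto simp: below_def)

lemma below_0: "below c x 0 \<longleftrightarrow> 0 < c"
  by (simp add: below_def walk_def)

lemma exit_index_0 [simp]: "exit_index c 0 x = 0"
  by (simp add: exit_index_def)

lemma exit_index_Suc: "exit_index c (Suc n) x = exit_index c n x + of_bool (below c x n)"
proof -
  have "{k. k < Suc n \<and> below c x k} = {k. k < n \<and> below c x k} \<union> (if below c x n then {n} else {})"
    by (auto simp: less_Suc_eq)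
  then show ?thesis by (simp add: exit_index_def)
qed

lemma exit_index_le: "exit_index c n x \<le> n"
  by (induction n) (auto simp: exit_index_Suc)

lemma exit_index_below: "below c x n \<Longrightarrow> exit_index c n x = n"
  by (induction n) (auto simp: exit_index_Suc intro: below_mono)

lemma less_exit_index_iff: "k < exit_index c n x \<longleftrightarrow> k < n \<and> below c x k"
proof (induction n)
  case (Suc n)
  have "exit_index c n x = n" if "below c x n" using that by (rule exit_index_below)
  moreover have "k = n \<or> k < n" if "k < Suc n" using that by auto
  ultimately show ?case using Suc below_mono[of c x n k] exit_index_le[of c n x]
    by (auto simp: exit_index_Suc less_Suc_eq)
qed simp

text \<open>
  Every stopped quantity is a telescoping sum of increments, each switched on by an event that is
  decided before the increment is made.
\<close>

lemma stopped_expansion: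
  fixes p :: "nat \<Rightarrow> complex"
  assumes "below c x k" "k \<le> n"
  shows "p (exit_index c n x) = p k + (\<Sum>j\<in>{k..<n}. of_bool (below c x j) * (p (Suc j) - p j))"
  using assms(2)
proof (induction n rule: dec_induct)
  case base
  then show ?case using assms(1) by (simp add: exit_index_below)
next
  case (step n)
  then show ?case
    by (cases "below c x n") (auto simp: exit_index_Suc exit_index_below)
qed

lemma measurable_walk_PiM [measurable]:
  "k \<le> n \<Longrightarrow> (\<lambda>x. walk x k) \<in> borel_measurable (PiM {..<n} (\<lambda>_. borel))"
  unfolding walk_def by (intro borel_measurable_sum measurable_component_singleton) auto

lemma measurable_below_PiM:
  assumes "k \<le> n"
  shows "Measurable.pred (PiM {..<n} (\<lambda>_. borel)) (\<lambda>x. below c x k)"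
proof -
  have "(\<lambda>x. below c x k) = (\<lambda>x. \<forall>i\<in>{..k}. walk x i < c)"
    by (auto simp: below_def)
  moreover have "Measurable.pred (PiM {..<n} (\<lambda>_. borel)) (\<lambda>x. \<forall>i\<in>{..k}. walk x i < c)"
    by (intro pred_intros_countable_bounded countable_finite borel_measurable_less measurable_walk_PiM)
       (use assms in auto)
  ultimately show ?thesis by simp
qed

lemma walk_restrict: "k \<le> n \<Longrightarrow> walk (restrict x {..<n}) k = walk x k"
  by (auto simp: walk_def)

lemma below_restrict: "k \<le> n \<Longrightarrow> below c (restrict x {..<n}) k = below c x k"
  by (auto simp: below_def walk_restrict)

locale gaussian_walk = prob_space M for M :: "'w measure" +
  fixes X :: "nat \<Rightarrow> 'w \<Rightarrow> real" and h :: real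
  assumes h_pos: "h > 0"
    and X_normal: "\<And>i. distributed M lborel (X i) (normal_density 0 (sqrt h))"
    and X_indep: "\<And>n. indep_vars (\<lambda>_. borel) X {..<n}"
begin

lemma measurable_X [measurable]: "X i \<in> borel_measurable M"
  using distributed_measurable[OF X_normal[of i]] by simp

abbreviation steps :: "'w \<Rightarrow> nat \<Rightarrow> real" where "steps \<omega> \<equiv> (\<lambda>i. X i \<omega>)"

lemma measurable_steps_restrict: "(\<lambda>\<omega>. restrict (steps \<omega>) {..<n}) \<in> measurable M (PiM {..<n} (\<lambda>_. borel))"
  by (rule measurable_restrict) auto

text \<open>
  The bound on \<open>Z\<close> makes both factors of the product integrable, so that independence of the past from
  the next step can be used for complex-valued integrands.
\<close>

lemma independent_step:
  fixes Z :: "(nat \<Rightarrow> real) \<Rightarrow> complex"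
  assumes Z: "Z \<in> borel_measurable (PiM {..<n} (\<lambda>_. borel))"
    and past: "\<And>x. Z (restrict x {..<n}) = Z x" and bound: "\<And>x. norm (Z x) \<le> C"
  shows "integrable M (\<lambda>\<omega>. Z (steps \<omega>))"
    and "integrable M (\<lambda>\<omega>. Z (steps \<omega>) * exp (Complex \<theta> \<mu> * X n \<omega>))"
    and "(LINT \<omega>|M. Z (steps \<omega>) * exp (Complex \<theta> \<mu> * X n \<omega>))
           = (LINT \<omega>|M. Z (steps \<omega>)) * exp ((Complex \<theta> \<mu>)\<^sup>2 * h / 2)"
proof -
  have meas: "(\<lambda>\<omega>. Z (steps \<omega>)) \<in> borel_measurable M"
    using measurable_compose[OF measurable_steps_restrict[of n] Z] by (simp add: past)
  show int: "integrable M (\<lambda>\<omega>. Z (steps \<omega>))"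
    by (rule integrable_const_bound[where B=C]) (auto simp: bound meas)
  note G = gaussian_exp_moment[OF X_normal[of n] h_pos, of \<theta> \<mu>, unfolded has_bochner_integral_iff]
  have comp: "(\<lambda>y::nat\<Rightarrow>real. exp (Complex \<theta> \<mu> * complex_of_real (y n))) \<in> borel_measurable (PiM {n} (\<lambda>_. borel))"
    by measurable
  have "indep_var borel (Z \<circ> (\<lambda>\<omega>. restrict (steps \<omega>) {..<n})) borel
      ((\<lambda>y. exp (Complex \<theta> \<mu> * complex_of_real (y n))) \<circ> (\<lambda>\<omega>. restrict (steps \<omega>) {n}))"
    by (rule indep_var_compose[OF indep_var_restrict[OF X_indep[of "Suc n"]] Z comp]) auto
  then have ind: "indep_var borel (\<lambda>\<omega>. Z (steps \<omega>)) borel (\<lambda>\<omega>. exp (Complex \<theta> \<mu> * X n \<omega>))"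
    by (simp add: comp_def past)
  show "integrable M (\<lambda>\<omega>. Z (steps \<omega>) * exp (Complex \<theta> \<mu> * X n \<omega>))"
    using indep_var_integrable[OF ind int] G by blast
  show "(LINT \<omega>|M. Z (steps \<omega>) * exp (Complex \<theta> \<mu> * X n \<omega>))
           = (LINT \<omega>|M. Z (steps \<omega>)) * exp ((Complex \<theta> \<mu>)\<^sup>2 * h / 2)"
    using indep_var_lebesgue_integral[OF ind int] G by simp
qed

text \<open>
  The exponential functional \<open>exp (z * walk - l * time)\<close>; for \<open>z\<^sup>2 / 2 = l\<close> it is a martingale.
\<close>

definition expo :: "complex \<Rightarrow> real \<Rightarrow> nat \<Rightarrow> (nat \<Rightarrow> real) \<Rightarrow> complex" where
  "expo z l k x = exp (z * complex_of_real (walk x k) - complex_of_real (l * h * real k))"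

lemma expo_Suc: "expo z l (Suc k) x = expo z l k x * exp (z * x k) * exp (- complex_of_real (l * h))"
  by (simp add: expo_def walk_Suc algebra_simps flip: exp_add)

lemma norm_expo_below:
  assumes "0 \<le> \<theta>" "0 \<le> l" "below c x j"
  shows "norm (expo (Complex \<theta> \<mu>) l j x) \<le> exp (\<theta> * c)"
proof -
  have "\<theta> * walk x j - l * h * real j \<le> \<theta> * c"
  proof -
    have "\<theta> * walk x j \<le> \<theta> * c"
      using assms by (intro mult_left_mono) (auto simp: below_def less_imp_le)
    moreover have "0 \<le> l * h * real j" using assms h_pos by simp
    ultimately show ?thesis by simp
  qed
  then show ?thesis by (simp add: expo_def)
qed

text \<open>
  The factor \<open>V\<close> is known at time \<open>k\<close>.  It is what allows a sum over the times before the exit to be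
  treated term by term: for real \<open>z\<close> with \<open>z\<^sup>2 / 2 = l\<close> the stopped exponential may be replaced by its
  value at time \<open>k\<close>.
\<close>

proposition optional_stopping:
  fixes V :: "(nat \<Rightarrow> real) \<Rightarrow> complex" and \<theta> \<mu> l c C :: real
  assumes V: "V \<in> borel_measurable (PiM {..<k} (\<lambda>_. borel))"
    and past: "\<And>x. V (restrict x {..<k}) = V x" and bound: "\<And>x. norm (V x) \<le> C"
    and nonneg: "0 \<le> \<theta>" "0 \<le> l" and kn: "k \<le> n"
  defines "z \<equiv> Complex \<theta> \<mu>"
  shows "integrable M (\<lambda>\<omega>. V (steps \<omega>) * of_bool (below c (steps \<omega>) k) * expo z l (exit_index c n (steps \<omega>)) (steps \<omega>))"
    and "(LINT \<omega>|M. V (steps \<omega>) * of_bool (below c (steps \<omega>) k) * expo z l (exit_index c n (steps \<omega>)) (steps \<omega>))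
       = (LINT \<omega>|M. V (steps \<omega>) * of_bool (below c (steps \<omega>) k) * expo z l k (steps \<omega>))
        + (exp (z\<^sup>2 * h / 2 - l * h) - 1) * (\<Sum>j\<in>{k..<n}. LINT \<omega>|M. V (steps \<omega>) * of_bool (below c (steps \<omega>) j) * expo z l j (steps \<omega>))"
proof -
  define Z where "Z j x = V x * of_bool (below c x j) * expo z l j x" for j x
  have C: "0 \<le> C" using bound[of undefined] norm_ge_zero order_trans by blast
  have Z_meas: "Z j \<in> borel_measurable (PiM {..<j} (\<lambda>_. borel))" if "k \<le> j" for j
  proof -
    have "(\<lambda>x. V (restrict x {..<k})) \<in> borel_measurable (PiM {..<j} (\<lambda>_. borel))"
      by (rule measurable_compose[OF measurable_restrict_subset V]) (use that in auto)
    then have [measurable]: "V \<in> borel_measurable (PiM {..<j} (\<lambda>_. borel))" by (simp add: past)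
    note [measurable] = measurable_below_PiM[of j j c, OF order_refl] measurable_walk_PiM[of j j, OF order_refl]
    show ?thesis unfolding Z_def expo_def by measurable
  qed
  have Z_past: "Z j (restrict x {..<j}) = Z j x" if "k \<le> j" for j x
  proof -
    have "V (restrict x {..<j}) = V x"
    proof -
      have "restrict (restrict x {..<j}) {..<k} = restrict x {..<k}" using that by auto
      then show ?thesis by (metis past)
    qed
    then show ?thesis by (simp add: Z_def below_restrict expo_def walk_restrict)
  qed
  have Z_bound: "norm (Z j x) \<le> C * exp (\<theta> * c)" for j x
    using norm_expo_below[OF nonneg, where c=c and x=x and j=j and \<mu>=\<mu>] bound[of x] C
    by (auto simp: Z_def norm_mult z_def intro!: mult_mono)
  have step: "integrable M (\<lambda>\<omega>. Z j (steps \<omega>))"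
    "integrable M (\<lambda>\<omega>. Z j (steps \<omega>) * exp (z * X j \<omega>))"
    "(LINT \<omega>|M. Z j (steps \<omega>) * exp (z * X j \<omega>)) = (LINT \<omega>|M. Z j (steps \<omega>)) * exp (z\<^sup>2 * h / 2)"
    if "k \<le> j" for j
    unfolding z_def using independent_step[OF Z_meas[OF that] Z_past[OF that] Z_bound] by blast+
  \<comment> \<open>Since the walk is below the level up to time j, the increment is a bounded function of the
    past times a function of the next step.\<close>
  have inc: "V x * of_bool (below c x j) * (expo z l (Suc j) x - expo z l j x)
      = exp (- complex_of_real (l * h)) * (Z j x * exp (z * x j)) - Z j x" for j x
    by (simp add: Z_def expo_Suc algebra_simps)
  have inc_int: "integrable M (\<lambda>\<omega>. V (steps \<omega>) * of_bool (below c (steps \<omega>) j) * (expo z l (Suc j) (steps \<omega>) - expo z l j (steps \<omega>)))"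
    and inc_eq: "(LINT \<omega>|M. V (steps \<omega>) * of_bool (below c (steps \<omega>) j) * (expo z l (Suc j) (steps \<omega>) - expo z l j (steps \<omega>)))
      = (exp (z\<^sup>2 * h / 2 - l * h) - 1) * (LINT \<omega>|M. Z j (steps \<omega>))" if "k \<le> j" for j
  proof -
    note s = step[OF that]
    have factor: "exp (z\<^sup>2 * h / 2 - l * h) = exp (- complex_of_real (l * h)) * exp (z\<^sup>2 * h / 2)"
      by (simp flip: exp_add)
    show "integrable M (\<lambda>\<omega>. V (steps \<omega>) * of_bool (below c (steps \<omega>) j) * (expo z l (Suc j) (steps \<omega>) - expo z l j (steps \<omega>)))"
      unfolding inc using s by (intro Bochner_Integration.integrable_diff integrable_mult_right) auto
    show "(LINT \<omega>|M. V (steps \<omega>) * of_bool (below c (steps \<omega>) j) * (expo z l (Suc j) (steps \<omega>) - expo z l j (steps \<omega>)))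
      = (exp (z\<^sup>2 * h / 2 - l * h) - 1) * (LINT \<omega>|M. Z j (steps \<omega>))"
      unfolding inc using s(1,2)
      by (subst Bochner_Integration.integral_diff) (auto simp: s(3) factor[simplified] left_diff_distrib)
  qed
  have expand: "V x * of_bool (below c x k) * expo z l (exit_index c n x) x
     = Z k x + (\<Sum>j\<in>{k..<n}. V x * of_bool (below c x j) * (expo z l (Suc j) x - expo z l j x))" for x
  proof (cases "below c x k")
    case True
    then show ?thesis
      by (simp add: Z_def stopped_expansion[OF True kn, of "\<lambda>i. expo z l i x"] algebra_simps sum_distrib_left)
  next
    case False
    then have "\<not> below c x j" if "k \<le> j" for j using below_mono that by blast
    then show ?thesis using False by (simp add: Z_def)
  qed
  show "integrable M (\<lambda>\<omega>. V (steps \<omega>) * of_bool (below c (steps \<omega>) k) * expo z l (exit_index c n (steps \<omega>)) (steps \<omega>))"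
    unfolding expand using inc_int step(1)[of k]
    by (intro Bochner_Integration.integrable_add Bochner_Integration.integrable_sum) auto
  show "(LINT \<omega>|M. V (steps \<omega>) * of_bool (below c (steps \<omega>) k) * expo z l (exit_index c n (steps \<omega>)) (steps \<omega>))
       = (LINT \<omega>|M. V (steps \<omega>) * of_bool (below c (steps \<omega>) k) * expo z l k (steps \<omega>))
        + (exp (z\<^sup>2 * h / 2 - l * h) - 1) * (\<Sum>j\<in>{k..<n}. LINT \<omega>|M. V (steps \<omega>) * of_bool (below c (steps \<omega>) j) * expo z l j (steps \<omega>))"
    unfolding expand using inc_int step(1)[of k]
    by (subst Bochner_Integration.integral_add)
       (auto simp: Bochner_Integration.integral_sum inc_eq sum_distrib_left Z_def)
qed

lemma norm_expo: "norm (expo (Complex \<theta> \<mu>) l k x) = exp (\<theta> * walk x k - l * h * real k)"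
  by (simp add: expo_def)

text \<open>
  Both sides are evaluated with the same \<open>l\<close>.  For \<open>\<mu> = 0\<close> the exponential is a martingale, so in the
  sum over \<open>k < K\<close> its stopped value may be pulled back to time \<open>k\<close>, where multiplication by
  \<open>exp (\<i> \<mu> walk)\<close> turns \<open>\<theta>\<close> into \<open>\<theta> + \<i> \<mu>\<close>; the resulting sum is the compensator of the stopped
  exponential with complex exponent.
\<close>

proposition walk_optional_stopping:
  fixes \<theta> \<mu> c :: real and n :: nat
  assumes \<theta>: "0 \<le> \<theta>" and c: "0 < c"
  defines "l \<equiv> \<theta>\<^sup>2 / 2" and "K \<equiv> \<lambda>\<omega>. exit_index c n (steps \<omega>)"
  shows "integrable M (\<lambda>\<omega>. expo (Complex \<theta> 0) l (K \<omega>) (steps \<omega>) * (\<Sum>k<K \<omega>. iexp (\<mu> * walk (steps \<omega>) k)))"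
    and "integrable M (\<lambda>\<omega>. expo (Complex \<theta> \<mu>) l (K \<omega>) (steps \<omega>))"
    and "(LINT \<omega>|M. expo (Complex \<theta> \<mu>) l (K \<omega>) (steps \<omega>)) - 1
      = (exp ((\<i> * \<mu> * \<theta> - \<mu>\<^sup>2 / 2) * h) - 1) *
        (LINT \<omega>|M. expo (Complex \<theta> 0) l (K \<omega>) (steps \<omega>) * (\<Sum>k<K \<omega>. iexp (\<mu> * walk (steps \<omega>) k)))"
proof -
  have l: "0 \<le> l" by (simp add: l_def)
  define V where "V k x = iexp (\<mu> * walk x k)" for k x
  have V_meas: "V k \<in> borel_measurable (PiM {..<k} (\<lambda>_. borel))" for k
  proof -
    note [measurable] = measurable_walk_PiM[of k k, OF order_refl]
    show ?thesis unfolding V_def by measurable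
  qed
  have V_past: "V k (restrict x {..<k}) = V k x" for k x
    by (simp add: V_def walk_restrict)
  have V_bound: "norm (V k x) \<le> 1" for k x by (simp add: V_def)
  have tilt: "V k x * expo (Complex \<theta> 0) l k x = expo (Complex \<theta> \<mu>) l k x" for k x
  proof -
    have "\<i> * complex_of_real (\<mu> * walk x k) + (Complex \<theta> 0 * complex_of_real (walk x k) - complex_of_real (l * h * real k))
      = Complex \<theta> \<mu> * complex_of_real (walk x k) - complex_of_real (l * h * real k)"
      by (simp add: complex_eq_iff)
    then show ?thesis unfolding V_def expo_def by (simp only: flip: exp_add)
  qed
  have mart: "exp ((Complex \<theta> 0)\<^sup>2 * h / 2 - l * h) - 1 = (0::complex)"
  proof -
    have "(Complex \<theta> 0)\<^sup>2 * h / 2 - l * h = 0"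
      by (simp add: l_def complex_eq_iff power2_eq_square)
    then show ?thesis by (metis cancel_comm_monoid_add_class.diff_cancel exp_zero)
  qed
  have expand: "expo (Complex \<theta> 0) l (K \<omega>) (steps \<omega>) * (\<Sum>k<K \<omega>. iexp (\<mu> * walk (steps \<omega>) k))
     = (\<Sum>k<n. V k (steps \<omega>) * of_bool (below c (steps \<omega>) k) * expo (Complex \<theta> 0) l (K \<omega>) (steps \<omega>))" for \<omega>
  proof -
    have "(\<Sum>k<K \<omega>. iexp (\<mu> * walk (steps \<omega>) k)) = (\<Sum>k<n. V k (steps \<omega>) * of_bool (below c (steps \<omega>) k))"
      unfolding V_def K_def using exit_index_le[of c n "steps \<omega>"]
      by (intro sum.mono_neutral_cong_left) (auto simp: less_exit_index_iff dest!: leD)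
    then show ?thesis
      unfolding sum_distrib_left[symmetric] sum_distrib_right[symmetric] by (simp only: mult.commute)
  qed
  have int: "integrable M (\<lambda>\<omega>. V k (steps \<omega>) * of_bool (below c (steps \<omega>) k) * expo (Complex \<theta> 0) l (K \<omega>) (steps \<omega>))" (is ?A)
    and eq: "(LINT \<omega>|M. V k (steps \<omega>) * of_bool (below c (steps \<omega>) k) * expo (Complex \<theta> 0) l (K \<omega>) (steps \<omega>))
      = (LINT \<omega>|M. of_bool (below c (steps \<omega>) k) * expo (Complex \<theta> \<mu>) l k (steps \<omega>))" (is ?B) if "k < n" for k
  proof -
    note os = optional_stopping(1,2)[OF V_meas V_past V_bound \<theta> l less_imp_le[OF that], where c=c and \<mu>=0]
    show ?A using os(1) by (simp add: K_def)
    have at_k: "V k x * of_bool (below c x k) * expo (Complex \<theta> 0) l k x = of_bool (below c x k) * expo (Complex \<theta> \<mu>) l k x" for x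
      unfolding tilt[symmetric] by (simp add: mult_ac)
    show ?B using os(2) unfolding mart K_def at_k by simp
  qed
  show "integrable M (\<lambda>\<omega>. expo (Complex \<theta> 0) l (K \<omega>) (steps \<omega>) * (\<Sum>k<K \<omega>. iexp (\<mu> * walk (steps \<omega>) k)))"
    unfolding expand using int by auto
  have S: "(LINT \<omega>|M. expo (Complex \<theta> 0) l (K \<omega>) (steps \<omega>) * (\<Sum>k<K \<omega>. iexp (\<mu> * walk (steps \<omega>) k)))
    = (\<Sum>k<n. LINT \<omega>|M. of_bool (below c (steps \<omega>) k) * expo (Complex \<theta> \<mu>) l k (steps \<omega>))"
    unfolding expand using int by (subst Bochner_Integration.integral_sum) (auto simp: eq)
  have one: "(\<lambda>_. 1::complex) \<in> borel_measurable (PiM {..<0} (\<lambda>_. borel :: real measure))" by simp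
  note os = optional_stopping(1,2)[where V="\<lambda>_. 1" and k=0 and n=n and c=c and \<theta>=\<theta> and \<mu>=\<mu> and l=l and C=1,
      OF one refl norm_one[THEN eq_refl] \<theta> l le0]
  show "integrable M (\<lambda>\<omega>. expo (Complex \<theta> \<mu>) l (K \<omega>) (steps \<omega>))"
    using os(1) c by (simp add: below_0 K_def)
  have rate: "(Complex \<theta> \<mu>)\<^sup>2 * complex_of_real h / 2 - l * h = (\<i> * \<mu> * \<theta> - \<mu>\<^sup>2 / 2) * h"
    by (simp add: l_def complex_eq_iff power2_eq_square field_simps)
  have "(LINT \<omega>|M. expo (Complex \<theta> \<mu>) l 0 (steps \<omega>)) = 1"
    by (simp add: expo_def walk_def prob_space)
  then show "(LINT \<omega>|M. expo (Complex \<theta> \<mu>) l (K \<omega>) (steps \<omega>)) - 1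
      = (exp ((\<i> * \<mu> * \<theta> - \<mu>\<^sup>2 / 2) * h) - 1) *
        (LINT \<omega>|M. expo (Complex \<theta> 0) l (K \<omega>) (steps \<omega>) * (\<Sum>k<K \<omega>. iexp (\<mu> * walk (steps \<omega>) k)))"
    unfolding S using os(2) c unfolding rate by (simp add: below_0 K_def atLeast0LessThan)
qed

text \<open>
  The square is the martingale with parameter \<open>2 \<theta>\<close> times a factor that is bounded because the walk is
  stopped by time \<open>n\<close>.  The bound does not depend on the grid when \<open>h n\<close> is fixed, which is how the
  overshoot above the level is controlled.
\<close>

lemma stopped_second_moment:
  fixes \<theta> c :: real and n :: nat
  assumes \<theta>: "0 \<le> \<theta>" and c: "0 < c"
  defines "K \<equiv> \<lambda>\<omega>. exit_index c n (steps \<omega>)"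
  shows "integrable M (\<lambda>\<omega>. (exp (\<theta> * walk (steps \<omega>) (K \<omega>) - \<theta>\<^sup>2 / 2 * h * K \<omega>))\<^sup>2)"
    and "(LINT \<omega>|M. (exp (\<theta> * walk (steps \<omega>) (K \<omega>) - \<theta>\<^sup>2 / 2 * h * K \<omega>))\<^sup>2) \<le> exp (\<theta>\<^sup>2 * h * n)"
proof -
  define g where "g \<omega> = exp (2 * \<theta> * walk (steps \<omega>) (K \<omega>) - (2*\<theta>)\<^sup>2 / 2 * h * K \<omega>)" for \<omega>
  have K_eq: "exit_index c n (steps \<omega>) = K \<omega>" for \<omega> by (simp add: K_def)
  have ex: "expo (Complex (2*\<theta>) 0) ((2*\<theta>)\<^sup>2/2) (K \<omega>) (steps \<omega>) = complex_of_real (g \<omega>)" for \<omega>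
  proof -
    have "Complex (2*\<theta>) 0 = complex_of_real (2*\<theta>)" by (simp add: complex_eq_iff)
    then show ?thesis by (simp add: expo_def g_def flip: exp_of_real)
  qed
  have int: "integrable M g" 
    using walk_optional_stopping(2)[of "2 * \<theta>" c 0 n] \<theta> c unfolding K_eq ex
    by (simp add: complex_of_real_integrable_eq)
  have E: "(LINT \<omega>|M. g \<omega>) = 1"
  proof -
    have "complex_of_real (LINT \<omega>|M. g \<omega>) - 1 = 0"
      using walk_optional_stopping(3)[of "2 * \<theta>" c 0 n] \<theta> c unfolding K_eq ex by simp
    then show ?thesis by (metis eq_iff_diff_eq_0 of_real_eq_1_iff)
  qed
  have le: "(exp (\<theta> * walk (steps \<omega>) (K \<omega>) - \<theta>\<^sup>2 / 2 * h * K \<omega>))\<^sup>2 \<le> exp (\<theta>\<^sup>2 * h * n) * g \<omega>" for \<omega>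
  proof -
    have "\<theta>\<^sup>2 * h * K \<omega> \<le> \<theta>\<^sup>2 * h * n"
      using exit_index_le[of c n "steps \<omega>"] h_pos by (intro mult_left_mono) (auto simp: K_def)
    then show ?thesis by (simp add: g_def power2_eq_square field_simps flip: exp_add)
  qed
  have Km: "(\<lambda>\<omega>. (exp (\<theta> * walk (steps \<omega>) (K \<omega>) - \<theta>\<^sup>2 / 2 * h * K \<omega>))\<^sup>2) \<in> borel_measurable M"
  proof -
    have [measurable]: "(\<lambda>\<omega>. expo (Complex \<theta> 0) (\<theta>\<^sup>2/2) (K \<omega>) (steps \<omega>)) \<in> borel_measurable M"
      using walk_optional_stopping(2)[OF \<theta> c, of 0 n, THEN borel_measurable_integrable]
      unfolding K_def .
    have "(\<lambda>\<omega>. norm (expo (Complex \<theta> 0) (\<theta>\<^sup>2/2) (K \<omega>) (steps \<omega>))) \<in> borel_measurable M"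
      by measurable
    then show ?thesis unfolding norm_expo by measurable
  qed
  show i: "integrable M (\<lambda>\<omega>. (exp (\<theta> * walk (steps \<omega>) (K \<omega>) - \<theta>\<^sup>2 / 2 * h * K \<omega>))\<^sup>2)"
    by (rule Bochner_Integration.integrable_bound[OF integrable_mult_right[OF int, of "exp (\<theta>\<^sup>2 * h * n)"] Km])
       (use le in \<open>auto simp: g_def\<close>)
  have "(LINT \<omega>|M. (exp (\<theta> * walk (steps \<omega>) (K \<omega>) - \<theta>\<^sup>2 / 2 * h * K \<omega>))\<^sup>2) \<le> (LINT \<omega>|M. exp (\<theta>\<^sup>2 * h * n) * g \<omega>)"
    by (rule integral_mono[OF i]) (use int le in auto)
  then show "(LINT \<omega>|M. (exp (\<theta> * walk (steps \<omega>) (K \<omega>) - \<theta>\<^sup>2 / 2 * h * K \<omega>))\<^sup>2) \<le> exp (\<theta>\<^sup>2 * h * n)"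
    using E by simp
qed

end

section \<open>Convergence of expectations under an L2 bound\<close>

text \<open>
  Boundedness in the second moment replaces a dominating function: the part of the error that exceeds
  \<open>R\<close> contributes at most its second moment divided by \<open>R\<close>, and the truncated part converges boundedly.
\<close>

lemma (in finite_measure) tendsto_integral_L2_bounded:
  fixes f :: "nat \<Rightarrow> 'a \<Rightarrow> 'b :: {banach, second_countable_topology}"
  assumes [measurable]: "\<And>j. f j \<in> borel_measurable M" "g \<in> borel_measurable M"
    and lim: "AE x in M. (\<lambda>j. f j x) \<longlonglongrightarrow> g x"
    and sq_int: "\<And>j. integrable M (\<lambda>x. (norm (f j x))\<^sup>2)"
    and sq_le: "\<And>j. (LINT x|M. (norm (f j x))\<^sup>2) \<le> C"
  shows "integrable M g" and "(\<lambda>j. LINT x|M. f j x) \<longlonglongrightarrow> (LINT x|M. g x)"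
proof -
  have nn_sq: "(\<integral>\<^sup>+x. ennreal ((norm (f j x))\<^sup>2) \<partial>M) \<le> ennreal C" for j
    using nn_integral_eq_integral[OF sq_int[of j]] sq_le[of j] by (simp add: ennreal_leI)
  have "0 \<le> (LINT x|M. (norm (f 0 x))\<^sup>2)" by (rule integral_nonneg_AE) simp
  then have C: "0 \<le> C" using sq_le[of 0] by linarith
  have g_sq: "(\<integral>\<^sup>+x. ennreal ((norm (g x))\<^sup>2) \<partial>M) \<le> ennreal C"
  proof -
    have "(\<integral>\<^sup>+x. ennreal ((norm (g x))\<^sup>2) \<partial>M) = (\<integral>\<^sup>+x. liminf (\<lambda>j. ennreal ((norm (f j x))\<^sup>2)) \<partial>M)"
    proof (rule nn_integral_cong_AE, use lim in eventually_elim)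
      case (elim x)
      then have "(\<lambda>j. ennreal ((norm (f j x))\<^sup>2)) \<longlonglongrightarrow> ennreal ((norm (g x))\<^sup>2)"
        by (intro tendsto_intros)
      then show ?case by (rule lim_imp_Liminf[OF sequentially_bot, symmetric])
    qed
    also have "\<dots> \<le> liminf (\<lambda>j. \<integral>\<^sup>+x. ennreal ((norm (f j x))\<^sup>2) \<partial>M)"
      by (rule nn_integral_liminf) auto
    also have "\<dots> \<le> ennreal C"
      using nn_sq by (intro Liminf_le) auto
    finally show ?thesis .
  qed
  have g_sq_int: "integrable M (\<lambda>x. (norm (g x))\<^sup>2)"
    using g_sq by (intro integrableI_bounded) (auto simp: less_top[symmetric] top_unique)
  have int_of_sq: "integrable M u" if "u \<in> borel_measurable M" "integrable M (\<lambda>x. (norm (u x))\<^sup>2)" for u :: "'a \<Rightarrow> 'b"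
  proof (rule Bochner_Integration.integrable_bound[of _ "\<lambda>x. 1 + (norm (u x))\<^sup>2"])
    have "y \<le> 1 + y\<^sup>2" if "0 \<le> y" for y :: real
      using sum_power2_ge_zero[of "y - 1" 0] that by (simp add: power2_eq_square algebra_simps)
    then show "AE x in M. norm (u x) \<le> norm (1 + (norm (u x))\<^sup>2)" by auto
  qed (use that in auto)
  show g_int: "integrable M g" by (rule int_of_sq) (use g_sq_int in auto)
  have f_int: "integrable M (f j)" for j by (rule int_of_sq) (use sq_int in auto)
  define d where "d j x = norm (f j x - g x)" for j x
  have d_le: "(d j x)\<^sup>2 \<le> 2 * (norm (f j x))\<^sup>2 + 2 * (norm (g x))\<^sup>2" for j x
  proof -
    have "(d j x)\<^sup>2 \<le> (norm (f j x) + norm (g x))\<^sup>2"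
      unfolding d_def by (intro power_mono norm_triangle_ineq4) auto
    also have "\<dots> \<le> 2 * (norm (f j x))\<^sup>2 + 2 * (norm (g x))\<^sup>2"
      using sum_power2_ge_zero[of "norm (f j x) - norm (g x)" 0] by (simp add: power2_eq_square algebra_simps)
    finally show ?thesis .
  qed
  have g_sq_le: "(LINT x|M. (norm (g x))\<^sup>2) \<le> C"
    using g_sq C nn_integral_eq_integral[OF g_sq_int] by simp
  have d_meas [measurable]: "d j \<in> borel_measurable M" for j unfolding d_def by measurable
  have d_sq_int: "integrable M (\<lambda>x. (d j x)\<^sup>2)" for j
    by (rule Bochner_Integration.integrable_bound[of _ "\<lambda>x. 2 * (norm (f j x))\<^sup>2 + 2 * (norm (g x))\<^sup>2"])
       (use d_le sq_int g_sq_int in auto)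
  have d_int: "integrable M (d j)" for j unfolding d_def using f_int g_int by auto
  have d_sq: "(LINT x|M. (d j x)\<^sup>2) \<le> 4 * C" for j
  proof -
    have "(LINT x|M. (d j x)\<^sup>2) \<le> (LINT x|M. 2 * (norm (f j x))\<^sup>2 + 2 * (norm (g x))\<^sup>2)"
      by (rule integral_mono) (use d_sq_int sq_int g_sq_int d_le in auto)
    also have "\<dots> \<le> 4 * C" using sq_int g_sq_int sq_le[of j] g_sq_le by simp
    finally show ?thesis .
  qed
  have "(\<lambda>j. LINT x|M. d j x) \<longlonglongrightarrow> 0"
  proof (rule LIMSEQ_I)
    fix e :: real assume e: "0 < e"
    \<comment> \<open>Chosen so that the part above R, at most 4 C / R, is at most e / 2.\<close>
    define R where "R = (8 * C + 1) / e"
    have R: "0 < R" using e C by (simp add: R_def)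
    have "(\<lambda>j. LINT x|M. min (d j x) R) \<longlonglongrightarrow> (LINT x|M. 0)"
    proof (rule integral_dominated_convergence[where w="\<lambda>_. R"])
      show "AE x in M. (\<lambda>j. min (d j x) R) \<longlonglongrightarrow> 0"
        using lim
      proof eventually_elim
        case (elim x)
        have "(\<lambda>j. min (norm (f j x - g x)) R) \<longlonglongrightarrow> min (norm (g x - g x)) R"
          using elim by (intro tendsto_intros)
        then show ?case using R by (simp add: d_def)
      qed
    qed (use R in \<open>auto simp: d_def\<close>)
    then obtain j0 where "\<forall>j\<ge>j0. norm ((LINT x|M. min (d j x) R) - (LINT x|M. 0)) < e / 2"
      using LIMSEQ_D[of _ _ "e/2"] e by (meson half_gt_zero)
    then have j0: "\<bar>LINT x|M. min (d j x) R\<bar> < e / 2" if "j \<ge> j0" for j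
      using that by simp
    have "(LINT x|M. d j x) < e" if "j \<ge> j0" for j
    proof -
      have pt: "d j x \<le> min (d j x) R + (d j x)\<^sup>2 / R" for x
      proof (cases "d j x \<le> R")
        case True then show ?thesis using R by simp
      next
        case False
        then have "d j x * R \<le> d j x * d j x" using R by (intro mult_left_mono) auto
        then have "d j x \<le> (d j x)\<^sup>2 / R" using R by (simp add: power2_eq_square pos_le_divide_eq)
        then show ?thesis using R d_def[of j x] norm_ge_zero[of "f j x - g x"] by linarith
      qed
      have "(LINT x|M. d j x) \<le> (LINT x|M. min (d j x) R + (d j x)\<^sup>2 / R)"
        by (rule integral_mono[OF d_int _ pt]) (use d_sq_int d_int in auto)
      also have "\<dots> = (LINT x|M. min (d j x) R) + (LINT x|M. (d j x)\<^sup>2) / R"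
        using d_sq_int d_int by (subst Bochner_Integration.integral_add) auto
      also have "\<dots> < e / 2 + 4 * C / R"
        using j0[OF that] divide_right_mono[OF d_sq[of j], of R] R by linarith
      also have "4 * C / R \<le> e / 2" using e C R by (simp add: R_def field_simps)
      finally show ?thesis by simp
    qed
    moreover have "0 \<le> (LINT x|M. d j x)" for j by (rule integral_nonneg_AE) (simp add: d_def)
    ultimately show "\<exists>no. \<forall>n\<ge>no. norm ((LINT x|M. d n x) - 0) < e" by auto
  qed
  then have "(\<lambda>j. (LINT x|M. f j x) - (LINT x|M. g x)) \<longlonglongrightarrow> 0"
  proof (rule Lim_null_comparison[rotated], intro always_eventually allI)
    fix j
    have "norm ((LINT x|M. f j x) - (LINT x|M. g x)) = norm (LINT x|M. f j x - g x)"
      using f_int g_int by simp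
    also have "\<dots> \<le> (LINT x|M. d j x)" unfolding d_def by (rule integral_norm_bound)
    finally show "norm ((LINT x|M. f j x) - (LINT x|M. g x)) \<le> (LINT x|M. d j x)" .
  qed
  then show "(\<lambda>j. LINT x|M. f j x) \<longlonglongrightarrow> (LINT x|M. g x)" by (simp add: LIM_zero_iff)
qed

section \<open>Dyadic exit times of a continuous path\<close>

definition increments :: "(real \<Rightarrow> real) \<Rightarrow> real \<Rightarrow> nat \<Rightarrow> real" where
  "increments w h i = w (real (Suc i) * h) - w (real i * h)"

lemma walk_increments: "walk (increments w h) k = w (real k * h) - w 0"
  by (induction k) (simp_all add: walk_def increments_def)

text \<open>
  The first dyadic point \<open>k t / 2^j\<close> of \<open>{0..t}\<close> at which the path is at least \<open>c\<close>, and \<open>t\<close> if there is none.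
\<close>

definition dyadic_exit :: "(real \<Rightarrow> real) \<Rightarrow> real \<Rightarrow> real \<Rightarrow> nat \<Rightarrow> real" where
  "dyadic_exit w c t j = real (exit_index c (2^j) (increments w (t / 2^j))) * (t / 2^j)"

lemma below_increments:
  "w 0 = 0 \<Longrightarrow> below c (increments w h) k \<longleftrightarrow> (\<forall>i\<le>k. w (real i * h) < c)"
  by (simp add: below_def walk_increments)

lemma dyadic_exit_nonneg: "0 \<le> t \<Longrightarrow> 0 \<le> dyadic_exit w c t j"
  by (simp add: dyadic_exit_def)

lemma dyadic_exit_le: assumes "0 \<le> t" shows "dyadic_exit w c t j \<le> t"
proof -
  have "real (exit_index c (2^j) (increments w (t / 2^j))) \<le> 2^j"
    using exit_index_le[of c "2^j"] by (metis of_nat_le_iff of_nat_numeral of_nat_power)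
  then have "dyadic_exit w c t j \<le> 2^j * (t / 2^j)"
    unfolding dyadic_exit_def using assms by (intro mult_right_mono) auto
  then show ?thesis by simp
qed

lemma below_dyadic_exit:
  assumes "w 0 = 0" "0 < t" "real k * (t / 2^j) < dyadic_exit w c t j"
  shows "w (real k * (t / 2^j)) < c"
proof -
  have "k < exit_index c (2^j) (increments w (t / 2^j))"
    using assms by (simp add: dyadic_exit_def mult_less_cancel_right divide_less_cancel)
  then show ?thesis using assms(1) by (auto simp: less_exit_index_iff below_increments)
qed

lemma dyadic_exit_above:
  assumes "w 0 = 0" "0 < t" "dyadic_exit w c t j < t"
  shows "c \<le> w (dyadic_exit w c t j)"
proof (rule ccontr)
  let ?x = "increments w (t / 2^j)"
  let ?K = "exit_index c (2^j) ?x"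
  assume "\<not> ?thesis"
  then have K: "w (real ?K * (t / 2^j)) < c" by (simp add: dyadic_exit_def)
  have "?K < 2^j"
  proof (rule ccontr)
    assume "\<not> ?K < 2^j"
    then have "?K = 2^j" using exit_index_le[of c "2^j" ?x] by simp
    then show False using assms by (simp add: dyadic_exit_def)
  qed
  moreover have "below c ?x ?K"
    unfolding below_increments[of w, OF assms(1)]
  proof (intro allI impI)
    fix i assume "i \<le> ?K"
    then consider "i = ?K" | "i < ?K" by linarith
    then show "w (real i * (t / 2^j)) < c"
    proof cases
      case 2
      then show ?thesis using less_exit_index_iff[of i c "2^j" ?x] by (auto simp: below_increments assms)
    qed (use K in simp)
  qed
  ultimately show False using less_exit_index_iff[of ?K c "2^j" ?x] by simp
qed

text \<open>
  Each grid contains the previous one, so an exit on the coarse grid is seen on the fine one.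
\<close>

lemma dyadic_exit_decreasing:
  assumes "w 0 = 0" "0 < t"
  shows "dyadic_exit w c t (Suc j) \<le> dyadic_exit w c t j"
proof -
  let ?K = "\<lambda>j. exit_index c (2^j) (increments w (t / 2^j))"
  have "\<not> 2 * ?K j < ?K (Suc j)"
  proof
    assume "2 * ?K j < ?K (Suc j)"
    then have 1: "2 * ?K j < 2^Suc j" and 2: "\<And>i. i \<le> 2 * ?K j \<Longrightarrow> w (real i * (t / 2^Suc j)) < c"
      using assms(1) by (auto simp: less_exit_index_iff below_increments)
    have "w (real i * (t / 2^j)) < c" if "i \<le> ?K j" for i
      using 2[of "2*i"] that by (simp add: field_simps)
    then have "?K j < ?K j"
      using 1 assms(1) by (subst less_exit_index_iff) (auto simp: below_increments)
    then show False by simp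
  qed
  then have "real (?K (Suc j)) \<le> 2 * real (?K j)" by linarith
  then have "real (?K (Suc j)) * (t / 2^Suc j) \<le> 2 * real (?K j) * (t / 2^Suc j)"
    using assms by (intro mult_right_mono) auto
  then show ?thesis by (simp add: dyadic_exit_def)
qed

lemma dyadic_exit_convergent:
  assumes "w 0 = 0" "0 < t"
  shows "convergent (dyadic_exit w c t)"
proof -
  have "decseq (dyadic_exit w c t)"
    using dyadic_exit_decreasing[of w t c, OF assms] by (rule decseq_SucI)
  then obtain L where "dyadic_exit w c t \<longlonglongrightarrow> L"
    using decseq_convergent[of "dyadic_exit w c t" 0] dyadic_exit_nonneg assms(2) by (metis less_imp_le)
  then show ?thesis by (auto simp: convergent_def)
qed

text \<open>
  The limit need not be the hitting time of \<open>c\<close>: a path that only touches \<open>c\<close> may not be seen by the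
  grids.  It is, however, not earlier than the hitting time of \<open>c\<close> or the horizon (\<open>exit_limit_ge\<close>) and not
  later than any time at which the path exceeds \<open>c\<close> (\<open>exit_limit_le\<close>), and so it is located precisely enough
  once the level \<open>c\<close> is raised to \<open>a\<close>.
\<close>

definition exit_limit :: "(real \<Rightarrow> real) \<Rightarrow> real \<Rightarrow> real \<Rightarrow> real" where
  "exit_limit w c t = lim (dyadic_exit w c t)"

lemma dyadic_exit_tendsto:
  "w 0 = 0 \<Longrightarrow> 0 < t \<Longrightarrow> dyadic_exit w c t \<longlonglongrightarrow> exit_limit w c t"
  unfolding exit_limit_def using dyadic_exit_convergent convergent_LIMSEQ_iff by blast

lemma exit_limit_bounds:
  assumes "w 0 = 0" "0 < t"
  shows "0 \<le> exit_limit w c t" "exit_limit w c t \<le> t"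
  using LIMSEQ_le_const[OF dyadic_exit_tendsto[of w t c, OF assms]]
    LIMSEQ_le_const2[OF dyadic_exit_tendsto[of w t c, OF assms]]
    dyadic_exit_nonneg dyadic_exit_le assms by (meson less_imp_le)+

lemma exit_limit_ge:
  assumes "w 0 = 0" "0 < t" "u \<le> t" and below: "\<And>s. 0 \<le> s \<Longrightarrow> s < u \<Longrightarrow> w s < c"
  shows "u \<le> exit_limit w c t"
proof -
  have "u \<le> dyadic_exit w c t j" for j
  proof (rule ccontr)
    assume *: "\<not> ?thesis"
    then have "c \<le> w (dyadic_exit w c t j)" using assms by (intro dyadic_exit_above) auto
    moreover have "w (dyadic_exit w c t j) < c"
      using * assms(2) by (intro below dyadic_exit_nonneg) auto
    ultimately show False by simp
  qed
  then show ?thesis using LIMSEQ_le_const[OF dyadic_exit_tendsto[of w t c, OF assms(1,2)]] by blast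
qed

lemma exit_limit_le:
  assumes w: "continuous_on {0..} w" "w 0 = 0" and t: "0 < t" and u: "0 \<le> u" "c < w u"
  shows "exit_limit w c t \<le> u"
proof (cases "u < t")
  case True
  \<comment> \<open>The first grid point after u: it tends to u, so the path exceeds c there for large j.\<close>
  define s where "s j = real (nat \<lfloor>u / (t / 2^j)\<rfloor> + 1) * (t / 2^j)" for j :: nat
  have s_bounds: "u \<le> s j" "s j \<le> u + t / 2^j" for j
  proof -
    have h: "0 < t / 2^j" using t by simp
    have cancel: "(x / d + 1) * d = x + d" if "0 < d" for x d :: real using that by (simp add: distrib_right)
    have r: "real (nat \<lfloor>u / (t / 2^j)\<rfloor> + 1) = real_of_int \<lfloor>u / (t / 2^j)\<rfloor> + 1"
      using u t by simp
    have "u / (t / 2^j) \<le> real_of_int \<lfloor>u / (t / 2^j)\<rfloor> + 1" by linarith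
    then have "u / (t / 2^j) * (t / 2^j) \<le> s j" unfolding s_def r using h by (intro mult_right_mono) auto
    then show "u \<le> s j" using t by simp
    have "real_of_int \<lfloor>u / (t / 2^j)\<rfloor> + 1 \<le> u / (t / 2^j) + 1" by linarith
    then have "s j \<le> (u / (t / 2^j) + 1) * (t / 2^j)" unfolding s_def r using h by (intro mult_right_mono) auto
    also have "\<dots> = u + t / 2^j" by (rule cancel[OF h])
    finally show "s j \<le> u + t / 2^j" .
  qed
  have "(\<lambda>j. u + t * (1/2)^j) \<longlonglongrightarrow> u + t * 0" by (intro tendsto_intros) auto
  then have s_lim: "s \<longlonglongrightarrow> u"
    using s_bounds by (intro tendsto_sandwich[of "\<lambda>_. u" s sequentially "\<lambda>j. u + t * (1/2)^j"])
       (auto simp: power_divide)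
  have s_nonneg: "s j \<in> {0..}" for j using s_bounds(1)[of j] u by simp
  have "(\<lambda>j. w (s j)) \<longlonglongrightarrow> w u"
    using w(1) s_lim s_nonneg u by (intro continuous_on_tendsto_compose[of "{0..}" w]) auto
  then have ev: "\<forall>\<^sub>F j in sequentially. c < w (s j)" using u(2) by (rule order_tendstoD)
  have "\<forall>\<^sub>F j in sequentially. dyadic_exit w c t j \<le> s j"
    using ev
  proof eventually_elim
    case (elim j)
    show ?case
    proof (rule ccontr)
      assume "\<not> ?thesis"
      then have "w (s j) < c" unfolding s_def by (intro below_dyadic_exit[of w] w(2) t) simp
      then show False using elim by simp
    qed
  qed
  then show ?thesis
    by (rule tendsto_le[OF sequentially_bot s_lim dyadic_exit_tendsto[of w t c, OF w(2) t]])
next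
  case False
  then show ?thesis using exit_limit_bounds(2)[of w t c, OF w(2) t] by linarith
qed

lemma left_sum_integral_error:
  fixes y :: "real \<Rightarrow> complex"
  assumes y: "continuous_on {0..t} y" and h: "0 < h" "real K * h \<le> t"
    and osc: "\<And>r s. r \<in> {0..t} \<Longrightarrow> s \<in> {0..t} \<Longrightarrow> \<bar>r - s\<bar> \<le> h \<Longrightarrow> norm (y r - y s) \<le> e"
  shows "norm ((\<Sum>k<K. h *\<^sub>R y (real k * h)) - integral {0..real K * h} y) \<le> e * (real K * h)"
  using h(2)
proof (induction K)
  case (Suc K)
  let ?a = "real K * h" and ?b = "real (Suc K) * h"
  have ab: "0 \<le> ?a" "?a \<le> ?b" "?b \<le> t" "?b - ?a = h" using Suc.prems h by (auto simp: algebra_simps)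
  have int: "y integrable_on {u..v}" if "0 \<le> u" "v \<le> t" for u v
    using that by (intro integrable_continuous_real continuous_on_subset[OF y]) auto
  have split: "integral {0..?b} y = integral {0..?a} y + integral {?a..?b} y"
    using ab int by (intro Henstock_Kurzweil_Integration.integral_combine[symmetric]) auto
  have "((\<lambda>s. y ?a - y s) has_integral (h *\<^sub>R y ?a - integral {?a..?b} y)) {?a..?b}"
    using has_integral_diff[OF has_integral_const_real[of "y ?a" ?a ?b] integrable_integral[OF int[of ?a ?b]]] ab
    by simp
  then have "norm (h *\<^sub>R y ?a - integral {?a..?b} y) \<le> e * measure lborel {?a..?b}"
  proof (rule has_integral_bound_real[rotated 2])
    show "norm (y ?a - y s) \<le> e" if "s \<in> {?a..?b} - {}" for s
    proof (rule osc)
      have "?a \<le> s" "s \<le> ?b" using that by auto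
      then show "?a \<in> {0..t}" "s \<in> {0..t}" "\<bar>?a - s\<bar> \<le> h"
        unfolding atLeastAtMost_iff using ab by linarith+
    qed
    show "0 \<le> e" using osc[of ?a ?a] ab h by auto
  qed simp
  then have piece: "norm (h *\<^sub>R y ?a - integral {?a..?b} y) \<le> e * h" using ab by simp
  have "norm ((\<Sum>k<Suc K. h *\<^sub>R y (real k * h)) - integral {0..?b} y)
    = norm (((\<Sum>k<K. h *\<^sub>R y (real k * h)) - integral {0..?a} y) + (h *\<^sub>R y ?a - integral {?a..?b} y))"
    unfolding split by (simp add: algebra_simps)
  also have "\<dots> \<le> e * ?a + e * h"
    using norm_triangle_mono[OF Suc.IH piece] ab by simp
  finally show ?case by (simp add: algebra_simps)
qed simp

text \<open>
  The upper limit of integration varies with the grid; uniform continuity makes the error of the left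
  sums uniform in it.
\<close>

lemma left_sums_tendsto:
  fixes y :: "real \<Rightarrow> complex" and K :: "nat \<Rightarrow> nat"
  assumes y: "continuous_on {0..t} y" and t: "0 < t"
    and K: "\<And>j. real (K j) * (t / 2^j) \<le> t" "(\<lambda>j. real (K j) * (t / 2^j)) \<longlonglongrightarrow> R"
  shows "(\<lambda>j. \<Sum>k<K j. (t / 2^j) *\<^sub>R y (real k * (t / 2^j))) \<longlonglongrightarrow> integral {0..R} y"
proof -
  let ?r = "\<lambda>j. real (K j) * (t / 2^j)"
  have R: "0 \<le> R" "R \<le> t"
    using LIMSEQ_le_const[OF K(2)] LIMSEQ_le_const2[OF K(2)] K(1) t by auto
  have "continuous_on {0..t} (\<lambda>r. integral {0..r} y)"
    by (intro indefinite_integral_continuous_1 integrable_continuous_real y)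
  then have int_lim: "(\<lambda>j. integral {0..?r j} y) \<longlonglongrightarrow> integral {0..R} y"
    using K R t by (intro continuous_on_tendsto_compose[of "{0..t}" "\<lambda>r. integral {0..r} y"]) auto
  have h_lim: "(\<lambda>j. t / 2^j) \<longlonglongrightarrow> 0"
  proof -
    have "(\<lambda>j. t * (1/2)^j) \<longlonglongrightarrow> t * 0" by (intro tendsto_intros) auto
    then show ?thesis by (simp add: power_divide)
  qed
  have "(\<lambda>j. (\<Sum>k<K j. (t / 2^j) *\<^sub>R y (real k * (t / 2^j))) - integral {0..?r j} y) \<longlonglongrightarrow> 0"
  proof (rule LIMSEQ_I)
    fix e :: real assume "0 < e"
    define d where "d = e / (2 * t)"
    have d: "0 < d" using \<open>0 < e\<close> t by (simp add: d_def)
    have "uniformly_continuous_on {0..t} y" by (rule compact_uniformly_continuous[OF y]) simp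
    then obtain \<eta> where \<eta>: "0 < \<eta>" "\<And>r s. r \<in> {0..t} \<Longrightarrow> s \<in> {0..t} \<Longrightarrow> dist s r < \<eta> \<Longrightarrow> dist (y s) (y r) < d"
      using d unfolding uniformly_continuous_on_def by metis
    have "\<forall>\<^sub>F j in sequentially. t / 2^j < \<eta>" using h_lim \<eta>(1) by (rule order_tendstoD)
    then obtain j0 where j0: "\<And>j. j \<ge> j0 \<Longrightarrow> t / 2^j < \<eta>" by (auto simp: eventually_sequentially)
    show "\<exists>j0. \<forall>j\<ge>j0. norm ((\<Sum>k<K j. (t / 2^j) *\<^sub>R y (real k * (t / 2^j))) - integral {0..?r j} y - 0) < e"
    proof (intro exI allI impI)
      fix j assume j: "j0 \<le> j"
      have "norm ((\<Sum>k<K j. (t / 2^j) *\<^sub>R y (real k * (t / 2^j))) - integral {0..?r j} y) \<le> d * ?r j"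
        using j0[OF j] t
        by (intro left_sum_integral_error[OF y _ K(1)])
           (auto intro!: less_imp_le \<eta>(2)[unfolded dist_norm] simp: dist_real_def)
      also have "\<dots> \<le> d * t" using d K(1) by (intro mult_left_mono) auto
      also have "\<dots> < e" using \<open>0 < e\<close> t by (simp add: d_def)
      finally show "norm ((\<Sum>k<K j. (t / 2^j) *\<^sub>R y (real k * (t / 2^j))) - integral {0..?r j} y - 0) < e" by simp
    qed
  qed
  from tendsto_add[OF this int_lim] show ?thesis by simp
qed

lemma hitting_time_attained:
  fixes w :: "real \<Rightarrow> real"
  assumes w: "continuous_on {0..} w" "w 0 = 0" and a: "0 < a" and hit: "0 \<le> s" "w s = a"
  defines "T \<equiv> Inf {t. 0 \<le> t \<and> w t = a}"
  shows "0 < T" "w T = a" "\<And>t. 0 \<le> t \<Longrightarrow> t < T \<Longrightarrow> w t < a"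
proof -
  let ?S = "{t. 0 \<le> t \<and> w t = a}"
  have "closed ({0..} \<inter> w -` {a})" by (intro continuous_closed_preimage w) auto
  also have "{0..} \<inter> w -` {a} = ?S" by auto
  finally have "T \<in> ?S"
    unfolding T_def using hit by (intro closed_contains_Inf) (auto intro: bdd_belowI)
  then show "w T = a" "0 < T" using w(2) a by (auto simp: less_le)
  show "w t < a" if t: "0 \<le> t" "t < T" for t
  proof (rule ccontr)
    assume "\<not> ?thesis"
    then obtain r where "0 \<le> r" "r \<le> t" "w r = a"
      using IVT'[of w 0 a t] w a t continuous_on_subset[OF w(1), of "{0..t}"] by auto
    then have "T \<le> r" unfolding T_def by (intro cInf_lower) (auto intro: bdd_belowI)
    then show False using t \<open>r \<le> t\<close> by simp
  qed
qed

definition lower_level :: "real \<Rightarrow> nat \<Rightarrow> real" where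
  "lower_level a i = a * (1 - 1 / real (i + 2))"

lemma lower_level: assumes "0 < a" shows "0 < lower_level a i" "lower_level a i < a"
  "lower_level a \<longlonglongrightarrow> a"
proof -
  show "0 < lower_level a i" "lower_level a i < a" using assms by (simp_all add: lower_level_def)
  have "(\<lambda>i. a * (1 - 1 / real (i + 2))) \<longlonglongrightarrow> a * (1 - 0)"
    by (intro tendsto_intros LIMSEQ_ignore_initial_segment[OF lim_1_over_n])
  then show "lower_level a \<longlonglongrightarrow> a" by (simp add: lower_level_def[abs_def])
qed

text \<open>
  Levels increasing to \<open>a\<close> together with horizons increasing to infinity.  Unlike the dyadic exit times
  of the level \<open>a\<close> itself, these times never exceed the hitting time of \<open>a\<close>, so that the path is at most
  \<open>a\<close> up to each of them.
\<close>

definition exit_seq :: "(real \<Rightarrow> real) \<Rightarrow> real \<Rightarrow> nat \<Rightarrow> real" where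
  "exit_seq w a i = exit_limit w (lower_level a i) (real (i + 1))"

lemma exit_seq_eventually_ge:
  assumes w: "continuous_on {0..} w" "w 0 = 0" and a: "0 < a"
    and u: "0 \<le> u" "\<And>s. 0 \<le> s \<Longrightarrow> s \<le> u \<Longrightarrow> w s < a"
  shows "\<forall>\<^sub>F i in sequentially. u \<le> exit_seq w a i"
proof -
  \<comment> \<open>The maximum over {0..u} is less than a, hence less than all but finitely many of the levels.\<close>
  obtain m where m: "m \<in> {0..u}" "\<And>s. s \<in> {0..u} \<Longrightarrow> w s \<le> w m"
    using continuous_attains_sup[of "{0..u}" w] u(1) continuous_on_subset[OF w(1), of "{0..u}"] by auto
  have "w m < a" using m(1) u(2) by simp
  then have "\<forall>\<^sub>F i in sequentially. w m < lower_level a i"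
    by (rule order_tendstoD(1)[OF lower_level(3)[OF a]])
  moreover have "\<forall>\<^sub>F i in sequentially. u \<le> real (i + 1)"
    using eventually_ge_at_top[of "nat \<lceil>u\<rceil>"] by eventually_elim linarith
  ultimately show ?thesis
  proof eventually_elim
    case (elim i)
    then have "w s < lower_level a i" if "0 \<le> s" "s < u" for s
      using m(2)[of s] that by simp
    then show ?case unfolding exit_seq_def
      using elim by (intro exit_limit_ge w(2)) auto
  qed
qed

lemma exit_seq_nonneg: "w 0 = 0 \<Longrightarrow> 0 \<le> exit_seq w a i"
  unfolding exit_seq_def by (intro exit_limit_bounds) auto

lemma exit_seq_le_hitting:
  assumes w: "continuous_on {0..} w" "w 0 = 0" and a: "0 < a" and u: "0 \<le> u" "w u = a"
  shows "exit_seq w a i \<le> u"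
  unfolding exit_seq_def using lower_level(2)[OF a] u by (intro exit_limit_le w) auto

lemma exit_seq_tendsto:
  assumes w: "continuous_on {0..} w" "w 0 = 0" and a: "0 < a" and hit: "0 \<le> s" "w s = a"
  shows "exit_seq w a \<longlonglongrightarrow> Inf {t. 0 \<le> t \<and> w t = a}"
proof -
  let ?T = "Inf {t. 0 \<le> t \<and> w t = a}"
  note T = hitting_time_attained[OF w a hit]
  show ?thesis
  proof (rule order_tendstoI)
    fix u assume "u < ?T"
    define v where "v = max 0 ((u + ?T) / 2)"
    have v: "u < v" "0 \<le> v" "v < ?T" using \<open>u < ?T\<close> T(1) by (auto simp: v_def less_max_iff_disj)
    have "\<forall>\<^sub>F i in sequentially. v \<le> exit_seq w a i"
      using v T(3) by (intro exit_seq_eventually_ge w a) auto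
    then show "\<forall>\<^sub>F i in sequentially. u < exit_seq w a i"
      by eventually_elim (use v in auto)
  next
    fix u assume "?T < u"
    then show "\<forall>\<^sub>F i in sequentially. exit_seq w a i < u"
      using le_less_trans[OF exit_seq_le_hitting[OF w a less_imp_le[OF T(1)] T(2)]]
      by (intro always_eventually allI)
  qed
qed

lemma exit_seq_at_top:
  assumes w: "continuous_on {0..} w" "w 0 = 0" and a: "0 < a" and no_hit: "\<And>s. 0 \<le> s \<Longrightarrow> w s \<noteq> a"
  shows "filterlim (exit_seq w a) at_top sequentially"
proof -
  have below: "w s < a" if s: "0 \<le> s" for s
  proof (rule ccontr)
    assume "\<not> ?thesis"
    then obtain r where "0 \<le> r" "w r = a"
      using IVT'[of w 0 a s] w a s continuous_on_subset[OF w(1), of "{0..s}"] by auto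
    then show False using no_hit by blast
  qed
  show ?thesis unfolding filterlim_at_top
  proof
    fix Z :: real
    have "\<forall>\<^sub>F i in sequentially. max 0 Z \<le> exit_seq w a i"
      using below by (intro exit_seq_eventually_ge w a) auto
    then show "\<forall>\<^sub>F i in sequentially. Z \<le> exit_seq w a i" by eventually_elim simp
  qed
qed

lemma path_at_exit_seq_le:
  assumes w: "continuous_on {0..} w" "w 0 = 0" and a: "0 < a"
  shows "w (exit_seq w a i) \<le> a"
proof (rule ccontr)
  assume *: "\<not> ?thesis"
  let ?R = "exit_seq w a i"
  obtain r where r: "0 \<le> r" "r \<le> ?R" "w r = a"
    using * IVT'[of w 0 a ?R] w a exit_seq_nonneg[of w a i] continuous_on_subset[OF w(1), of "{0..?R}"] by auto
  have "?R \<le> r" by (rule exit_seq_le_hitting[OF w a r(1,3)])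
  then show False using r * by simp
qed

section \<open>Optional stopping for Brownian motion\<close>

context standard_brownian_motion
begin

text \<open>
  The paths of \<open>B\<close> start at 0 only almost surely; those of \<open>W\<close> always do, which lets the statements about
  single paths be used for every outcome.
\<close>

definition W :: "real \<Rightarrow> 'w \<Rightarrow> real" where "W t \<omega> = B t \<omega> - B 0 \<omega>"

abbreviation Wpath :: "'w \<Rightarrow> real \<Rightarrow> real" where "Wpath \<omega> \<equiv> (\<lambda>t. W t \<omega>)"

lemma W_0 [simp]: "W 0 \<omega> = 0" by (simp add: W_def)

lemma continuous_W: "\<omega> \<in> space M \<Longrightarrow> continuous_on {0..} (Wpath \<omega>)"
  unfolding W_def by (intro continuous_intros continuous_paths)

lemma increments_W: "increments (Wpath \<omega>) h = (\<lambda>i. B (real (Suc i) * h) \<omega> - B (real i * h) \<omega>)"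
  by (simp add: fun_eq_iff increments_def W_def)

lemma gaussian_walk_increments:
  assumes h: "0 < h"
  shows "gaussian_walk M (\<lambda>i \<omega>. B (real (Suc i) * h) \<omega> - B (real i * h) \<omega>) h"
proof
  show "0 < h" by fact
  show "distributed M lborel (\<lambda>\<omega>. B (real (Suc i) * h) \<omega> - B (real i * h) \<omega>) (normal_density 0 (sqrt h))" for i
    using normal_increments[of "real i * h" "real (Suc i) * h"] h by (simp add: algebra_simps)
  show "indep_vars (\<lambda>_. borel) (\<lambda>i \<omega>. B (real (Suc i) * h) \<omega> - B (real i * h) \<omega>) {..<n}" for n
    using independent_increments[of "\<lambda>i. real i * h" n] h by simp
qed

text \<open>
  The exponential with complex parameter \<open>\<theta> + \<i> \<mu>\<close>, for a path that is at \<open>x\<close> at time \<open>r\<close>.  For \<open>\<mu> = 0\<close> it is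
  the density that adds the drift \<open>\<theta>\<close>.
\<close>

definition tilt :: "real \<Rightarrow> real \<Rightarrow> real \<Rightarrow> real \<Rightarrow> complex" where
  "tilt \<theta> \<mu> r x = exp (Complex \<theta> \<mu> * complex_of_real x - complex_of_real (\<theta>\<^sup>2 / 2 * r))"

lemma norm_tilt: "norm (tilt \<theta> \<mu> r x) = exp (\<theta> * x - \<theta>\<^sup>2 / 2 * r)"
  by (simp add: tilt_def)

lemma dyadic_identity:
  fixes \<theta> \<mu> c t :: real and j :: nat
  assumes \<theta>: "0 \<le> \<theta>" and c: "0 < c" and t: "0 < t"
  defines "h \<equiv> t / 2^j"
  defines "r \<equiv> \<lambda>\<omega>. dyadic_exit (Wpath \<omega>) c t j"
    and "K \<equiv> \<lambda>\<omega>. exit_index c (2^j) (increments (Wpath \<omega>) h)"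
  shows "integrable M (\<lambda>\<omega>. tilt \<theta> \<mu> (r \<omega>) (W (r \<omega>) \<omega>))" (is ?I1)
    and "integrable M (\<lambda>\<omega>. tilt \<theta> 0 (r \<omega>) (W (r \<omega>) \<omega>) * (\<Sum>k<K \<omega>. h *\<^sub>R iexp (\<mu> * W (real k * h) \<omega>)))" (is ?I2)
    and "(LINT \<omega>|M. tilt \<theta> \<mu> (r \<omega>) (W (r \<omega>) \<omega>)) - 1
      = ((exp ((\<i> * \<mu> * \<theta> - \<mu>\<^sup>2 / 2) * h) - 1) / h) *
        (LINT \<omega>|M. tilt \<theta> 0 (r \<omega>) (W (r \<omega>) \<omega>) * (\<Sum>k<K \<omega>. h *\<^sub>R iexp (\<mu> * W (real k * h) \<omega>)))" (is ?E)
    and "integrable M (\<lambda>\<omega>. (exp (\<theta> * W (r \<omega>) \<omega> - \<theta>\<^sup>2 / 2 * r \<omega>))\<^sup>2)" (is ?I3)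
    and "(LINT \<omega>|M. (exp (\<theta> * W (r \<omega>) \<omega> - \<theta>\<^sup>2 / 2 * r \<omega>))\<^sup>2) \<le> exp (\<theta>\<^sup>2 * t)" (is ?L)
proof -
  have h: "0 < h" using t by (simp add: h_def)
  interpret gw: gaussian_walk M "\<lambda>i \<omega>. B (real (Suc i) * h) \<omega> - B (real i * h) \<omega>" h
    by (rule gaussian_walk_increments[OF h])
  have path: "(\<lambda>i. B (real (Suc i) * h) \<omega> - B (real i * h) \<omega>) = increments (Wpath \<omega>) h" for \<omega>
    by (rule increments_W[symmetric])
  have r: "r \<omega> = real (K \<omega>) * h" for \<omega> by (simp add: r_def K_def h_def dyadic_exit_def)
  have K: "exit_index c (2^j) (increments (Wpath \<omega>) h) = K \<omega>" for \<omega> by (simp add: K_def)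
  have walk: "walk (increments (Wpath \<omega>) h) k = W (real k * h) \<omega>" for \<omega> k by (simp add: walk_increments)
  have expo: "gw.expo (Complex \<theta> \<mu>) (\<theta>\<^sup>2 / 2) (K \<omega>) (increments (Wpath \<omega>) h) = tilt \<theta> \<mu> (r \<omega>) (W (r \<omega>) \<omega>)" for \<omega> \<mu>
    unfolding gw.expo_def tilt_def walk r by (simp add: mult_ac)
  have sums: "(\<Sum>k<K \<omega>. iexp (\<mu> * W (real k * h) \<omega>)) = (\<Sum>k<K \<omega>. h *\<^sub>R iexp (\<mu> * W (real k * h) \<omega>)) / h" for \<omega>
    using h by (simp add: scaleR_conv_of_real flip: sum_distrib_left)
  note os = gw.walk_optional_stopping[OF \<theta> c, where \<mu>=\<mu> and n="2^j", unfolded path K expo walk]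
  note sm = gw.stopped_second_moment[OF \<theta> c, of "2^j", unfolded path K walk]
  show ?I1 by (rule os(2))
  have h0: "complex_of_real h \<noteq> 0" using h by simp
  show ?I2
    using integrable_mult_right[where c="complex_of_real h", OF os(1)] h0 unfolding sums by simp
  show ?E
    using os(3) unfolding sums by (simp only: times_divide_eq_right times_divide_eq_left Bochner_Integration.integral_divide_zero)
  have lin: "\<theta> * W (real (K \<omega>) * h) \<omega> - \<theta>\<^sup>2 / 2 * h * real (K \<omega>) = \<theta> * W (r \<omega>) \<omega> - \<theta>\<^sup>2 / 2 * r \<omega>" for \<omega>
    unfolding r by simp
  show ?I3 using sm(1) unfolding lin .
  show ?L using sm(2) unfolding lin using h by (simp add: h_def)
qed

text \<open>
  The mesh tends to 0 in \<open>dyadic_identity\<close>: the sums become integrals along the path and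
  \<open>(exp (\<kappa> h) - 1) / h\<close> becomes \<open>\<kappa>\<close>.  Expectations converge by the second moment bound.
\<close>

proposition exit_limit_identity:
  fixes \<theta> \<mu> c t :: real
  assumes \<theta>: "0 \<le> \<theta>" and c: "0 < c" and t: "0 < t"
  defines "r \<equiv> \<lambda>\<omega>. exit_limit (Wpath \<omega>) c t"
  shows "integrable M (\<lambda>\<omega>. tilt \<theta> \<mu> (r \<omega>) (W (r \<omega>) \<omega>))" (is ?I1)
    and "integrable M (\<lambda>\<omega>. tilt \<theta> 0 (r \<omega>) (W (r \<omega>) \<omega>) * integral {0..r \<omega>} (\<lambda>s. iexp (\<mu> * W s \<omega>)))" (is ?I2)
    and "(LINT \<omega>|M. tilt \<theta> \<mu> (r \<omega>) (W (r \<omega>) \<omega>)) - 1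
      = (\<i> * \<mu> * \<theta> - \<mu>\<^sup>2 / 2) *
        (LINT \<omega>|M. tilt \<theta> 0 (r \<omega>) (W (r \<omega>) \<omega>) * integral {0..r \<omega>} (\<lambda>s. iexp (\<mu> * W s \<omega>)))" (is ?E)
proof -
  define q where "q j \<omega> = dyadic_exit (Wpath \<omega>) c t j" for j \<omega>
  define f where "f j \<omega> = tilt \<theta> \<mu> (q j \<omega>) (W (q j \<omega>) \<omega>)" for j \<omega>
  define S where "S j \<omega> = (\<Sum>k<exit_index c (2^j) (increments (Wpath \<omega>) (t / 2^j)). (t / 2^j) *\<^sub>R iexp (\<mu> * W (real k * (t / 2^j)) \<omega>))" for j \<omega>
  define g where "g j \<omega> = tilt \<theta> 0 (q j \<omega>) (W (q j \<omega>) \<omega>) * S j \<omega>" for j \<omega>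
  have f_int: "integrable M (f j)" for j
    unfolding f_def q_def by (rule dyadic_identity(1)[OF \<theta> c t])
  have g_int: "integrable M (g j)" for j
    unfolding g_def S_def q_def by (rule dyadic_identity(2)[OF \<theta> c t])
  have id: "(LINT \<omega>|M. f j \<omega>) - 1 =
      ((exp ((\<i> * \<mu> * \<theta> - \<mu>\<^sup>2 / 2) * complex_of_real (t / 2^j)) - 1) / complex_of_real (t / 2^j)) * (LINT \<omega>|M. g j \<omega>)" for j
    unfolding f_def g_def S_def q_def by (rule dyadic_identity(3)[OF \<theta> c t])
  let ?sq = "\<lambda>j \<omega>. (exp (\<theta> * W (q j \<omega>) \<omega> - \<theta>\<^sup>2 / 2 * q j \<omega>))\<^sup>2"
  have sq_int: "integrable M (?sq j)" for j
    unfolding q_def by (rule dyadic_identity(4)[OF \<theta> c t])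
  have sq_le: "(LINT \<omega>|M. ?sq j \<omega>) \<le> exp (\<theta>\<^sup>2 * t)" for j
    unfolding q_def by (rule dyadic_identity(5)[OF \<theta> c t])
  have q_lim: "(\<lambda>j. q j \<omega>) \<longlonglongrightarrow> r \<omega>" for \<omega>
    unfolding q_def r_def by (rule dyadic_exit_tendsto[of "Wpath \<omega>" t c, OF W_0 t])
  have q_range: "0 \<le> q j \<omega>" "q j \<omega> \<le> t" for j \<omega>
    using t by (auto simp: q_def intro: dyadic_exit_nonneg dyadic_exit_le)
  have r_range: "0 \<le> r \<omega>" "r \<omega> \<le> t" for \<omega>
    unfolding r_def by (rule exit_limit_bounds[of "Wpath \<omega>" t c, OF W_0 t])+
  have W_lim: "(\<lambda>j. W (q j \<omega>) \<omega>) \<longlonglongrightarrow> W (r \<omega>) \<omega>" if "\<omega> \<in> space M" for \<omega>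
    using continuous_W[OF that] q_lim q_range r_range
    by (intro continuous_on_tendsto_compose[of "{0..}" "Wpath \<omega>"]) auto
  have tilt_lim: "(\<lambda>j. tilt \<theta> \<mu> (q j \<omega>) (W (q j \<omega>) \<omega>)) \<longlonglongrightarrow> tilt \<theta> \<mu> (r \<omega>) (W (r \<omega>) \<omega>)" if "\<omega> \<in> space M" for \<omega> \<mu>
    unfolding tilt_def by (intro tendsto_intros W_lim q_lim that)
  have S_lim: "(\<lambda>j. S j \<omega>) \<longlonglongrightarrow> integral {0..r \<omega>} (\<lambda>s. iexp (\<mu> * W s \<omega>))" if "\<omega> \<in> space M" for \<omega>
    unfolding S_def
  proof (rule left_sums_tendsto[OF _ t])
    show "continuous_on {0..t} (\<lambda>s. iexp (\<mu> * W s \<omega>))"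
      by (intro continuous_intros continuous_on_subset[OF continuous_W[OF that]]) auto
  qed (use q_range q_lim in \<open>auto simp: q_def dyadic_exit_def\<close>)
  have f_meas: "f j \<in> borel_measurable M" and g_meas: "g j \<in> borel_measurable M" for j
    using borel_measurable_integrable[OF f_int] borel_measurable_integrable[OF g_int] by simp_all
  have f_lim: "(\<lambda>j. f j \<omega>) \<longlonglongrightarrow> tilt \<theta> \<mu> (r \<omega>) (W (r \<omega>) \<omega>)" if "\<omega> \<in> space M" for \<omega>
    unfolding f_def by (rule tilt_lim[OF that])
  have g_lim: "(\<lambda>j. g j \<omega>) \<longlonglongrightarrow> tilt \<theta> 0 (r \<omega>) (W (r \<omega>) \<omega>) * integral {0..r \<omega>} (\<lambda>s. iexp (\<mu> * W s \<omega>))"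
    if "\<omega> \<in> space M" for \<omega>
    unfolding g_def by (rule tendsto_mult[OF tilt_lim[OF that] S_lim[OF that]])
  have S_le: "norm (S j \<omega>) \<le> t" for j \<omega>
  proof -
    have "norm (S j \<omega>) \<le> (\<Sum>k<exit_index c (2^j) (increments (Wpath \<omega>) (t / 2^j)). t / 2^j)"
      unfolding S_def by (rule sum_norm_le) (use t in simp)
    also have "\<dots> = q j \<omega>" by (simp add: q_def dyadic_exit_def)
    finally show ?thesis using q_range(2)[of j \<omega>] by simp
  qed
  have g_sq: "(norm (g j \<omega>))\<^sup>2 \<le> t\<^sup>2 * ?sq j \<omega>" for j \<omega>
  proof -
    have "(norm (g j \<omega>))\<^sup>2 = ?sq j \<omega> * (norm (S j \<omega>))\<^sup>2"
      by (simp add: g_def norm_mult norm_tilt power_mult_distrib)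
    also have "\<dots> \<le> ?sq j \<omega> * t\<^sup>2" using S_le by (intro mult_left_mono power_mono) auto
    finally show ?thesis by (simp add: mult.commute)
  qed
  have g_sq_int: "integrable M (\<lambda>\<omega>. (norm (g j \<omega>))\<^sup>2)" for j
    by (rule Bochner_Integration.integrable_bound[OF integrable_mult_right[OF sq_int[of j], of "t\<^sup>2"]])
       (use g_sq g_meas in auto)
  have g_sq_le: "(LINT \<omega>|M. (norm (g j \<omega>))\<^sup>2) \<le> t\<^sup>2 * exp (\<theta>\<^sup>2 * t)" for j
  proof -
    have "(LINT \<omega>|M. (norm (g j \<omega>))\<^sup>2) \<le> (LINT \<omega>|M. t\<^sup>2 * ?sq j \<omega>)"
      by (rule integral_mono[OF g_sq_int]) (use sq_int[of j] g_sq in auto)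
    also have "\<dots> \<le> t\<^sup>2 * exp (\<theta>\<^sup>2 * t)" using sq_le[of j] by (simp add: mult_left_mono)
    finally show ?thesis .
  qed
  note Lf = tendsto_integral_L2_bounded[of f "\<lambda>\<omega>. tilt \<theta> \<mu> (r \<omega>) (W (r \<omega>) \<omega>)" "exp (\<theta>\<^sup>2 * t)",
      OF f_meas borel_measurable_LIMSEQ_metric[OF f_meas f_lim] AE_I2[OF f_lim]]
  note Lg = tendsto_integral_L2_bounded[of g _ "t\<^sup>2 * exp (\<theta>\<^sup>2 * t)",
      OF g_meas borel_measurable_LIMSEQ_metric[OF g_meas g_lim] AE_I2[OF g_lim] g_sq_int g_sq_le]
  have f_sq: "norm (f j \<omega>) = exp (\<theta> * W (q j \<omega>) \<omega> - \<theta>\<^sup>2 / 2 * q j \<omega>)" for j \<omega>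
    by (simp add: f_def norm_tilt)
  show ?I1 using Lf(1) sq_int sq_le unfolding f_sq by blast
  show ?I2 by (rule Lg(1))
  have h_lim: "filterlim (\<lambda>j. complex_of_real (t / 2^j)) (at 0) sequentially"
  proof -
    have "(\<lambda>j. complex_of_real (t * (1/2)^j)) \<longlonglongrightarrow> complex_of_real (t * 0)" by (intro tendsto_intros) auto
    then show ?thesis using t by (auto simp: filterlim_at power_divide intro!: always_eventually)
  qed
  have "((\<lambda>z. (exp ((\<i> * \<mu> * \<theta> - \<mu>\<^sup>2 / 2) * z) - 1) / z) \<longlongrightarrow> \<i> * \<mu> * \<theta> - \<mu>\<^sup>2 / 2) (at 0)"
  proof -
    have "((\<lambda>z. exp ((\<i> * \<mu> * \<theta> - \<mu>\<^sup>2 / 2) * z)) has_field_derivative (\<i> * \<mu> * \<theta> - \<mu>\<^sup>2 / 2)) (at 0)"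
      by (auto intro!: derivative_eq_intros)
    then show ?thesis by (simp add: has_field_derivative_iff)
  qed
  note rate_lim = filterlim_compose[OF this h_lim]
  have "(\<lambda>j. (LINT \<omega>|M. f j \<omega>) - 1) \<longlonglongrightarrow> (LINT \<omega>|M. tilt \<theta> \<mu> (r \<omega>) (W (r \<omega>) \<omega>)) - 1"
    using Lf(2) sq_int sq_le unfolding f_sq by (intro tendsto_intros) blast
  moreover have "(\<lambda>j. (LINT \<omega>|M. f j \<omega>) - 1) \<longlonglongrightarrow> (\<i> * \<mu> * \<theta> - \<mu>\<^sup>2 / 2) *
        (LINT \<omega>|M. tilt \<theta> 0 (r \<omega>) (W (r \<omega>) \<omega>) * integral {0..r \<omega>} (\<lambda>s. iexp (\<mu> * W s \<omega>)))"
    unfolding id using tendsto_mult[OF rate_lim Lg(2)] by simp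
  ultimately show ?E by (rule LIMSEQ_unique)
qed

end

lemma norm_integral_iexp_le:
  fixes w :: "real \<Rightarrow> real"
  assumes w: "continuous_on {0..} w" and r: "0 \<le> r"
  shows "norm (integral {0..r} (\<lambda>s. iexp (\<mu> * w s))) \<le> r"
proof -
  have "continuous_on {0..r} (\<lambda>s. iexp (\<mu> * w s))"
    by (intro continuous_intros continuous_on_subset[OF w]) auto
  from integral_bound[OF r this, of 1] show ?thesis by simp
qed

lemma mult_exp_neg_le:
  fixes l x :: real
  assumes "0 < l"
  shows "x * exp (- (l * x)) \<le> 1 / l"
proof -
  have "l * x \<le> exp (l * x)" using exp_ge_add_one_self[of "l * x"] by linarith
  then have "l * x * exp (- (l * x)) \<le> exp (l * x) * exp (- (l * x))" by (rule mult_right_mono) simp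
  then show ?thesis using assms by (simp add: field_simps flip: exp_add)
qed

context standard_brownian_motion
begin

definition W_hits :: "real \<Rightarrow> 'w \<Rightarrow> bool" where "W_hits a \<omega> \<longleftrightarrow> (\<exists>s\<ge>0. W s \<omega> = a)"

text \<open>
  On paths that never reach \<open>a\<close> the exit times tend to infinity while the path stays below \<open>a\<close>, so the
  integrands vanish in the limit; hence the indicator.  The bounds \<open>exp (\<theta> a)\<close> and \<open>exp (\<theta> a) / l\<close> with
  \<open>l = \<theta>\<^sup>2 / 2\<close> serve for dominated convergence.
\<close>

lemma stopped_identity:
  fixes \<theta> \<mu> a :: real
  assumes \<theta>: "0 < \<theta>" and a: "0 < a"
  defines "T \<equiv> hitting_time W a"
  shows "integrable M (\<lambda>\<omega>. of_bool (W_hits a \<omega>) * tilt \<theta> \<mu> (T \<omega>) a)" (is ?I1)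
    and "integrable M (\<lambda>\<omega>. of_bool (W_hits a \<omega>) * (tilt \<theta> 0 (T \<omega>) a * integral {0..T \<omega>} (\<lambda>s. iexp (\<mu> * W s \<omega>))))" (is ?I2)
    and "(LINT \<omega>|M. of_bool (W_hits a \<omega>) * tilt \<theta> \<mu> (T \<omega>) a) - 1 = (\<i> * \<mu> * \<theta> - \<mu>\<^sup>2 / 2) *
        (LINT \<omega>|M. of_bool (W_hits a \<omega>) * (tilt \<theta> 0 (T \<omega>) a * integral {0..T \<omega>} (\<lambda>s. iexp (\<mu> * W s \<omega>))))" (is ?E)
proof -
  define l where "l = \<theta>\<^sup>2 / 2"
  have l: "0 < l" using \<theta> by (simp add: l_def)
  define R where "R i \<omega> = exit_seq (Wpath \<omega>) a i" for i \<omega>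
  define f where "f i \<omega> = tilt \<theta> \<mu> (R i \<omega>) (W (R i \<omega>) \<omega>)" for i \<omega>
  define g where "g i \<omega> = tilt \<theta> 0 (R i \<omega>) (W (R i \<omega>) \<omega>) * integral {0..R i \<omega>} (\<lambda>s. iexp (\<mu> * W s \<omega>))" for i \<omega>
  let ?F = "\<lambda>\<omega>. of_bool (W_hits a \<omega>) * tilt \<theta> \<mu> (T \<omega>) a"
  let ?G = "\<lambda>\<omega>. of_bool (W_hits a \<omega>) * (tilt \<theta> 0 (T \<omega>) a * integral {0..T \<omega>} (\<lambda>s. iexp (\<mu> * W s \<omega>)))"
  have f_int: "integrable M (f i)" and g_int: "integrable M (g i)"
    and id: "(LINT \<omega>|M. f i \<omega>) - 1 = (\<i> * \<mu> * \<theta> - \<mu>\<^sup>2 / 2) * (LINT \<omega>|M. g i \<omega>)" for i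
    using exit_limit_identity[OF less_imp_le[OF \<theta>] lower_level(1)[OF a], where t = "real (i + 1)" and \<mu>=\<mu>]
    unfolding f_def g_def R_def exit_seq_def by simp_all
  have R0: "0 \<le> R i \<omega>" for i \<omega> unfolding R_def by (rule exit_seq_nonneg) simp
  have tilt_le: "norm (tilt \<theta> \<nu> (R i \<omega>) (W (R i \<omega>) \<omega>)) \<le> exp (\<theta> * a) * exp (- (l * R i \<omega>))"
    if "\<omega> \<in> space M" for i \<omega> \<nu>
  proof -
    have "W (R i \<omega>) \<omega> \<le> a"
      unfolding R_def by (rule path_at_exit_seq_le[OF continuous_W[OF that] W_0 a])
    then have "\<theta> * W (R i \<omega>) \<omega> \<le> \<theta> * a" using \<theta> by simp
    then show ?thesis by (simp add: norm_tilt l_def flip: exp_add)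
  qed
  have f_le: "norm (f i \<omega>) \<le> exp (\<theta> * a) * exp (- (l * R i \<omega>))" if "\<omega> \<in> space M" for i \<omega>
    unfolding f_def by (rule tilt_le[OF that])
  have g_le: "norm (g i \<omega>) \<le> exp (\<theta> * a) * exp (- (l * R i \<omega>)) * R i \<omega>" if "\<omega> \<in> space M" for i \<omega>
    unfolding g_def norm_mult
    by (intro mult_mono tilt_le norm_integral_iexp_le continuous_W that R0) auto
  have f_le': "norm (f i \<omega>) \<le> exp (\<theta> * a)" if "\<omega> \<in> space M" for i \<omega>
  proof -
    have "exp (\<theta> * a) * exp (- (l * R i \<omega>)) \<le> exp (\<theta> * a) * 1"
      using l R0[of i \<omega>] by (intro mult_left_mono) auto
    then show ?thesis using f_le[OF that, of i] by linarith
  qed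
  have g_le': "norm (g i \<omega>) \<le> exp (\<theta> * a) * (1 / l)" if "\<omega> \<in> space M" for i \<omega>
  proof -
    have "exp (\<theta> * a) * (R i \<omega> * exp (- (l * R i \<omega>))) \<le> exp (\<theta> * a) * (1 / l)"
      by (intro mult_left_mono mult_exp_neg_le l) simp
    then show ?thesis using g_le[OF that, of i] by (simp add: mult_ac)
  qed
  have lims: "(\<lambda>i. f i \<omega>) \<longlonglongrightarrow> ?F \<omega> \<and> (\<lambda>i. g i \<omega>) \<longlonglongrightarrow> ?G \<omega>" if \<omega>: "\<omega> \<in> space M" for \<omega>
  proof (cases "W_hits a \<omega>")
    case True
    then obtain s where s: "0 \<le> s" "W s \<omega> = a" by (auto simp: W_hits_def)
    note cont = continuous_W[OF \<omega>]
    have R_lim: "(\<lambda>i. R i \<omega>) \<longlonglongrightarrow> T \<omega>"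
      unfolding R_def T_def hitting_time_def by (rule exit_seq_tendsto[OF cont W_0 a s])
    note T = hitting_time_attained[OF cont W_0 a s, folded hitting_time_def, folded T_def]
    have R_le: "R i \<omega> \<le> T \<omega>" for i
      unfolding R_def using T by (intro exit_seq_le_hitting cont a) auto
    have "(\<lambda>i. W (R i \<omega>) \<omega>) \<longlonglongrightarrow> W (T \<omega>) \<omega>"
      using cont R_lim R0 T by (intro continuous_on_tendsto_compose[of "{0..}" "Wpath \<omega>"]) auto
    then have W_lim: "(\<lambda>i. W (R i \<omega>) \<omega>) \<longlonglongrightarrow> a" using T(2) by simp
    have tilt_lim: "(\<lambda>i. tilt \<theta> \<nu> (R i \<omega>) (W (R i \<omega>) \<omega>)) \<longlonglongrightarrow> tilt \<theta> \<nu> (T \<omega>) a" for \<nu>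
      unfolding tilt_def by (intro tendsto_intros W_lim R_lim)
    have "continuous_on {0..T \<omega>} (\<lambda>r. integral {0..r} (\<lambda>s. iexp (\<mu> * W s \<omega>)))"
      by (intro indefinite_integral_continuous_1 integrable_continuous_real continuous_intros continuous_on_subset[OF cont]) auto
    then have "(\<lambda>i. integral {0..R i \<omega>} (\<lambda>s. iexp (\<mu> * W s \<omega>))) \<longlonglongrightarrow> integral {0..T \<omega>} (\<lambda>s. iexp (\<mu> * W s \<omega>))"
      using R_lim R0 R_le T
      by (intro continuous_on_tendsto_compose[of "{0..T \<omega>}" "\<lambda>r. integral {0..r} (\<lambda>s. iexp (\<mu> * W s \<omega>))"]) auto
    then show ?thesis
      using True tilt_lim unfolding f_def g_def by (auto intro!: tendsto_mult)
  next
    case False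
    have "filterlim (\<lambda>i. R i \<omega>) at_top sequentially"
      unfolding R_def using False by (intro exit_seq_at_top continuous_W \<omega> a) (auto simp: W_hits_def)
    note R_top = this
    have decay: "((\<lambda>x. exp (\<theta> * a) * exp (- (l * x))) \<longlongrightarrow> 0) at_top" "((\<lambda>x. exp (\<theta> * a) * exp (- (l * x)) * x) \<longlongrightarrow> 0) at_top"
      using l by real_asymp+
    have zero: "(\<lambda>i. exp (\<theta> * a) * exp (- (l * R i \<omega>))) \<longlonglongrightarrow> 0" "(\<lambda>i. exp (\<theta> * a) * exp (- (l * R i \<omega>)) * R i \<omega>) \<longlonglongrightarrow> 0"
      by (rule filterlim_compose[OF decay(1) R_top], rule filterlim_compose[OF decay(2) R_top])
    have "(\<lambda>i. f i \<omega>) \<longlonglongrightarrow> 0" "(\<lambda>i. g i \<omega>) \<longlonglongrightarrow> 0"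
      by (rule Lim_null_comparison[OF always_eventually[OF allI[OF f_le[OF \<omega>]]] zero(1)],
          rule Lim_null_comparison[OF always_eventually[OF allI[OF g_le[OF \<omega>]]] zero(2)])
    then show ?thesis using False by simp
  qed
  have F_meas: "?F \<in> borel_measurable M"
    by (rule borel_measurable_LIMSEQ_metric[of f]) (use f_int lims in auto)
  have G_meas: "?G \<in> borel_measurable M"
    by (rule borel_measurable_LIMSEQ_metric[of g]) (use g_int lims in auto)
  have f_AE: "AE \<omega> in M. (\<lambda>i. f i \<omega>) \<longlonglongrightarrow> ?F \<omega>" "AE \<omega> in M. norm (f i \<omega>) \<le> exp (\<theta> * a)"
    and g_AE: "AE \<omega> in M. (\<lambda>i. g i \<omega>) \<longlonglongrightarrow> ?G \<omega>" "AE \<omega> in M. norm (g i \<omega>) \<le> exp (\<theta> * a) * (1 / l)" for i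
    using lims f_le' g_le' by (auto intro!: AE_I2)
  note df = integrable_dominated_convergence[OF F_meas borel_measurable_integrable[OF f_int] _ f_AE]
    integral_dominated_convergence[OF F_meas borel_measurable_integrable[OF f_int] _ f_AE]
  note dg = integrable_dominated_convergence[OF G_meas borel_measurable_integrable[OF g_int] _ g_AE]
    integral_dominated_convergence[OF G_meas borel_measurable_integrable[OF g_int] _ g_AE]
  show ?I1 using df(1) by simp
  show ?I2 using dg(1) by simp
  have "(\<lambda>i. (LINT \<omega>|M. f i \<omega>) - 1) \<longlonglongrightarrow> (LINT \<omega>|M. ?F \<omega>) - 1"
    using df(2) by (intro tendsto_intros) simp
  moreover have "(\<lambda>i. (LINT \<omega>|M. f i \<omega>) - 1) \<longlonglongrightarrow> (\<i> * \<mu> * \<theta> - \<mu>\<^sup>2 / 2) * (LINT \<omega>|M. ?G \<omega>)"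
    unfolding id using dg(2) by (intro tendsto_intros) simp
  ultimately show ?E by (rule LIMSEQ_unique)
qed

end

section \<open>Fourier inversion\<close>

text \<open>
  The characteristic functions are compared away from 0 only, since the rate \<open>\<kappa>\<close> vanishes there.
  Continuity at 0 recovers the total mass, after which the measure can be normalised and the
  uniqueness theorem applied.
\<close>

lemma finite_measure_eq_scaled_distribution:
  fixes N \<rho> :: "real measure" and c :: real
  assumes N: "finite_measure N" "sets N = sets borel" and \<rho>: "real_distribution \<rho>" and c: "0 < c"
    and char_eq: "\<And>\<mu>. \<mu> \<noteq> 0 \<Longrightarrow> (LINT x|N. iexp (\<mu> * x)) = c * char \<rho> \<mu>"
    and g: "g \<in> borel_measurable borel"
  shows "(\<integral>\<^sup>+x. g x \<partial>N) = ennreal c * (\<integral>\<^sup>+x. g x \<partial>\<rho>)"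
proof -
  interpret N: finite_measure N by (rule N)
  interpret \<rho>: real_distribution \<rho> by (rule \<rho>)
  have sets_N [measurable_cong]: "sets N = sets borel" by (rule N)
  have space_N: "space N = UNIV" using sets_eq_imp_space_eq[OF N(2)] by simp
  have zero_lim: "(\<lambda>n. 1 / real (Suc n)) \<longlonglongrightarrow> 0" by (rule LIMSEQ_Suc[OF lim_1_over_n])
  have "(\<lambda>n. LINT x|N. iexp (1 / real (Suc n) * x)) \<longlonglongrightarrow> (LINT x|N. iexp (0 * x))"
  proof (rule integral_dominated_convergence[where w="\<lambda>_. 1"])
    show "AE x in N. (\<lambda>n. iexp (1 / real (Suc n) * x)) \<longlonglongrightarrow> iexp (0 * x)"
      by (intro AE_I2 tendsto_intros zero_lim)
  qed auto
  moreover have "(\<lambda>n. LINT x|N. iexp (1 / real (Suc n) * x)) \<longlonglongrightarrow> c * char \<rho> 0"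
  proof -
    have "(\<lambda>n. c * char \<rho> (1 / real (Suc n))) \<longlonglongrightarrow> c * char \<rho> 0"
      by (intro tendsto_intros isCont_tendsto_compose[OF \<rho>.isCont_char zero_lim])
    moreover have "(LINT x|N. iexp (1 / real (Suc n) * x)) = c * char \<rho> (1 / real (Suc n))" for n
      by (rule char_eq) simp
    ultimately show ?thesis by simp
  qed
  ultimately have "(LINT x|N. iexp (0 * x)) = c * char \<rho> 0" by (rule LIMSEQ_unique)
  then have "complex_of_real (measure N UNIV) = complex_of_real c"
    by (simp add: \<rho>.char_zero space_N scaleR_conv_of_real)
  then have mass: "measure N UNIV = c" by (simp only: of_real_eq_iff)
  define N' where "N' = density N (\<lambda>_. ennreal (1 / c))"
  have [measurable_cong]: "sets N' = sets borel" by (simp add: N'_def N)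
  have "emeasure N' (space N') = 1"
  proof -
    have "emeasure N' (space N') = ennreal (1 / c) * emeasure N UNIV"
      unfolding N'_def using space_N by (subst emeasure_density) (auto simp: nn_integral_cmult)
    also have "\<dots> = 1" using c by (simp add: N.emeasure_eq_measure mass flip: ennreal_mult')
    finally show ?thesis .
  qed
  then interpret N': prob_space N' by (rule prob_spaceI)
  have N': "real_distribution N'"
    by standard (simp add: N'_def N)
  have "char N' \<mu> = char \<rho> \<mu>" for \<mu>
  proof (cases "\<mu> = 0")
    case True
    then show ?thesis using real_distribution.char_zero[OF N'] \<rho>.char_zero by simp
  next
    case False
    have "char N' \<mu> = (1 / c) *\<^sub>R (LINT x|N. iexp (\<mu> * x))"
      unfolding char_def N'_def using c by (subst integral_density) auto
    then show ?thesis using c char_eq[OF False] by (simp add: scaleR_conv_of_real)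
  qed
  then have eq: "N' = \<rho>" using Levy_uniqueness[OF N' \<rho>] by blast
  have "(\<integral>\<^sup>+x. g x \<partial>\<rho>) = ennreal (1 / c) * (\<integral>\<^sup>+x. g x \<partial>N)"
    unfolding eq[symmetric] N'_def using g
    by (subst nn_integral_density) (auto simp: nn_integral_cmult measurable_cong_sets[OF sets_N refl])
  then have "ennreal c * (\<integral>\<^sup>+x. g x \<partial>\<rho>) = (ennreal c * ennreal (1 / c)) * (\<integral>\<^sup>+x. g x \<partial>N)"
    by (simp add: mult.assoc)
  also have "ennreal c * ennreal (1 / c) = 1" using c by (simp flip: ennreal_mult')
  finally show ?thesis by simp
qed

definition unit_uniform :: "real measure" where
  "unit_uniform = density lborel (\<lambda>u. ennreal (indicator {0..1} u))"

definition unit_exponential :: "real measure" where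
  "unit_exponential = density lborel (\<lambda>v. ennreal (exponential_density 1 v))"

lemma prob_space_unit_uniform: "prob_space unit_uniform"
proof (rule prob_spaceI)
  show "emeasure unit_uniform (space unit_uniform) = 1"
    by (simp add: unit_uniform_def emeasure_density ennreal_indicator)
qed

lemma prob_space_unit_exponential: "prob_space unit_exponential"
  unfolding unit_exponential_def by (rule prob_space_exponential_density) simp

lemma sets_unit [measurable_cong, simp]: "sets unit_uniform = sets borel" "sets unit_exponential = sets borel"
  by (simp_all add: unit_uniform_def unit_exponential_def)

lemma space_unit [simp]: "space unit_uniform = UNIV" "space unit_exponential = UNIV"
  by (simp_all add: unit_uniform_def unit_exponential_def)

lemma char_unit_uniform:
  assumes "t \<noteq> 0"
  shows "(LINT u|unit_uniform. iexp (t * u)) = (iexp t - 1) / (\<i> * t)"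
proof -
  have "(LINT u|unit_uniform. iexp (t * u)) = (LINT u|lborel. indicator {0..1} u *\<^sub>R iexp (t * u))"
    unfolding unit_uniform_def by (subst integral_density) auto
  also have "\<dots> = iexp (t * 1) / (\<i> * t) - iexp (t * 0) / (\<i> * t)"
  proof (rule integral_FTC_atLeastAtMost)
    fix x :: real
    show "((\<lambda>u. iexp (t * u) / (\<i> * t)) has_vector_derivative iexp (t * x)) (at x within {0..1})"
      using assms by (auto intro!: derivative_eq_intros has_vector_derivative_real_field simp: field_simps)
  qed (auto intro!: continuous_intros)
  finally show ?thesis by (simp add: diff_divide_distrib)
qed

text \<open>
  The integral over the half line is the limit of the integrals over \<open>{0..n}\<close>, which have a primitive.
\<close>

lemma char_unit_exponential:
  "(LINT v|unit_exponential. iexp (t * v)) = 1 / (1 - \<i> * t)"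
proof -
  let ?z = "\<i> * complex_of_real t - 1"
  have z: "?z \<noteq> 0" by (simp add: complex_eq_iff)
  have deriv: "((\<lambda>v. exp (z * complex_of_real v) / z) has_vector_derivative exp (z * complex_of_real x)) (at x within S)"
    if "z \<noteq> 0" for z x S
    using that by (auto intro!: derivative_eq_intros has_vector_derivative_real_field)
  have "(LINT v|unit_exponential. iexp (t * v)) = (LINT v|lborel. exponential_density 1 v *\<^sub>R iexp (t * v))"
    unfolding unit_exponential_def by (subst integral_density) (auto simp: exponential_density_def)
  also have "\<dots> = (LINT v|lborel. indicator {0..} v *\<^sub>R exp (?z * complex_of_real v))"
    by (intro Bochner_Integration.integral_cong)
       (auto simp: exponential_density_def indicator_def scaleR_conv_of_real algebra_simps exp_diff exp_minus divide_inverse simp flip: exp_of_real)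
  finally have 1: "(LINT v|unit_exponential. iexp (t * v)) = (LINT v|lborel. indicator {0..} v *\<^sub>R exp (?z * complex_of_real v))" .
  have partial: "(LINT v|lborel. indicator {0..real n} v *\<^sub>R exp (?z * v)) = exp (?z * real n) / ?z - exp (?z * complex_of_real 0) / ?z" for n :: nat
  proof (rule integral_FTC_atLeastAtMost)
    fix x :: real
    show "((\<lambda>v. exp (?z * v) / ?z) has_vector_derivative exp (?z * x)) (at x within {0..real n})"
      by (rule deriv[OF z])
  qed (auto intro!: continuous_intros)
  have dom: "integrable lborel (exponential_density 1)"
    using prob_space.finite_measure[OF prob_space_unit_exponential]
    by (intro integrableI_nonneg)
       (auto simp: exponential_density_def unit_exponential_def finite_measure_def finite_measure_axioms_def emeasure_density less_top)
  have "(\<lambda>n. LINT v|lborel. indicator {0..real n} v *\<^sub>R exp (?z * v)) \<longlonglongrightarrow> (LINT v|lborel. indicator {0..} v *\<^sub>R exp (?z * complex_of_real v))"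
  proof (rule integral_dominated_convergence[OF _ _ dom])
    show "AE v in lborel. (\<lambda>n. indicator {0..real n} v *\<^sub>R exp (?z * v)) \<longlonglongrightarrow> indicator {0..} v *\<^sub>R exp (?z * complex_of_real v)"
    proof (intro AE_I2 tendsto_eventually)
      fix v :: real
      show "\<forall>\<^sub>F n in sequentially. indicator {0..real n} v *\<^sub>R exp (?z * v) = indicator {0..} v *\<^sub>R exp (?z * complex_of_real v)"
        using eventually_ge_at_top[of "nat \<lceil>v\<rceil>"]
        by eventually_elim (auto simp: indicator_def nat_le_iff ceiling_le_iff)
    qed
    show "AE v in lborel. norm (indicator {0..real n} v *\<^sub>R exp (?z * v)) \<le> exponential_density 1 v" for n
      by (intro AE_I2) (auto simp: exponential_density_def indicator_def)
  qed auto
  moreover have "(\<lambda>n. exp (?z * real n) / ?z - exp (?z * complex_of_real 0) / ?z) \<longlonglongrightarrow> 0 / ?z - exp (?z * complex_of_real 0) / ?z"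
  proof (intro tendsto_intros z)
    have "(\<lambda>n. exp (- real n)) \<longlonglongrightarrow> 0" by real_asymp
    then show "(\<lambda>n. exp (?z * real n)) \<longlonglongrightarrow> 0"
      by (rule Lim_null_comparison[rotated]) (auto intro!: always_eventually)
  qed
  ultimately have "(LINT v|lborel. indicator {0..} v *\<^sub>R exp (?z * complex_of_real v)) = - 1 / ?z"
    unfolding partial by (auto dest: LIMSEQ_unique)
  then show ?thesis unfolding 1 using z by (simp add: divide_simps) (simp add: algebra_simps)
qed

text \<open>
  The law of \<open>a U - Z / (2 \<theta>)\<close>.  Multiplied by \<open>a / \<theta>\<close> it is the occupation measure of Brownian motion
  with drift \<open>\<theta>\<close> before its first visit to \<open>a\<close>.
\<close>

definition occupation_law :: "real \<Rightarrow> real \<Rightarrow> real measure" where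
  "occupation_law a \<theta> = distr (unit_uniform \<Otimes>\<^sub>M unit_exponential) borel (\<lambda>(u, v). a * u - v / (2 * \<theta>))"

lemma real_distribution_occupation_law: "real_distribution (occupation_law a \<theta>)"
proof -
  interpret U: prob_space unit_uniform by (rule prob_space_unit_uniform)
  interpret E: prob_space unit_exponential by (rule prob_space_unit_exponential)
  interpret pair_prob_space unit_uniform unit_exponential ..
  show ?thesis unfolding occupation_law_def
    by (rule real_distribution_distr) measurable
qed

text \<open>
  The characteristic functions of \<open>a U\<close> and of \<open>- Z / (2 \<theta>)\<close> are \<open>(exp (\<i> \<mu> a) - 1) / (\<i> \<mu> a)\<close> and
  \<open>1 / (1 + \<i> \<mu> / (2 \<theta>))\<close>, and \<open>\<kappa> = \<i> \<mu> \<theta> (1 + \<i> \<mu> / (2 \<theta>))\<close>.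
\<close>

lemma char_occupation_law:
  assumes "0 < a" "0 < \<theta>" "\<mu> \<noteq> 0"
  shows "(\<i> * \<mu> * \<theta> - \<mu>\<^sup>2 / 2) * (a / \<theta> * char (occupation_law a \<theta>) \<mu>) = iexp (\<mu> * a) - 1"
proof -
  interpret U: prob_space unit_uniform by (rule prob_space_unit_uniform)
  interpret E: prob_space unit_exponential by (rule prob_space_unit_exponential)
  interpret P: pair_prob_space unit_uniform unit_exponential ..
  let ?f = "\<lambda>(u, v). iexp (\<mu> * a * u) * iexp (- \<mu> / (2 * \<theta>) * v)"
  have "char (occupation_law a \<theta>) \<mu> = (LINT p|(unit_uniform \<Otimes>\<^sub>M unit_exponential). ?f p)"
    unfolding char_def occupation_law_def
    by (subst integral_distr) (auto intro!: Bochner_Integration.integral_cong simp: algebra_simps simp flip: exp_add)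
  also have "\<dots> = (LINT u|unit_uniform. LINT v|unit_exponential. ?f (u, v))"
    by (rule P.integral_fst'[symmetric], rule P.integrable_const_bound[where B=1]) (auto simp: norm_mult)
  also have "\<dots> = (LINT u|unit_uniform. iexp (\<mu> * a * u)) * (LINT v|unit_exponential. iexp (- \<mu> / (2 * \<theta>) * v))"
    by simp
  also have "\<dots> = (iexp (\<mu> * a) - 1) / (\<i> * (\<mu> * a)) * (1 / (1 + \<i> * \<mu> / (2 * \<theta>)))"
    using assms by (subst char_unit_uniform, simp, subst char_unit_exponential) simp
  finally have char: "char (occupation_law a \<theta>) \<mu> = (iexp (\<mu> * a) - 1) / (\<i> * (\<mu> * a)) * (1 / (1 + \<i> * \<mu> / (2 * \<theta>)))" .
  have nz: "1 + \<i> * complex_of_real \<mu> / (2 * complex_of_real \<theta>) \<noteq> 0"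
    by (simp add: complex_eq_iff)
  have "\<i> * \<mu> * \<theta> - \<mu>\<^sup>2 / 2 = \<i> * \<mu> * \<theta> * (1 + \<i> * \<mu> / (2 * \<theta>))"
    using assms by (simp add: complex_eq_iff power2_eq_square)
  moreover have "\<i> * \<mu> * \<theta> * D * (a / \<theta> * (E / (\<i> * (\<mu> * a)) * (1 / D))) = E" if "D \<noteq> 0" for D E :: complex
    using assms that by (simp add: field_simps)
  ultimately show ?thesis unfolding char using nz by simp
qed

lemma nn_integral_occupation_law:
  assumes [measurable]: "g \<in> borel_measurable borel"
  shows "(\<integral>\<^sup>+x. g x \<partial>occupation_law a \<theta>)
    = (\<integral>\<^sup>+u. indicator {0..1} u * (\<integral>\<^sup>+v. indicator {0..} v * ennreal (exp (- v)) * g (a * u - v / (2 * \<theta>)) \<partial>lborel) \<partial>lborel)"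
proof -
  interpret E: prob_space unit_exponential by (rule prob_space_unit_exponential)
  have "(\<integral>\<^sup>+x. g x \<partial>occupation_law a \<theta>) = (\<integral>\<^sup>+p. g (case p of (u, v) \<Rightarrow> a * u - v / (2 * \<theta>)) \<partial>(unit_uniform \<Otimes>\<^sub>M unit_exponential))"
    unfolding occupation_law_def by (subst nn_integral_distr) auto
  also have "\<dots> = (\<integral>\<^sup>+u. \<integral>\<^sup>+v. g (a * u - v / (2 * \<theta>)) \<partial>unit_exponential \<partial>unit_uniform)"
    by (subst E.nn_integral_fst[symmetric]) auto
  also have "\<dots> = (\<integral>\<^sup>+u. indicator {0..1} u * (\<integral>\<^sup>+v. g (a * u - v / (2 * \<theta>)) \<partial>unit_exponential) \<partial>lborel)"
    unfolding unit_uniform_def by (subst nn_integral_density) (auto simp: ennreal_indicator)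
  also have "\<dots> = (\<integral>\<^sup>+u. indicator {0..1} u * (\<integral>\<^sup>+v. indicator {0..} v * ennreal (exp (- v)) * g (a * u - v / (2 * \<theta>)) \<partial>lborel) \<partial>lborel)"
    unfolding unit_exponential_def
    by (intro nn_integral_cong, subst nn_integral_density)
       (auto intro!: nn_integral_cong arg_cong2[where f="(*)"] simp: exponential_density_def indicator_def)
  finally show ?thesis .
qed

section \<open>Hitting times and occupation measures of Brownian motion\<close>

lemma nat_floor_dyadic_tendsto:
  fixes s :: real
  shows "(\<lambda>n. real (nat \<lfloor>s * 2^n\<rfloor>) / 2^n) \<longlonglongrightarrow> max 0 s"
proof -
  have lower: "max 0 s - (1/2)^n \<le> real (nat \<lfloor>s * 2^n\<rfloor>) / 2^n" and upper: "real (nat \<lfloor>s * 2^n\<rfloor>) / 2^n \<le> max 0 s" for n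
  proof -
    have "real (nat \<lfloor>s * 2^n\<rfloor>) \<le> max 0 s * 2^n"
    proof (cases "0 \<le> s")
      case False
      then have "s * 2^n \<le> 0" by (simp add: mult_nonpos_nonneg)
      then have "\<lfloor>s * 2^n\<rfloor> \<le> 0" by (simp add: floor_le_iff)
      then show ?thesis using False by simp
    qed simp
    then show "real (nat \<lfloor>s * 2^n\<rfloor>) / 2^n \<le> max 0 s" by (simp add: field_simps)
    have "max 0 s * 2^n - 1 \<le> real (nat \<lfloor>s * 2^n\<rfloor>)"
    proof (cases "0 \<le> s")
      case True
      then have "0 \<le> \<lfloor>s * 2^n\<rfloor>" by simp
      then have "real (nat \<lfloor>s * 2^n\<rfloor>) = real_of_int \<lfloor>s * 2^n\<rfloor>" by simp
      then show ?thesis using True by (simp add: max_def)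
    qed (simp add: max_def)
    then have "(max 0 s * 2^n - 1) / 2^n \<le> real (nat \<lfloor>s * 2^n\<rfloor>) / 2^n" by (rule divide_right_mono) simp
    then show "max 0 s - (1/2)^n \<le> real (nat \<lfloor>s * 2^n\<rfloor>) / 2^n" by (simp add: diff_divide_distrib power_divide)
  qed
  have "(\<lambda>n. (1/2::real)^n) \<longlonglongrightarrow> 0" by (rule LIMSEQ_power_zero) simp
  from tendsto_diff[OF tendsto_const this] have "(\<lambda>n. max 0 s - (1/2)^n) \<longlonglongrightarrow> max 0 s" by simp
  then show ?thesis
    by (rule tendsto_sandwich[OF always_eventually[OF allI[OF lower]] always_eventually[OF allI[OF upper]] _ tendsto_const])
qed

text \<open>
  By compactness a continuous path attains \<open>a\<close> on \<open>{0..r}\<close> if it comes arbitrarily close to \<open>a\<close>, and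
  closeness can be tested at countably many times.
\<close>

lemma reaches_iff_approximates:
  fixes w :: "real \<Rightarrow> real"
  assumes w: "continuous_on {0..} w" and r: "0 \<le> r"
  shows "(\<exists>t. 0 \<le> t \<and> t \<le> r \<and> w t = a) \<longleftrightarrow>
    (\<forall>m. \<exists>n k. w (min r (real k / 2^n)) \<in> ball a (1 / real (Suc m)))" (is "?L \<longleftrightarrow> ?R")
proof
  assume ?L
  then obtain t where t: "0 \<le> t" "t \<le> r" "w t = a" by blast
  show ?R
  proof
    fix m
    have "(\<lambda>n. min r (real (nat \<lfloor>t * 2^n\<rfloor>) / 2^n)) \<longlonglongrightarrow> min r (max 0 t)"
      by (intro tendsto_intros nat_floor_dyadic_tendsto)
    moreover have "min r (max 0 t) = t" using t by simp
    ultimately have lim: "(\<lambda>n. min r (real (nat \<lfloor>t * 2^n\<rfloor>) / 2^n)) \<longlonglongrightarrow> t" by simp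
    have "(\<lambda>n. w (min r (real (nat \<lfloor>t * 2^n\<rfloor>) / 2^n))) \<longlonglongrightarrow> w t"
      by (rule continuous_on_tendsto_compose[OF w lim]) (use t r in auto)
    then have "\<forall>\<^sub>F n in sequentially. w (min r (real (nat \<lfloor>t * 2^n\<rfloor>) / 2^n)) \<in> ball a (1 / real (Suc m))"
      using t by (intro topological_tendstoD) auto
    then show "\<exists>n k. w (min r (real k / 2^n)) \<in> ball a (1 / real (Suc m))"
      using eventually_happens'[OF sequentially_bot] by blast
  qed
next
  assume R: ?R
  have "continuous_on {0..r} (\<lambda>t. dist a (w t))"
    by (intro continuous_intros continuous_on_subset[OF w]) auto
  then obtain t where t: "t \<in> {0..r}" "\<And>s. s \<in> {0..r} \<Longrightarrow> dist a (w t) \<le> dist a (w s)"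
    using continuous_attains_inf[of "{0..r}" "\<lambda>t. dist a (w t)"] r by auto
  have "dist a (w t) < 1 / real (Suc m)" for m
  proof -
    obtain n k where "w (min r (real k / 2^n)) \<in> ball a (1 / real (Suc m))" using R by blast
    then show ?thesis using t(2)[of "min r (real k / 2^n)"] r by auto
  qed
  note less = this
  have "dist a (w t) = 0"
  proof (rule ccontr)
    assume "dist a (w t) \<noteq> 0"
    then have "0 < dist a (w t)" by simp
    then obtain m where "1 / real (Suc m) < dist a (w t)" by (rule nat_approx_posE)
    then show False using less[of m] by linarith
  qed
  then show ?L using t(1) by auto
qed

context standard_brownian_motion
begin

text \<open>
  Measurability is needed for every outcome, including the null event of paths that never hit \<open>a\<close>, on
  which the hitting time is the constant \<open>Inf {}\<close>, and of paths that do not start at 0.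
\<close>

lemma measurable_hitting_time:
  "hitting_time B a \<in> borel_measurable M"
proof -
  let ?S = "\<lambda>\<omega>. {t. 0 \<le> t \<and> B t \<omega> = a}"
  define E where "E r = {\<omega> \<in> space M. \<exists>t. 0 \<le> t \<and> t \<le> r \<and> B t \<omega> = a}" for r
  have E_sets: "E r \<in> sets M" for r
  proof (cases "0 \<le> r")
    case True
    have "E r = {\<omega> \<in> space M. \<forall>m. \<exists>n k. B (min r (real k / 2^n)) \<omega> \<in> ball a (1 / real (Suc m))}"
      unfolding E_def using reaches_iff_approximates[OF continuous_paths True] by blast
    also have "\<dots> \<in> sets M"
    proof -
      have [measurable]: "B (min r (real k / 2^n)) \<in> borel_measurable M" for k n :: nat
        using True by (intro measurable_B) auto
      show ?thesis unfolding mem_ball by measurable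
    qed
    finally show ?thesis .
  next
    case False
    then have "E r = {}" by (auto simp: E_def)
    then show ?thesis by simp
  qed
  have closed_S: "closed (?S \<omega>)" if "\<omega> \<in> space M" for \<omega>
  proof -
    have "closed ({0..} \<inter> (\<lambda>t. B t \<omega>) -` {a})"
      by (intro continuous_closed_preimage continuous_paths that) auto
    also have "{0..} \<inter> (\<lambda>t. B t \<omega>) -` {a} = ?S \<omega>" by auto
    finally show ?thesis .
  qed
  have "{\<omega> \<in> space M. hitting_time B a \<omega> \<le> r} \<in> sets M" for r
  proof -
    have "{\<omega> \<in> space M. hitting_time B a \<omega> \<le> r} =
      E r \<union> (if Inf {} \<le> r then space M - (\<Union>n. E (real n)) else {})" (is "?A = ?B")
    proof (intro set_eqI)
      fix \<omega>
      show "\<omega> \<in> ?A \<longleftrightarrow> \<omega> \<in> ?B"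
      proof (cases "\<omega> \<in> space M")
        case True
        show ?thesis
        proof (cases "?S \<omega> = {}")
          case empty: True
          have "hitting_time B a \<omega> = Inf {}" unfolding hitting_time_def empty ..
          moreover have "\<omega> \<notin> E r'" for r' using empty by (auto simp: E_def)
          ultimately show ?thesis using True by auto
        next
          case False
          have bdd: "bdd_below (?S \<omega>)" by (auto intro: bdd_belowI)
          have "hitting_time B a \<omega> \<in> ?S \<omega>"
            unfolding hitting_time_def by (rule closed_contains_Inf[OF False bdd closed_S[OF True]])
          note attained = this
          have "hitting_time B a \<omega> \<le> r \<longleftrightarrow> \<omega> \<in> E r"
          proof
            assume "\<omega> \<in> E r"
            then obtain t where "t \<in> ?S \<omega>" "t \<le> r" by (auto simp: E_def)
            then show "hitting_time B a \<omega> \<le> r"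
              unfolding hitting_time_def using cInf_lower[OF _ bdd, of t] by linarith
          qed (use True attained in \<open>auto simp: E_def\<close>)
          moreover obtain s where s: "s \<in> ?S \<omega>" using False by blast
          have "s \<le> real (nat \<lceil>s\<rceil>)" by linarith
          then have "\<omega> \<in> E (real (nat \<lceil>s\<rceil>))" using s True unfolding E_def by blast
          then have "\<omega> \<notin> space M - (\<Union>n. E (real n))" by blast
          ultimately show ?thesis using True by simp
        qed
      qed (auto simp: E_def)
    qed
    moreover have "?B \<in> sets M" using E_sets by auto
    ultimately show ?thesis by simp
  qed
  then show ?thesis by (intro borel_measurableI_le) auto
qed

text \<open>
  Replacing \<open>s\<close> by \<open>max 0 s\<close> extends the paths to continuous functions on the whole line.
\<close>

lemma measurable_B_joint:
  "(\<lambda>p. B (max 0 (snd p)) (fst p)) \<in> borel_measurable (M \<Otimes>\<^sub>M lborel)"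
proof (rule borel_measurable_LIMSEQ_metric)
  fix n :: nat
  have [measurable]: "(\<lambda>p. B (real k / 2^n) (fst p)) \<in> borel_measurable (M \<Otimes>\<^sub>M (lborel :: real measure))" for k :: nat
    by (rule measurable_compose[OF measurable_fst measurable_B]) simp
  show "(\<lambda>p. B (real (nat \<lfloor>(snd p :: real) * 2^n\<rfloor>) / 2^n) (fst p)) \<in> borel_measurable (M \<Otimes>\<^sub>M lborel)"
    by (rule measurable_compose_countable[where g="\<lambda>p. nat \<lfloor>(snd p :: real) * 2^n\<rfloor>" and f="\<lambda>k p. B (real k / 2^n) (fst p)"]) measurable
next
  fix p :: "'w \<times> real" assume "p \<in> space (M \<Otimes>\<^sub>M lborel)"
  then have "fst p \<in> space M" by (auto simp: space_pair_measure)
  then show "(\<lambda>n. B (real (nat \<lfloor>snd p * 2^n\<rfloor>) / 2^n) (fst p)) \<longlonglongrightarrow> B (max 0 (snd p)) (fst p)"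
    by (intro continuous_on_tendsto_compose[OF continuous_paths nat_floor_dyadic_tendsto]) auto
qed

lemma measurable_window [measurable]:
  assumes [measurable]: "T \<in> borel_measurable M"
  shows "Measurable.pred (M \<Otimes>\<^sub>M lborel) (\<lambda>p. snd p \<in> {0..T (fst p) :: real})"
  unfolding atLeastAtMost_iff by measurable

text \<open>
  The event is recovered from the integrand of \<open>stopped_identity\<close>, whose exponential factor never
  vanishes.
\<close>

lemma W_hits_sets: assumes "0 < a" shows "{\<omega> \<in> space M. W_hits a \<omega>} \<in> sets M"
proof -
  have [measurable]: "(\<lambda>\<omega>. of_bool (W_hits a \<omega>) * tilt 1 0 (hitting_time W a \<omega>) a) \<in> borel_measurable M"
    using stopped_identity(1)[OF zero_less_one assms] by simp
  have "{\<omega> \<in> space M. W_hits a \<omega>} = {\<omega> \<in> space M. of_bool (W_hits a \<omega>) * tilt 1 0 (hitting_time W a \<omega>) a \<noteq> 0}"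
    by (auto simp: tilt_def)
  also have "\<dots> \<in> sets M" by measurable
  finally show ?thesis .
qed

lemma tilt_0: "tilt \<theta> 0 t x = complex_of_real (exp (\<theta> * x) * exp (- (\<theta>\<^sup>2 / 2 * t)))"
proof -
  have "Complex \<theta> 0 * complex_of_real x - complex_of_real (\<theta>\<^sup>2 / 2 * t) = complex_of_real (\<theta> * x + - (\<theta>\<^sup>2 / 2 * t))"
    by (simp add: complex_eq_iff)
  then show ?thesis unfolding tilt_def by (simp only: exp_of_real exp_add)
qed

text \<open>
  For \<open>\<mu> = 0\<close> the rate \<open>\<kappa>\<close> is 0 and \<open>stopped_identity\<close> gives the Laplace transform \<open>exp (- \<theta> a)\<close> of \<open>T\<close> on the
  event that \<open>a\<close> is hit.  It bounds the probability of this event from below, for every \<open>\<theta> > 0\<close>.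
\<close>

lemma AE_W_hits:
  assumes a: "0 < a"
  shows "AE \<omega> in M. W_hits a \<omega>"
proof -
  have le: "exp (- \<theta> * a) \<le> prob {\<omega> \<in> space M. W_hits a \<omega>}" if \<theta>: "0 < \<theta>" for \<theta>
  proof -
    let ?f = "\<lambda>\<omega>. of_bool (W_hits a \<omega>) * (exp (\<theta> * a) * exp (- (\<theta>\<^sup>2 / 2 * hitting_time W a \<omega>)))"
    have c: "of_bool (W_hits a \<omega>) * tilt \<theta> 0 (hitting_time W a \<omega>) a = complex_of_real (?f \<omega>)" for \<omega>
      by (simp add: tilt_0)
    have f_int: "integrable M ?f"
      using stopped_identity(1)[OF \<theta> a, of 0] unfolding c by (simp only: complex_of_real_integrable_eq)
    have "complex_of_real (LINT \<omega>|M. ?f \<omega>) = (LINT \<omega>|M. of_bool (W_hits a \<omega>) * tilt \<theta> 0 (hitting_time W a \<omega>) a)"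
      unfolding c by (rule integral_complex_of_real[symmetric])
    also have "\<dots> = 1" using stopped_identity(3)[OF \<theta> a, of 0] by simp
    finally have "(LINT \<omega>|M. ?f \<omega>) = 1" unfolding of_real_eq_1_iff .
    then have "1 = (LINT \<omega>|M. ?f \<omega>)" by (rule sym)
    also have "\<dots> \<le> (LINT \<omega>|M. exp (\<theta> * a) * indicator {\<omega> \<in> space M. W_hits a \<omega>} \<omega>)"
    proof (rule integral_mono[OF f_int])
      show "integrable M (\<lambda>\<omega>. exp (\<theta> * a) * indicator {\<omega> \<in> space M. W_hits a \<omega>} \<omega> :: real)"
        using W_hits_sets[OF a]
        by (intro integrable_mult_right integrable_real_indicator) (auto simp: emeasure_eq_measure)
      fix \<omega> assume \<omega>: "\<omega> \<in> space M"
      have "0 \<le> hitting_time W a \<omega>" if "W_hits a \<omega>"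
        using that unfolding hitting_time_def W_hits_def by (intro cInf_greatest) auto
      then have "exp (- (\<theta>\<^sup>2 / 2 * hitting_time W a \<omega>)) \<le> 1" if "W_hits a \<omega>"
        using that by simp
      then show "?f \<omega> \<le> exp (\<theta> * a) * indicator {\<omega> \<in> space M. W_hits a \<omega>} \<omega>"
        using \<omega> by (cases "W_hits a \<omega>") simp_all
    qed
    also have "\<dots> = exp (\<theta> * a) * prob {\<omega> \<in> space M. W_hits a \<omega>}" using W_hits_sets[OF a] by simp
    finally have "exp (- \<theta> * a) * 1 \<le> exp (- \<theta> * a) * (exp (\<theta> * a) * prob {\<omega> \<in> space M. W_hits a \<omega>})"
      by (intro mult_left_mono) auto
    moreover have "exp (- \<theta> * a) * exp (\<theta> * a) = 1" by (simp flip: exp_add)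
    ultimately show ?thesis by (simp only: mult.assoc[symmetric] mult_1_left mult_1_right)
  qed
  have "1 \<le> prob {\<omega> \<in> space M. W_hits a \<omega>} + e" if "0 < e" for e
    \<comment> \<open>exp (- e) is at least 1 - e.\<close>
    using le[of "e / a"] exp_ge_add_one_self[of "- e"] a that by simp
  then have "1 \<le> prob {\<omega> \<in> space M. W_hits a \<omega>}" by (rule field_le_epsilon)
  then have "prob {\<omega> \<in> space M. W_hits a \<omega>} = 1" using prob_le_1 by (intro antisym)
  then show ?thesis using W_hits_sets[OF a] by (simp add: prob_Collect_eq_1)
qed

lemma AE_paths_hit:
  assumes a: "0 < a"
  shows "AE \<omega> in M. \<omega> \<in> space M \<and> (\<forall>t. W t \<omega> = B t \<omega>) \<and> hitting_time W a \<omega> = hitting_time B a \<omega>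
    \<and> W_hits a \<omega> \<and> 0 < hitting_time B a \<omega>"
  using starts_at_0 AE_W_hits[OF a] AE_space
proof eventually_elim
  case (elim \<omega>)
  then have eq: "W t \<omega> = B t \<omega>" for t by (simp add: W_def)
  then have h: "hitting_time W a \<omega> = hitting_time B a \<omega>" by (simp add: hitting_time_def)
  obtain s where s: "0 \<le> s" "W s \<omega> = a" using elim(2) by (auto simp: W_hits_def)
  have "0 < hitting_time W a \<omega>"
    unfolding hitting_time_def by (rule hitting_time_attained(1)[OF continuous_W W_0 a s]) (rule elim(3))
  then show ?case using eq h elim by simp
qed

text \<open>
  This is \<open>stopped_identity\<close> for \<open>B\<close> itself.  The Laplace transform of \<open>T\<close>, which is the case \<open>\<mu> = 0\<close>,
  evaluates the stopped exponential.
\<close>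

lemma stopped_fourier:
  fixes \<theta> \<mu> a :: real
  assumes \<theta>: "0 < \<theta>" and a: "0 < a"
  defines "T \<equiv> hitting_time B a"
  shows "(\<i> * \<mu> * \<theta> - \<mu>\<^sup>2 / 2) *
      (LINT \<omega>|M. exp (- (\<theta>\<^sup>2 / 2 * T \<omega>)) *\<^sub>R (LINT s:{0..T \<omega>}|lborel. iexp (\<mu> * B (max 0 s) \<omega>)))
    = exp (- \<theta> * a) * (iexp (\<mu> * a) - 1)"
proof -
  let ?G = "\<lambda>\<omega>. exp (- (\<theta>\<^sup>2 / 2 * T \<omega>)) *\<^sub>R (LINT s:{0..T \<omega>}|lborel. iexp (\<mu> * B (max 0 s) \<omega>))"
  have laplace: "(LINT \<omega>|M. of_bool (W_hits a \<omega>) * tilt \<theta> \<nu> (hitting_time W a \<omega>) a)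
      = exp (\<i> * (\<nu> * a)) * (LINT \<omega>|M. of_bool (W_hits a \<omega>) * tilt \<theta> 0 (hitting_time W a \<omega>) a)" for \<nu>
  proof -
    have "tilt \<theta> \<nu> t a = exp (\<i> * (\<nu> * a)) * tilt \<theta> 0 t a" for t
    proof -
      have "Complex \<theta> \<nu> * a - complex_of_real (\<theta>\<^sup>2 / 2 * t) = \<i> * (\<nu> * a) + (Complex \<theta> 0 * a - complex_of_real (\<theta>\<^sup>2 / 2 * t))"
        by (simp add: complex_eq_iff)
      then show ?thesis unfolding tilt_def by (simp only: exp_add)
    qed
    then have shift: "of_bool (W_hits a \<omega>) * tilt \<theta> \<nu> (hitting_time W a \<omega>) a
       = exp (\<i> * (\<nu> * a)) * (of_bool (W_hits a \<omega>) * tilt \<theta> 0 (hitting_time W a \<omega>) a)" for \<omega> by simp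
    show ?thesis unfolding shift by (rule integral_mult_right_zero)
  qed
  have one: "(LINT \<omega>|M. of_bool (W_hits a \<omega>) * tilt \<theta> 0 (hitting_time W a \<omega>) a) = 1"
    using stopped_identity(3)[OF \<theta> a, of 0] by simp
  have "(LINT \<omega>|M. of_bool (W_hits a \<omega>) * (tilt \<theta> 0 (hitting_time W a \<omega>) a * integral {0..hitting_time W a \<omega>} (\<lambda>s. iexp (\<mu> * W s \<omega>))))
     = (LINT \<omega>|M. exp (\<theta> * a) * ?G \<omega>)"
  proof (rule integral_cong_AE)
    have [measurable]: "T \<in> borel_measurable M" unfolding T_def by (rule measurable_hitting_time)
    have "(\<lambda>p. indicat_real {0..T (fst p)} (snd p) *\<^sub>R iexp (\<mu> * B (max 0 (snd p)) (fst p))) \<in> borel_measurable (M \<Otimes>\<^sub>M lborel)"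
      using measurable_B_joint by measurable
    then have "(\<lambda>\<omega>. LINT s:{0..T \<omega>}|lborel. iexp (\<mu> * B (max 0 s) \<omega>)) \<in> borel_measurable M"
      unfolding set_lebesgue_integral_def
      by (intro lborel.borel_measurable_lebesgue_integral) (simp add: case_prod_beta)
    then show "(\<lambda>\<omega>. exp (\<theta> * a) * ?G \<omega>) \<in> borel_measurable M" by measurable
    show "AE \<omega> in M. of_bool (W_hits a \<omega>) * (tilt \<theta> 0 (hitting_time W a \<omega>) a * integral {0..hitting_time W a \<omega>} (\<lambda>s. iexp (\<mu> * W s \<omega>)))
        = exp (\<theta> * a) * ?G \<omega>"
      using AE_paths_hit[OF a]
    proof eventually_elim
      case (elim \<omega>)
      then have cont: "continuous_on {0..T \<omega>} (\<lambda>s. iexp (\<mu> * B (max 0 s) \<omega>))"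
        by (intro continuous_intros continuous_on_compose2[OF continuous_paths[of \<omega>]]) auto
      have "(LINT s:{0..T \<omega>}|lborel. iexp (\<mu> * B (max 0 s) \<omega>)) = integral {0..T \<omega>} (\<lambda>s. iexp (\<mu> * B (max 0 s) \<omega>))"
        by (rule set_borel_integral_eq_integral(2)[OF borel_integrable_atLeastAtMost'[OF cont]])
      also have "\<dots> = integral {0..T \<omega>} (\<lambda>s. iexp (\<mu> * W s \<omega>))"
        using elim by (intro Henstock_Kurzweil_Integration.integral_cong) auto
      finally show ?case using elim by (simp add: tilt_0 T_def scaleR_conv_of_real)
    qed
  qed (use stopped_identity(2)[OF \<theta> a, of \<mu>] in simp)
  also have "\<dots> = exp (\<theta> * a) * (LINT \<omega>|M. ?G \<omega>)" by (rule integral_mult_right_zero)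
  finally have "iexp (\<mu> * a) - 1 = (\<i> * \<mu> * \<theta> - \<mu>\<^sup>2 / 2) * (complex_of_real (exp (\<theta> * a)) * (LINT \<omega>|M. ?G \<omega>))"
    using stopped_identity(3)[OF \<theta> a, of \<mu>] unfolding laplace[of \<mu>] one by simp
  then have "complex_of_real (exp (- \<theta> * a)) * (iexp (\<mu> * a) - 1)
     = (complex_of_real (exp (- \<theta> * a)) * complex_of_real (exp (\<theta> * a))) * ((\<i> * \<mu> * \<theta> - \<mu>\<^sup>2 / 2) * (LINT \<omega>|M. ?G \<omega>))"
    by (simp only: mult_ac)
  also have "complex_of_real (exp (- \<theta> * a)) * complex_of_real (exp (\<theta> * a)) = 1"
    by (simp flip: of_real_mult exp_add)
  finally show ?thesis by simp
qed

end

context standard_brownian_motion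
begin

text \<open>
  The left-hand side is the integral of \<open>g\<close> with respect to the image \<open>N\<close> of a weighted product measure
  under \<open>(\<omega>, s) \<mapsto> B s \<omega>\<close>.  By Fubini its Fourier transform is the one in \<open>stopped_fourier\<close>.
\<close>

proposition occupation_identity:
  fixes g :: "real \<Rightarrow> ennreal" and \<theta> a :: real
  assumes \<theta>: "0 < \<theta>" and a: "0 < a" and g [measurable]: "g \<in> borel_measurable borel"
  defines "T \<equiv> hitting_time B a"
  shows "(\<integral>\<^sup>+\<omega>. \<integral>\<^sup>+s. ennreal (exp (- (\<theta>\<^sup>2 / 2 * T \<omega>)) * indicat_real {0..T \<omega>} s) * g (B (max 0 s) \<omega>) \<partial>lborel \<partial>M)
    = ennreal (exp (- \<theta> * a) * (a / \<theta>)) * (\<integral>\<^sup>+x. g x \<partial>occupation_law a \<theta>)"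
proof -
  interpret P: pair_sigma_finite M "lborel :: real measure" ..
  define l where "l = \<theta>\<^sup>2 / 2"
  have l: "0 < l" using \<theta> by (simp add: l_def)
  have [measurable]: "T \<in> borel_measurable M" unfolding T_def by (rule measurable_hitting_time)
  define d where "d p = exp (- (l * T (fst p))) * indicat_real {0..T (fst p)} (snd p)" for p
  define X where "X p = B (max 0 (snd p)) (fst p)" for p
  have d_meas [measurable]: "d \<in> borel_measurable (M \<Otimes>\<^sub>M lborel)" unfolding d_def[abs_def] by measurable
  have X_meas [measurable]: "X \<in> borel_measurable (M \<Otimes>\<^sub>M lborel)"
    unfolding X_def[abs_def] by (rule measurable_B_joint)
  have d_nonneg: "0 \<le> d p" for p by (simp add: d_def)
  define D where "D = density (M \<Otimes>\<^sub>M lborel) (\<lambda>p. ennreal (d p))"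
  define N where "N = distr D borel X"
  have X_D [measurable]: "X \<in> borel_measurable D" unfolding D_def by measurable
  have nn_N: "(\<integral>\<^sup>+x. f x \<partial>N) = (\<integral>\<^sup>+\<omega>. \<integral>\<^sup>+s. ennreal (d (\<omega>, s)) * f (X (\<omega>, s)) \<partial>lborel \<partial>M)"
    if [measurable]: "f \<in> borel_measurable borel" for f :: "real \<Rightarrow> ennreal"
  proof -
    have "(\<integral>\<^sup>+x. f x \<partial>N) = (\<integral>\<^sup>+p. f (X p) \<partial>D)" unfolding N_def by (rule nn_integral_distr) measurable
    also have "\<dots> = (\<integral>\<^sup>+p. ennreal (d p) * f (X p) \<partial>(M \<Otimes>\<^sub>M lborel))"
      unfolding D_def by (rule nn_integral_density) measurable
    also have "\<dots> = (\<integral>\<^sup>+\<omega>. \<integral>\<^sup>+s. ennreal (d (\<omega>, s)) * f (X (\<omega>, s)) \<partial>lborel \<partial>M)"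
      by (rule lborel.nn_integral_fst[symmetric]) measurable
    finally show ?thesis .
  qed
  have slice_le: "(\<integral>\<^sup>+s. ennreal (d (\<omega>, s)) \<partial>lborel) \<le> ennreal (1 / l)" for \<omega>
  proof -
    have "(\<integral>\<^sup>+s. ennreal (d (\<omega>, s)) \<partial>lborel) = (\<integral>\<^sup>+s. ennreal (exp (- (l * T \<omega>))) * indicator {0..T \<omega>} s \<partial>lborel)"
      by (intro nn_integral_cong) (auto simp: d_def indicator_def)
    also have "\<dots> = ennreal (exp (- (l * T \<omega>))) * emeasure lborel {0..T \<omega>}"
      by (rule nn_integral_cmult_indicator) simp
    also have "\<dots> \<le> ennreal (1 / l)"
    proof (cases "0 \<le> T \<omega>")
      case True
      then show ?thesis
        using mult_exp_neg_le[OF l, of "T \<omega>"] by (simp add: mult.commute ennreal_leI flip: ennreal_mult')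
    qed simp
    finally show ?thesis .
  qed
  have N_mass: "emeasure N (space N) \<noteq> \<infinity>"
  proof -
    have "emeasure N (space N) = (\<integral>\<^sup>+x. 1 \<partial>N)" by simp
    also have "\<dots> = (\<integral>\<^sup>+\<omega>. \<integral>\<^sup>+s. ennreal (d (\<omega>, s)) \<partial>lborel \<partial>M)" by (subst nn_N) auto
    also have "\<dots> \<le> (\<integral>\<^sup>+\<omega>. ennreal (1 / l) \<partial>M)" by (intro nn_integral_mono slice_le)
    also have "\<dots> = ennreal (1 / l)" by (simp add: emeasure_space_1)
    finally show ?thesis by (auto simp: top_unique)
  qed
  then interpret N: finite_measure N by (rule finite_measureI)
  have N_sets: "sets N = sets borel" by (simp add: N_def)
  have char_N: "(LINT x|N. iexp (\<mu> * x)) = exp (- \<theta> * a) * (a / \<theta>) * char (occupation_law a \<theta>) \<mu>" if \<mu>: "\<mu> \<noteq> 0" for \<mu>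
  proof -
    have "integrable N (\<lambda>x. iexp (\<mu> * x))"
      by (rule N.integrable_const_bound[where B=1]) (auto simp: N_def)
    then have "integrable D (\<lambda>p. iexp (\<mu> * X p))"
      unfolding N_def by (subst (asm) integrable_distr_eq) auto
    then have int: "integrable (M \<Otimes>\<^sub>M lborel) (\<lambda>p. d p *\<^sub>R iexp (\<mu> * X p))"
      unfolding D_def by (subst (asm) integrable_density) (auto simp: d_nonneg)
    have "(LINT x|N. iexp (\<mu> * x)) = (LINT p|D. iexp (\<mu> * X p))"
      unfolding N_def by (rule integral_distr) auto
    also have "\<dots> = (LINT p|(M \<Otimes>\<^sub>M lborel). d p *\<^sub>R iexp (\<mu> * X p))"
      unfolding D_def by (rule integral_density) (auto simp: d_nonneg)
    also have "\<dots> = (LINT \<omega>|M. LINT s|lborel. d (\<omega>, s) *\<^sub>R iexp (\<mu> * X (\<omega>, s)))"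
      by (rule P.integral_fst'[OF int, symmetric])
    also have "\<dots> = (LINT \<omega>|M. exp (- (\<theta>\<^sup>2 / 2 * T \<omega>)) *\<^sub>R (LINT s:{0..T \<omega>}|lborel. iexp (\<mu> * B (max 0 s) \<omega>)))"
      by (simp add: d_def X_def l_def set_lebesgue_integral_def flip: scaleR_scaleR)
    finally have I: "(\<i> * \<mu> * \<theta> - \<mu>\<^sup>2 / 2) * (LINT x|N. iexp (\<mu> * x)) = exp (- \<theta> * a) * (iexp (\<mu> * a) - 1)"
      using stopped_fourier[OF \<theta> a, of \<mu>] unfolding T_def by simp
    have "(\<i> * \<mu> * \<theta> - \<mu>\<^sup>2 / 2) * (exp (- \<theta> * a) * (a / \<theta>) * char (occupation_law a \<theta>) \<mu>)
       = exp (- \<theta> * a) * ((\<i> * \<mu> * \<theta> - \<mu>\<^sup>2 / 2) * (a / \<theta> * char (occupation_law a \<theta>) \<mu>))"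
      by (simp only: of_real_mult mult_ac)
    also have "\<dots> = (\<i> * \<mu> * \<theta> - \<mu>\<^sup>2 / 2) * (LINT x|N. iexp (\<mu> * x))"
    proof -
      have k: "(\<i> * \<mu> * \<theta> - \<mu>\<^sup>2 / 2) * (a / \<theta> * char (occupation_law a \<theta>) \<mu>) = iexp (\<mu> * a) - 1"
        using char_occupation_law[OF a \<theta> \<mu>] by simp
      show ?thesis unfolding k I by (rule refl)
    qed
    finally have eq: "(\<i> * \<mu> * \<theta> - \<mu>\<^sup>2 / 2) * (LINT x|N. iexp (\<mu> * x))
       = (\<i> * \<mu> * \<theta> - \<mu>\<^sup>2 / 2) * (exp (- \<theta> * a) * (a / \<theta>) * char (occupation_law a \<theta>) \<mu>)" by (rule sym)
    have "Re (\<i> * \<mu> * \<theta> - \<mu>\<^sup>2 / 2) \<noteq> 0" using \<mu> by simp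
    then have "\<i> * \<mu> * \<theta> - \<mu>\<^sup>2 / 2 \<noteq> 0" by (metis zero_complex.sel(1))
    then show ?thesis using eq by (simp only: mult_cancel_left simp_thms)
  qed
  have c: "0 < exp (- \<theta> * a) * (a / \<theta>)" using \<theta> a by simp
  have "(\<integral>\<^sup>+x. g x \<partial>N) = ennreal (exp (- \<theta> * a) * (a / \<theta>)) * (\<integral>\<^sup>+x. g x \<partial>occupation_law a \<theta>)"
  proof (rule finite_measure_eq_scaled_distribution[OF N.finite_measure_axioms N_sets real_distribution_occupation_law c _ g])
    fix \<mu> :: real assume "\<mu> \<noteq> 0"
    from char_N[OF this] show "(LINT x|N. iexp (\<mu> * x)) = complex_of_real (exp (- \<theta> * a) * (a / \<theta>)) * char (occupation_law a \<theta>) \<mu>"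
      by simp
  qed
  then show ?thesis unfolding nn_N[OF g] by (simp add: d_def X_def l_def)
qed

end

section \<open>Exponential integrals of signed powers\<close>

definition pos_power :: "real \<Rightarrow> real \<Rightarrow> real" where
  "pos_power m x = (if 0 < x then x powr m else 0)"

lemma pos_power_nonneg [simp]: "0 \<le> pos_power m x" by (simp add: pos_power_def)

lemma measurable_pos_power [measurable]: "pos_power m \<in> borel_measurable borel"
  unfolding pos_power_def[abs_def] by measurable

lemma pos_power_mult: "0 < c \<Longrightarrow> pos_power m (c * x) = c powr m * pos_power m x"
  by (simp add: pos_power_def powr_mult zero_less_mult_iff)

lemma nn_integral_exp_decay:
  assumes "0 < k"
  shows "(\<integral>\<^sup>+v. indicator {0..} v * ennreal (exp (- (k * v))) \<partial>lborel) = ennreal (1 / k)"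
proof -
  have "(\<integral>\<^sup>+v. indicator {0..} v * ennreal (exp (- (k * v))) \<partial>lborel)
     = (\<integral>\<^sup>+v. ennreal (1 / k) * ennreal (exponential_density k v) \<partial>lborel)"
    using assms by (intro nn_integral_cong)
      (auto simp: exponential_density_def indicator_def mult_ac simp flip: ennreal_mult)
  also have "\<dots> = ennreal (1 / k) * (\<integral>\<^sup>+v. ennreal (exponential_density k v) \<partial>lborel)"
    by (rule nn_integral_cmult) simp
  also have "(\<integral>\<^sup>+v. ennreal (exponential_density k v) \<partial>lborel) = 1"
    using prob_space.emeasure_space_1[OF prob_space_exponential_density[OF assms]]
    by (simp add: emeasure_density)
  finally show ?thesis by simp
qed

lemma nn_integral_pos_power_exp:
  assumes "0 \<le> m"
  shows "(\<integral>\<^sup>+z. ennreal (exp (- z) * pos_power m z) \<partial>lborel) = ennreal (Gamma (m + 1))"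
  using assms
  by (subst Gamma_conv_nn_integral_real)
     (auto intro!: nn_integral_cong simp: pos_power_def exp_minus field_simps indicator_def)

text \<open>
  For fixed \<open>v\<close> only \<open>r > v / (2 u)\<close> contributes; translating \<open>r\<close> by this amount leaves a Gamma integral,
  since the exponential weight has no memory.
\<close>

lemma positive_part_slice:
  assumes m: "0 \<le> m" and u: "0 < u"
  shows "(\<integral>\<^sup>+r. \<integral>\<^sup>+v. indicator {0..} r * (indicator {0..} v * ennreal (exp (- r) * (exp (- v) * pos_power m (r * u - v / 2)))) \<partial>lborel \<partial>lborel)
     = ennreal (Gamma (m + 1) * (u powr m * (2 * u / (1 + 2 * u))))"
proof -
  have inner: "(\<integral>\<^sup>+r. indicator {0..} r * (indicator {0..} v * ennreal (exp (- r) * (exp (- v) * pos_power m (r * u - v / 2)))) \<partial>lborel)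
     = ennreal (Gamma (m + 1) * u powr m) * (indicator {0..} v * ennreal (exp (- ((1 + 1 / (2 * u)) * v))))" (is "?L = _") for v
  proof (cases "0 \<le> v")
    case v: True
    have "?L = (\<integral>\<^sup>+r. ennreal (exp (- v) * (exp (- r) * pos_power m (r * u - v / 2))) \<partial>lborel)"
    proof (intro nn_integral_cong)
      fix r :: real
      \<comment> \<open>Where the integrand does not vanish, r is positive, so the indicator can be dropped.\<close>
      have "0 < r" if "0 < r * u - v / 2"
      proof -
        have "0 < r * u" using that v by linarith
        then show ?thesis using u by (simp add: zero_less_mult_iff)
      qed
      then show "indicator {0..} r * (indicator {0..} v * ennreal (exp (- r) * (exp (- v) * pos_power m (r * u - v / 2))))
        = ennreal (exp (- v) * (exp (- r) * pos_power m (r * u - v / 2)))"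
        using v by (auto simp: indicator_def pos_power_def mult_ac)
    qed
    also have "\<dots> = (\<integral>\<^sup>+z. ennreal (exp (- v) * (exp (- (v / (2 * u) + 1 * z)) * pos_power m ((v / (2 * u) + 1 * z) * u - v / 2))) \<partial>lborel)"
      by (subst nn_integral_real_affine[where c=1 and t="v / (2 * u)"]) auto
    also have "\<dots> = (\<integral>\<^sup>+z. ennreal (u powr m * exp (- ((1 + 1 / (2 * u)) * v))) * ennreal (exp (- z) * pos_power m z) \<partial>lborel)"
    proof (intro nn_integral_cong)
      fix z :: real
      have "(v / (2 * u) + 1 * z) * u - v / 2 = u * z" using u by (simp add: field_simps)
      moreover have "exp (- v) * exp (- (v / (2 * u) + 1 * z)) = exp (- ((1 + 1 / (2 * u)) * v)) * exp (- z)"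
        by (simp add: field_simps flip: exp_add)
      ultimately have "exp (- v) * (exp (- (v / (2 * u) + 1 * z)) * pos_power m ((v / (2 * u) + 1 * z) * u - v / 2))
        = (u powr m * exp (- ((1 + 1 / (2 * u)) * v))) * (exp (- z) * pos_power m z)"
        using u by (simp add: pos_power_mult mult.assoc[symmetric])
      then show "ennreal (exp (- v) * (exp (- (v / (2 * u) + 1 * z)) * pos_power m ((v / (2 * u) + 1 * z) * u - v / 2)))
        = ennreal (u powr m * exp (- ((1 + 1 / (2 * u)) * v))) * ennreal (exp (- z) * pos_power m z)"
        by (simp add: ennreal_mult')
    qed
    also have "\<dots> = ennreal (u powr m * exp (- ((1 + 1 / (2 * u)) * v))) * ennreal (Gamma (m + 1))"
      by (subst nn_integral_cmult) (auto simp: nn_integral_pos_power_exp m)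
    finally show ?thesis using v m
      by (simp add: indicator_def mult_ac ennreal_mult')
  qed simp
  have "(\<integral>\<^sup>+r. \<integral>\<^sup>+v. indicator {0..} r * (indicator {0..} v * ennreal (exp (- r) * (exp (- v) * pos_power m (r * u - v / 2)))) \<partial>lborel \<partial>lborel)
    = (\<integral>\<^sup>+v. \<integral>\<^sup>+r. indicator {0..} r * (indicator {0..} v * ennreal (exp (- r) * (exp (- v) * pos_power m (r * u - v / 2)))) \<partial>lborel \<partial>lborel)"
    by (rule lborel_pair.Fubini') measurable
  also have "\<dots> = ennreal (Gamma (m + 1) * u powr m) * ennreal (1 / (1 + 1 / (2 * u)))"
  proof -
    have pos: "0 < 1 + 1 / (2 * u)" using u by (simp add: add_pos_pos)
    show ?thesis unfolding inner by (subst nn_integral_cmult) (simp_all only: nn_integral_exp_decay[OF pos], measurable)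
  qed
  also have "\<dots> = ennreal (Gamma (m + 1) * u powr m * (1 / (1 + 1 / (2 * u))))"
    using u by (subst ennreal_mult''[symmetric]) auto
  also have "1 / (1 + 1 / (2 * u)) = 2 * u / (1 + 2 * u)" using u by (simp add: field_simps)
  finally show ?thesis by (simp add: mult.assoc)
qed

text \<open>
  The roles of the two exponential variables are exchanged: for fixed \<open>r\<close> only \<open>v > 2 r u\<close> contributes.
\<close>

lemma negative_part_slice:
  assumes m: "0 \<le> m" and u: "0 \<le> u"
  shows "(\<integral>\<^sup>+r. \<integral>\<^sup>+v. indicator {0..} r * (indicator {0..} v * ennreal (exp (- r) * (exp (- v) * pos_power m (- (r * u - v / 2))))) \<partial>lborel \<partial>lborel)
     = ennreal (Gamma (m + 1) * ((1/2) powr m * (1 / (1 + 2 * u))))"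
proof -
  have inner: "(\<integral>\<^sup>+v. indicator {0..} r * (indicator {0..} v * ennreal (exp (- r) * (exp (- v) * pos_power m (- (r * u - v / 2))))) \<partial>lborel)
     = ennreal (Gamma (m + 1) * (1/2) powr m) * (indicator {0..} r * ennreal (exp (- ((1 + 2 * u) * r))))" (is "?L = _") for r
  proof (cases "0 \<le> r")
    case r: True
    have "?L = (\<integral>\<^sup>+v. ennreal (exp (- r) * (exp (- v) * pos_power m (- (r * u - v / 2)))) \<partial>lborel)"
    proof (intro nn_integral_cong)
      fix v :: real
      have "0 < v" if "0 < - (r * u - v / 2)"
      proof -
        have "0 \<le> r * u" using r u by simp
        then show ?thesis using that by linarith
      qed
      then show "indicator {0..} r * (indicator {0..} v * ennreal (exp (- r) * (exp (- v) * pos_power m (- (r * u - v / 2)))))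
        = ennreal (exp (- r) * (exp (- v) * pos_power m (- (r * u - v / 2))))"
        using r by (auto simp: indicator_def pos_power_def)
    qed
    also have "\<dots> = (\<integral>\<^sup>+z. ennreal (exp (- r) * (exp (- (2 * r * u + 1 * z)) * pos_power m (- (r * u - (2 * r * u + 1 * z) / 2)))) \<partial>lborel)"
      by (subst nn_integral_real_affine[where c=1 and t="2 * r * u"]) auto
    also have "\<dots> = (\<integral>\<^sup>+z. ennreal ((1/2) powr m * exp (- ((1 + 2 * u) * r))) * ennreal (exp (- z) * pos_power m z) \<partial>lborel)"
    proof (intro nn_integral_cong)
      fix z :: real
      have e1: "- (r * u - (2 * r * u + 1 * z) / 2) = 1/2 * z" by (simp add: field_simps)
      have e2: "exp (- r) * exp (- (2 * r * u + 1 * z)) = exp (- ((1 + 2 * u) * r)) * exp (- z)"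
        by (simp add: field_simps flip: exp_add)
      have e3: "pos_power m (1/2 * z) = (1/2) powr m * pos_power m z" by (rule pos_power_mult) simp
      have "exp (- r) * (exp (- (2 * r * u + 1 * z)) * pos_power m (- (r * u - (2 * r * u + 1 * z) / 2)))
        = (exp (- r) * exp (- (2 * r * u + 1 * z))) * ((1/2) powr m * pos_power m z)"
        unfolding e1 e3 by (rule mult.assoc[symmetric])
      also have "\<dots> = ((1/2) powr m * exp (- ((1 + 2 * u) * r))) * (exp (- z) * pos_power m z)"
        unfolding e2 by (simp only: mult_ac)
      finally have "exp (- r) * (exp (- (2 * r * u + 1 * z)) * pos_power m (- (r * u - (2 * r * u + 1 * z) / 2)))
        = ((1/2) powr m * exp (- ((1 + 2 * u) * r))) * (exp (- z) * pos_power m z)" .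
      then show "ennreal (exp (- r) * (exp (- (2 * r * u + 1 * z)) * pos_power m (- (r * u - (2 * r * u + 1 * z) / 2))))
        = ennreal ((1/2) powr m * exp (- ((1 + 2 * u) * r))) * ennreal (exp (- z) * pos_power m z)"
        by (simp add: ennreal_mult')
    qed
    also have "\<dots> = ennreal ((1/2) powr m * exp (- ((1 + 2 * u) * r))) * ennreal (Gamma (m + 1))"
      by (subst nn_integral_cmult) (auto simp: nn_integral_pos_power_exp m)
    finally show ?thesis using r m
      by (simp add: indicator_def mult_ac ennreal_mult')
  qed simp
  have pos: "0 < 1 + 2 * u" using u by simp
  have "(\<integral>\<^sup>+r. \<integral>\<^sup>+v. indicator {0..} r * (indicator {0..} v * ennreal (exp (- r) * (exp (- v) * pos_power m (- (r * u - v / 2))))) \<partial>lborel \<partial>lborel)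
    = ennreal (Gamma (m + 1) * (1/2) powr m) * ennreal (1 / (1 + 2 * u))"
    unfolding inner by (subst nn_integral_cmult) (simp_all only: nn_integral_exp_decay[OF pos], measurable)
  also have "\<dots> = ennreal (Gamma (m + 1) * ((1/2) powr m * (1 / (1 + 2 * u))))"
    using u by (subst ennreal_mult''[symmetric]) (auto simp: mult.assoc)
  finally show ?thesis .
qed

text \<open>
  The slice at \<open>u = 0\<close>, a null set, is left out because the substitution in \<open>positive_part_slice\<close> divides
  by \<open>u\<close>.
\<close>

lemma triple_integral_by_slices:
  fixes f K :: "real \<Rightarrow> real"
  assumes [measurable]: "f \<in> borel_measurable borel" and f: "\<And>x. 0 \<le> f x"
    and slice: "\<And>u. 0 < u \<Longrightarrow> u \<le> 1 \<Longrightarrow>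
      (\<integral>\<^sup>+r. \<integral>\<^sup>+v. indicator {0..} r * (indicator {0..} v * ennreal (exp (- r) * (exp (- v) * f (r * u - v / 2)))) \<partial>lborel \<partial>lborel) = ennreal (K u)"
    and K: "\<And>u. u \<in> {0..1} \<Longrightarrow> 0 \<le> K u" "K integrable_on {0..1}"
  shows "(\<integral>\<^sup>+r. indicator {0..} r * ennreal (exp (- r)) * (\<integral>\<^sup>+u. indicator {0..1} u * (\<integral>\<^sup>+v. indicator {0..} v * ennreal (exp (- v)) * ennreal (f (r * u - v / 2)) \<partial>lborel) \<partial>lborel) \<partial>lborel)
    = ennreal (integral {0..1} K)"
proof -
  have "(\<integral>\<^sup>+r. indicator {0..} r * ennreal (exp (- r)) * (\<integral>\<^sup>+u. indicator {0..1} u * (\<integral>\<^sup>+v. indicator {0..} v * ennreal (exp (- v)) * ennreal (f (r * u - v / 2)) \<partial>lborel) \<partial>lborel) \<partial>lborel)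
     = (\<integral>\<^sup>+r. \<integral>\<^sup>+u. indicator {0..1} u * (\<integral>\<^sup>+v. indicator {0..} r * (indicator {0..} v * ennreal (exp (- r) * (exp (- v) * f (r * u - v / 2)))) \<partial>lborel) \<partial>lborel \<partial>lborel)"
    using f by (simp add: nn_integral_cmult[symmetric] ennreal_mult mult_ac)
  also have "\<dots> = (\<integral>\<^sup>+u. \<integral>\<^sup>+r. indicator {0..1} u * (\<integral>\<^sup>+v. indicator {0..} r * (indicator {0..} v * ennreal (exp (- r) * (exp (- v) * f (r * u - v / 2)))) \<partial>lborel) \<partial>lborel \<partial>lborel)"
    by (rule lborel_pair.Fubini') measurable
  also have "\<dots> = (\<integral>\<^sup>+u. indicator {0..1} u * (\<integral>\<^sup>+r. \<integral>\<^sup>+v. indicator {0..} r * (indicator {0..} v * ennreal (exp (- r) * (exp (- v) * f (r * u - v / 2)))) \<partial>lborel \<partial>lborel) \<partial>lborel)"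
    by (intro nn_integral_cong nn_integral_cmult) measurable
  also have "\<dots> = (\<integral>\<^sup>+u. ennreal (K u) * indicator {0..1} u \<partial>lborel)"
  proof (rule nn_integral_cong_AE)
    have "AE u in lborel. u \<noteq> (0::real)" by (rule AE_lborel_singleton)
    then show "AE u in lborel. indicator {0..1} u * (\<integral>\<^sup>+r. \<integral>\<^sup>+v. indicator {0..} r * (indicator {0..} v * ennreal (exp (- r) * (exp (- v) * f (r * u - v / 2)))) \<partial>lborel \<partial>lborel)
       = ennreal (K u) * indicator {0..1} u"
    proof eventually_elim
      case (elim u)
      then show ?case using slice[of u] by (cases "u \<in> {0..1}") auto
    qed
  qed
  also have "\<dots> = ennreal (integral {0..1} K)"
    by (rule nn_integral_has_integral_lebesgue'[OF K(1) integrable_integral[OF K(2)]])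
  finally show ?thesis .
qed

section \<open>Integration over the killing rate\<close>

definition gauss_moment :: "real \<Rightarrow> ennreal" where
  "gauss_moment m = (\<integral>\<^sup>+r. ennreal (pos_power (m + 1) r * exp (- (r\<^sup>2 / 2))) \<partial>lborel)"

text \<open>
  \<open>- r\<^sup>2 / 2 \<le> 1 / 2 - r\<close> compares the integrand with that of a Gamma integral.
\<close>

lemma gauss_moment_finite:
  assumes "0 \<le> m"
  shows "gauss_moment m < \<infinity>"
proof -
  have "gauss_moment m \<le> (\<integral>\<^sup>+r. ennreal (exp (1/2)) * ennreal (exp (- r) * pos_power (m + 1) r) \<partial>lborel)"
    unfolding gauss_moment_def
  proof (intro nn_integral_mono)
    fix r :: real
    have "- (r\<^sup>2 / 2) \<le> 1/2 + - r"
      using sum_power2_ge_zero[of "r - 1" 0] by (simp add: power2_eq_square algebra_simps)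
    then have "exp (- (r\<^sup>2 / 2)) \<le> exp (1/2) * exp (- r)" by (simp flip: exp_add)
    then have "pos_power (m + 1) r * exp (- (r\<^sup>2 / 2)) \<le> exp (1/2) * (exp (- r) * pos_power (m + 1) r)"
      using mult_left_mono[of "exp (- (r\<^sup>2 / 2))" "exp (1/2) * exp (- r)" "pos_power (m + 1) r"] by (simp add: mult_ac)
    then show "ennreal (pos_power (m + 1) r * exp (- (r\<^sup>2 / 2))) \<le> ennreal (exp (1/2)) * ennreal (exp (- r) * pos_power (m + 1) r)"
      by (simp add: ennreal_leI flip: ennreal_mult')
  qed
  also have "\<dots> = ennreal (exp (1/2)) * ennreal (Gamma (m + 1 + 1))"
    using assms by (subst nn_integral_cmult) (auto simp: nn_integral_pos_power_exp)
  also have "\<dots> < \<infinity>" by (simp flip: ennreal_mult')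
  finally show ?thesis .
qed

lemma gauss_mellin:
  assumes t: "0 < t"
  shows "(\<integral>\<^sup>+\<theta>. ennreal (pos_power (m + 1) \<theta> * exp (- (\<theta>\<^sup>2 / 2 * t))) \<partial>lborel)
    = ennreal (t powr (- (1 + m / 2))) * gauss_moment m"
proof -
  let ?c = "1 / sqrt t"
  have c: "0 < ?c" using t by simp
  have "(\<integral>\<^sup>+\<theta>. ennreal (pos_power (m + 1) \<theta> * exp (- (\<theta>\<^sup>2 / 2 * t))) \<partial>lborel)
     = ennreal \<bar>?c\<bar> * (\<integral>\<^sup>+r. ennreal (pos_power (m + 1) (0 + ?c * r) * exp (- ((0 + ?c * r)\<^sup>2 / 2 * t))) \<partial>lborel)"
    by (rule nn_integral_real_affine[where c="?c" and t=0 and f="\<lambda>\<theta>. ennreal (pos_power (m + 1) \<theta> * exp (- (\<theta>\<^sup>2 / 2 * t)))"])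
       (use t in auto)
  also have "(\<integral>\<^sup>+r. ennreal (pos_power (m + 1) (0 + ?c * r) * exp (- ((0 + ?c * r)\<^sup>2 / 2 * t))) \<partial>lborel)
     = (\<integral>\<^sup>+r. ennreal (?c powr (m + 1)) * ennreal (pos_power (m + 1) r * exp (- (r\<^sup>2 / 2))) \<partial>lborel)"
  proof (intro nn_integral_cong)
    fix r :: real
    have "(0 + ?c * r)\<^sup>2 / 2 * t = r\<^sup>2 / 2" using t by (simp add: power_mult_distrib power_divide)
    moreover have "pos_power (m + 1) (0 + ?c * r) = ?c powr (m + 1) * pos_power (m + 1) r"
      using pos_power_mult[OF c] by simp
    ultimately show "ennreal (pos_power (m + 1) (0 + ?c * r) * exp (- ((0 + ?c * r)\<^sup>2 / 2 * t)))
      = ennreal (?c powr (m + 1)) * ennreal (pos_power (m + 1) r * exp (- (r\<^sup>2 / 2)))"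
      by (simp only: mult.assoc ennreal_mult' powr_ge_zero)
  qed
  also have "\<dots> = ennreal (?c powr (m + 1)) * gauss_moment m"
    unfolding gauss_moment_def by (rule nn_integral_cmult) measurable
  also have "ennreal \<bar>?c\<bar> * (ennreal (?c powr (m + 1)) * gauss_moment m) = ennreal (?c powr 1 * ?c powr (m + 1)) * gauss_moment m"
  proof -
    have e: "\<bar>?c\<bar> = ?c powr 1" using c by simp
    show ?thesis unfolding e by (simp only: ennreal_mult' powr_ge_zero mult.assoc)
  qed
  also have "?c powr 1 * ?c powr (m + 1) = t powr (- (1 + m / 2))"
  proof -
    have "?c = t powr (- (1/2))"
      unfolding powr_minus using powr_half_sqrt[of t] t by (simp add: inverse_eq_divide)
    then have "?c powr 1 * ?c powr (m + 1) = t powr (- (1/2) * 1) * t powr (- (1/2) * (m + 1))"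
      by (simp only: powr_powr)
    also have "\<dots> = t powr (- (1/2) * 1 + - (1/2) * (m + 1))" by (rule powr_add[symmetric])
    also have "- (1/2) * 1 + - (1/2) * (m + 1) = - (1 + m / 2)" by (simp add: field_simps)
    finally show ?thesis .
  qed
  finally show ?thesis .
qed

context standard_brownian_motion
begin

definition occupation :: "(real \<Rightarrow> real) \<Rightarrow> real \<Rightarrow> 'w \<Rightarrow> ennreal" where
  "occupation f a \<omega> = (\<integral>\<^sup>+s. indicator {0..hitting_time B a \<omega>} s * ennreal (f (B (max 0 s) \<omega>)) \<partial>lborel)"

lemma measurable_occupation [measurable]:
  assumes [measurable]: "f \<in> borel_measurable borel"
  shows "occupation f a \<in> borel_measurable M"
proof -
  note [measurable] = measurable_hitting_time[of a] measurable_B_joint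
  have "(\<lambda>p. indicator {0..hitting_time B a (fst p)} (snd p) * ennreal (f (B (max 0 (snd p)) (fst p)))) \<in> borel_measurable (M \<Otimes>\<^sub>M lborel)"
    by measurable
  then show ?thesis unfolding occupation_def[abs_def]
    by (intro lborel.borel_measurable_nn_integral) (simp add: case_prod_beta)
qed

text \<open>
  The power \<open>T powr (- (1 + m / 2))\<close> is written as an integral over \<open>\<theta>\<close> and the expectation is taken
  first.  In the result \<open>\<theta> powr m\<close> is absorbed into the homogeneous \<open>f\<close>, which removes \<open>\<theta>\<close> from
  \<open>v / (2 \<theta>)\<close>, and \<open>r = a \<theta>\<close> then removes \<open>a\<close>: this is Brownian scaling.
\<close>

proposition scaled_occupation_moment:
  fixes f :: "real \<Rightarrow> real" and a m :: real
  assumes a: "0 < a" and f [measurable]: "f \<in> borel_measurable borel"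
    and hom: "\<And>c x. 0 < c \<Longrightarrow> f (c * x) = c powr m * f x"
  defines "T \<equiv> hitting_time B a"
  shows "gauss_moment m * (\<integral>\<^sup>+\<omega>. ennreal (T \<omega> powr (- (1 + m / 2))) * occupation f a \<omega> \<partial>M)
    = (\<integral>\<^sup>+r. indicator {0..} r * ennreal (exp (- r)) *
        (\<integral>\<^sup>+u. indicator {0..1} u * (\<integral>\<^sup>+v. indicator {0..} v * ennreal (exp (- v)) * ennreal (f (r * u - v / 2)) \<partial>lborel) \<partial>lborel) \<partial>lborel)"
proof -
  interpret P: pair_sigma_finite M "lborel :: real measure" ..
  have [measurable]: "T \<in> borel_measurable M" unfolding T_def by (rule measurable_hitting_time)
  define \<Phi> where "\<Phi> r = indicator {0..} r * ennreal (exp (- r)) *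
        (\<integral>\<^sup>+u. indicator {0..1} u * (\<integral>\<^sup>+v. indicator {0..} v * ennreal (exp (- v)) * ennreal (f (r * u - v / 2)) \<partial>lborel) \<partial>lborel)" for r :: real
  have \<Phi>_meas [measurable]: "\<Phi> \<in> borel_measurable borel" unfolding \<Phi>_def[abs_def] by measurable
  have "gauss_moment m * (\<integral>\<^sup>+\<omega>. ennreal (T \<omega> powr (- (1 + m / 2))) * occupation f a \<omega> \<partial>M)
     = (\<integral>\<^sup>+\<omega>. gauss_moment m * (ennreal (T \<omega> powr (- (1 + m / 2))) * occupation f a \<omega>) \<partial>M)"
    by (rule nn_integral_cmult[symmetric]) measurable
  also have "\<dots> = (\<integral>\<^sup>+\<omega>. \<integral>\<^sup>+\<theta>. ennreal (pos_power (m + 1) \<theta> * exp (- (\<theta>\<^sup>2 / 2 * T \<omega>))) * occupation f a \<omega> \<partial>lborel \<partial>M)"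
  proof (rule nn_integral_cong_AE, use AE_paths_hit[OF a] in eventually_elim)
    case (elim \<omega>)
    then have T_pos: "0 < T \<omega>" by (simp add: T_def)
    have split: "(\<integral>\<^sup>+\<theta>. ennreal (pos_power (m + 1) \<theta> * exp (- (\<theta>\<^sup>2 / 2 * T \<omega>))) * occupation f a \<omega> \<partial>lborel)
      = (\<integral>\<^sup>+\<theta>. ennreal (pos_power (m + 1) \<theta> * exp (- (\<theta>\<^sup>2 / 2 * T \<omega>))) \<partial>lborel) * occupation f a \<omega>"
      by (rule nn_integral_multc) measurable
    show ?case unfolding split gauss_mellin[OF T_pos] by (simp only: mult_ac)
  qed
  also have "\<dots> = (\<integral>\<^sup>+\<theta>. \<integral>\<^sup>+\<omega>. ennreal (pos_power (m + 1) \<theta> * exp (- (\<theta>\<^sup>2 / 2 * T \<omega>))) * occupation f a \<omega> \<partial>M \<partial>lborel)"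
    by (rule P.Fubini'[symmetric]) measurable
  also have "\<dots> = (\<integral>\<^sup>+\<theta>. ennreal a * \<Phi> (0 + a * \<theta>) \<partial>lborel)"
  proof (rule nn_integral_cong_AE)
    have "AE \<theta> in lborel. \<theta> \<noteq> (0::real)" by (rule AE_lborel_singleton)
    then show "AE \<theta> in lborel. (\<integral>\<^sup>+\<omega>. ennreal (pos_power (m + 1) \<theta> * exp (- (\<theta>\<^sup>2 / 2 * T \<omega>))) * occupation f a \<omega> \<partial>M) = ennreal a * \<Phi> (0 + a * \<theta>)"
    proof eventually_elim
      case (elim \<theta>)
      show ?case
      proof (cases "0 < \<theta>")
        case False
        then have "a * \<theta> < 0" using elim a by (simp add: mult_pos_neg)
        then show ?thesis using False by (simp add: pos_power_def \<Phi>_def)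
      next
        case \<theta>: True
        have "(\<integral>\<^sup>+\<omega>. ennreal (pos_power (m + 1) \<theta> * exp (- (\<theta>\<^sup>2 / 2 * T \<omega>))) * occupation f a \<omega> \<partial>M)
          = (\<integral>\<^sup>+\<omega>. ennreal (\<theta> powr (m + 1)) * (\<integral>\<^sup>+s. ennreal (exp (- (\<theta>\<^sup>2 / 2 * T \<omega>)) * indicat_real {0..T \<omega>} s) * ennreal (f (B (max 0 s) \<omega>)) \<partial>lborel) \<partial>M)"
        proof (intro nn_integral_cong)
          fix \<omega> assume \<omega>: "\<omega> \<in> space M"
          have "continuous_on UNIV (\<lambda>s. B (max 0 s) \<omega>)"
            by (intro continuous_on_compose2[OF continuous_paths[OF \<omega>]] continuous_intros) auto
          then have [measurable]: "(\<lambda>s. B (max 0 s) \<omega>) \<in> borel_measurable borel" by (rule borel_measurable_continuous_onI)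
          have "ennreal (exp (- (\<theta>\<^sup>2 / 2 * T \<omega>))) * occupation f a \<omega>
            = (\<integral>\<^sup>+s. ennreal (exp (- (\<theta>\<^sup>2 / 2 * T \<omega>))) * (indicator {0..T \<omega>} s * ennreal (f (B (max 0 s) \<omega>))) \<partial>lborel)"
            unfolding occupation_def T_def[symmetric] by (rule nn_integral_cmult[symmetric]) measurable
          also have "\<dots> = (\<integral>\<^sup>+s. ennreal (exp (- (\<theta>\<^sup>2 / 2 * T \<omega>)) * indicat_real {0..T \<omega>} s) * ennreal (f (B (max 0 s) \<omega>)) \<partial>lborel)"
            by (intro nn_integral_cong) (auto simp: indicator_def)
          finally show "ennreal (pos_power (m + 1) \<theta> * exp (- (\<theta>\<^sup>2 / 2 * T \<omega>))) * occupation f a \<omega>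
            = ennreal (\<theta> powr (m + 1)) * (\<integral>\<^sup>+s. ennreal (exp (- (\<theta>\<^sup>2 / 2 * T \<omega>)) * indicat_real {0..T \<omega>} s) * ennreal (f (B (max 0 s) \<omega>)) \<partial>lborel)"
            using \<theta> by (simp add: pos_power_def ennreal_mult' mult.assoc)
        qed
        also have "\<dots> = ennreal (\<theta> powr (m + 1)) * (\<integral>\<^sup>+\<omega>. \<integral>\<^sup>+s. ennreal (exp (- (\<theta>\<^sup>2 / 2 * T \<omega>)) * indicat_real {0..T \<omega>} s) * ennreal (f (B (max 0 s) \<omega>)) \<partial>lborel \<partial>M)"
        proof (rule nn_integral_cmult)
          note [measurable] = measurable_B_joint
          have "(\<lambda>p. ennreal (exp (- (\<theta>\<^sup>2 / 2 * T (fst p))) * indicat_real {0..T (fst p)} (snd p)) * ennreal (f (B (max 0 (snd p)) (fst p)))) \<in> borel_measurable (M \<Otimes>\<^sub>M lborel)"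
            by measurable
          then show "(\<lambda>\<omega>. \<integral>\<^sup>+s. ennreal (exp (- (\<theta>\<^sup>2 / 2 * T \<omega>)) * indicat_real {0..T \<omega>} s) * ennreal (f (B (max 0 s) \<omega>)) \<partial>lborel) \<in> borel_measurable M"
            by (intro lborel.borel_measurable_nn_integral) (simp add: case_prod_beta)
        qed
        also have "\<dots> = ennreal (\<theta> powr (m + 1)) * (ennreal (exp (- \<theta> * a) * (a / \<theta>)) *
           (\<integral>\<^sup>+u. indicator {0..1} u * (\<integral>\<^sup>+v. indicator {0..} v * ennreal (exp (- v)) * ennreal (f (a * u - v / (2 * \<theta>))) \<partial>lborel) \<partial>lborel))"
          unfolding T_def by (subst occupation_identity[OF \<theta> a]) (simp_all add: nn_integral_occupation_law)
        also have "\<dots> = ennreal a * (ennreal (exp (- (a * \<theta>))) * (ennreal (\<theta> powr m) *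
           (\<integral>\<^sup>+u. indicator {0..1} u * (\<integral>\<^sup>+v. indicator {0..} v * ennreal (exp (- v)) * ennreal (f (a * u - v / (2 * \<theta>))) \<partial>lborel) \<partial>lborel)))"
        proof -
          have "\<theta> powr (m + 1) * (exp (- \<theta> * a) * (a / \<theta>)) = a * (exp (- (a * \<theta>)) * \<theta> powr m)"
            using \<theta> by (simp add: powr_add mult_ac)
          then have "ennreal (\<theta> powr (m + 1)) * ennreal (exp (- \<theta> * a) * (a / \<theta>)) = ennreal a * (ennreal (exp (- (a * \<theta>))) * ennreal (\<theta> powr m))"
            using a by (simp add: ennreal_mult'[symmetric] del: mult_minus_left)
          then show ?thesis by (simp only: mult.assoc[symmetric])
        qed
        also have "ennreal (\<theta> powr m) *
           (\<integral>\<^sup>+u. indicator {0..1} u * (\<integral>\<^sup>+v. indicator {0..} v * ennreal (exp (- v)) * ennreal (f (a * u - v / (2 * \<theta>))) \<partial>lborel) \<partial>lborel)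
          = (\<integral>\<^sup>+u. indicator {0..1} u * (\<integral>\<^sup>+v. indicator {0..} v * ennreal (exp (- v)) * ennreal (f (a * \<theta> * u - v / 2)) \<partial>lborel) \<partial>lborel)"
        proof -
          have "f (a * \<theta> * u - v / 2) = \<theta> powr m * f (a * u - v / (2 * \<theta>))" for u v
          proof -
            have "a * \<theta> * u - v / 2 = \<theta> * (a * u - v / (2 * \<theta>))" using \<theta> by (simp add: field_simps)
            then show ?thesis using hom[OF \<theta>] by simp
          qed
          then have "ennreal (f (a * \<theta> * u - v / 2)) = ennreal (\<theta> powr m) * ennreal (f (a * u - v / (2 * \<theta>)))" for u v
            by (simp add: ennreal_mult')
          then show ?thesis by (simp add: nn_integral_cmult[symmetric] mult_ac)
        qed
        finally show ?thesis using \<theta> a by (simp add: \<Phi>_def mult_ac)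
      qed
    qed
  qed
  also have "\<dots> = ennreal \<bar>a\<bar> * (\<integral>\<^sup>+\<theta>. \<Phi> (0 + a * \<theta>) \<partial>lborel)"
    using a by (subst nn_integral_cmult) auto
  also have "\<dots> = (\<integral>\<^sup>+r. \<Phi> r \<partial>lborel)"
    by (rule nn_integral_real_affine[where c=a and t=0 and f=\<Phi>, symmetric]) (use a in auto)
  finally show ?thesis unfolding \<Phi>_def .
qed

end

section \<open>The sign of the balance integral\<close>

text \<open>
  The sign of this integral is the sign of the expectation.
\<close>

definition balance :: "real \<Rightarrow> real" where
  "balance m = integral {0..1} (\<lambda>u. ((2 * u) powr (m + 1) - 1) / (1 + 2 * u))"

text \<open>
  Convexity of \<open>exp\<close> between \<open>0\<close> and \<open>ln y\<close>.
\<close>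

lemma powr_le_tangent:
  fixes y m :: real
  assumes "0 < y" "0 \<le> m" "m \<le> 1"
  shows "y powr m \<le> 1 + m * (y - 1)"
proof -
  have "exp ((1 - m) *\<^sub>R 0 + m *\<^sub>R ln y) \<le> (1 - m) * exp 0 + m * exp (ln y)"
    using assms by (intro convex_onD[OF exp_convex]) auto
  then show ?thesis using assms by (simp add: powr_def algebra_simps)
qed

text \<open>
  \<open>powr_le_tangent\<close> for \<open>y powr m\<close> and the exponent \<open>1 / m\<close>.
\<close>

lemma powr_ge_tangent:
  fixes y m :: real
  assumes "0 < y" "1 \<le> m"
  shows "1 + m * (y - 1) \<le> y powr m"
proof -
  have "(y powr m) powr (1 / m) \<le> 1 + 1 / m * (y powr m - 1)"
    using assms by (intro powr_le_tangent) auto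
  then show ?thesis using assms by (simp add: powr_powr field_simps)
qed

lemma balance_integrand_continuous:
  assumes "0 \<le> m"
  shows "continuous_on {0..1} (\<lambda>u. ((2 * u) powr (m + 1) - 1) / (1 + 2 * u) :: real)"
  using assms by (intro continuous_on_divide continuous_on_diff continuous_on_powr' continuous_intros) auto

text \<open>
  With \<open>y = 2 u\<close> the numerator is \<open>(1 - m) (y - 1) + m (y\<^sup>2 - 1)\<close>, so the integrand equals
  \<open>(1 - m) (1 - 2 / (1 + 2 u)) + m (2 u - 1)\<close>.
\<close>

lemma tangent_integral:
  "((\<lambda>u. (2 * u * (1 + m * (2 * u - 1)) - 1) / (1 + 2 * u)) has_integral (1 - m) * (1 - ln 3)) {0..(1::real)}"
proof -
  have "((\<lambda>u. (2 * u * (1 + m * (2 * u - 1)) - 1) / (1 + 2 * u)) has_integral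
      ((1 - m) * (1 - ln (1 + 2 * 1)) + m * (1\<^sup>2 - 1)) - ((1 - m) * (0 - ln (1 + 2 * 0)) + m * (0\<^sup>2 - 0))) {0..(1::real)}"
  proof (rule fundamental_theorem_of_calculus)
    fix u :: real assume u: "u \<in> {0..1}"
    have "((\<lambda>u. (1 - m) * (u - ln (1 + 2 * u)) + m * (u\<^sup>2 - u)) has_real_derivative
        (1 - m) * (1 - 2 / (1 + 2 * u)) + m * (2 * u - 1)) (at u within {0..1})"
      using u by (auto intro!: derivative_eq_intros simp: divide_inverse)
    also have "(1 - m) * (1 - 2 / (1 + 2 * u)) + m * (2 * u - 1) = (2 * u * (1 + m * (2 * u - 1)) - 1) / (1 + 2 * u)"
      using u by (simp add: field_simps)
    finally show "((\<lambda>u. (1 - m) * (u - ln (1 + 2 * u)) + m * (u\<^sup>2 - u)) has_vector_derivative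
        (2 * u * (1 + m * (2 * u - 1)) - 1) / (1 + 2 * u)) (at u within {0..1})"
      by (simp add: has_real_derivative_iff_has_vector_derivative)
  qed simp
  then show ?thesis by simp
qed

lemma one_less_ln_3: "1 < ln (3::real)"
proof -
  have "exp 1 < (3::real)" using e_less_272 by simp
  then show ?thesis using ln_less_cancel_iff[of "exp 1" 3] by simp
qed

lemma balance_sign:
  assumes m: "0 \<le> m"
  shows "m < 1 \<Longrightarrow> balance m < 0" "m = 1 \<Longrightarrow> balance m = 0" "1 < m \<Longrightarrow> 0 < balance m"
proof -
  have int: "(\<lambda>u. ((2 * u) powr (m + 1) - 1) / (1 + 2 * u)) integrable_on {0..1}"
    by (rule integrable_continuous_real[OF balance_integrand_continuous[OF m]])
  have tangent: "integral {0..1} (\<lambda>u. (2 * u * (1 + m * (2 * u - 1)) - 1) / (1 + 2 * u)) = (1 - m) * (1 - ln 3)"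
    "(\<lambda>u. (2 * u * (1 + m * (2 * u - 1)) - 1) / (1 + 2 * u)) integrable_on {0..(1::real)}"
    using tangent_integral[of m] by (auto simp: has_integral_iff)
  have le: "balance m \<le> (1 - m) * (1 - ln 3)" if "m \<le> 1"
    unfolding balance_def tangent(1)[symmetric]
  proof (rule integral_le[OF int tangent(2)])
    fix u :: real assume u: "u \<in> {0..1}"
    have "(2 * u) powr (m + 1) \<le> 2 * u * (1 + m * (2 * u - 1))"
    proof (cases "u = 0")
      case False
      then have "2 * u * (2 * u) powr m \<le> 2 * u * (1 + m * (2 * u - 1))"
        using u that m by (intro mult_left_mono powr_le_tangent) auto
      then show ?thesis using u by (simp add: powr_add mult_ac)
    qed simp
    then show "((2 * u) powr (m + 1) - 1) / (1 + 2 * u) \<le> (2 * u * (1 + m * (2 * u - 1)) - 1) / (1 + 2 * u)"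
      using u by (intro divide_right_mono) auto
  qed
  have ge: "(1 - m) * (1 - ln 3) \<le> balance m" if "1 \<le> m"
    unfolding balance_def tangent(1)[symmetric]
  proof (rule integral_le[OF tangent(2) int])
    fix u :: real assume u: "u \<in> {0..1}"
    have "2 * u * (1 + m * (2 * u - 1)) \<le> (2 * u) powr (m + 1)"
    proof (cases "u = 0")
      case False
      then have "2 * u * (1 + m * (2 * u - 1)) \<le> 2 * u * (2 * u) powr m"
        using u that m by (intro mult_left_mono powr_ge_tangent) auto
      then show ?thesis using u by (simp add: powr_add mult_ac)
    qed simp
    then show "(2 * u * (1 + m * (2 * u - 1)) - 1) / (1 + 2 * u) \<le> ((2 * u) powr (m + 1) - 1) / (1 + 2 * u)"
      using u by (intro divide_right_mono) auto
  qed
  show "balance m < 0" if "m < 1"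
    using le that mult_pos_neg[of "1 - m" "1 - ln 3"] one_less_ln_3 by simp
  show "balance m = 0" if "m = 1" using le ge that by simp
  show "0 < balance m" if "1 < m"
    using ge that mult_neg_neg[of "1 - m" "1 - ln 3"] one_less_ln_3 by simp
qed

section \<open>The expectation of the signed power average\<close>

text \<open>
  This and \<open>lower_weight m\<close> are the products of \<open>gauss_moment m\<close> with the expectations of the positive and
  of the negative part of the average.
\<close>

definition upper_weight :: "real \<Rightarrow> real" where
  "upper_weight m = Gamma (m + 1) * (1/2) powr m * integral {0..1} (\<lambda>u. (2 * u) powr (m + 1) / (1 + 2 * u))"

definition lower_weight :: "real \<Rightarrow> real" where
  "lower_weight m = Gamma (m + 1) * (1/2) powr m * integral {0..1} (\<lambda>u. 1 / (1 + 2 * u))"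

lemma weight_integrable:
  assumes "0 \<le> m"
  shows "(\<lambda>u. (2 * u) powr (m + 1) / (1 + 2 * u)) integrable_on {0..(1::real)}"
    and "(\<lambda>u. 1 / (1 + 2 * u)) integrable_on {0..(1::real)}"
  by (intro integrable_continuous_real continuous_on_divide continuous_on_powr' continuous_intros; use assms in auto)+

lemma upper_minus_lower_weight:
  assumes "0 \<le> m"
  shows "upper_weight m - lower_weight m = Gamma (m + 1) * (1/2) powr m * balance m"
  using Henstock_Kurzweil_Integration.integral_diff[OF weight_integrable[OF assms]]
  by (simp add: upper_weight_def lower_weight_def balance_def diff_divide_distrib right_diff_distrib)

lemma weights_nonneg:
  assumes "0 \<le> m"
  shows "0 \<le> upper_weight m" "0 < lower_weight m"
proof -
  have G: "0 < Gamma (m + 1)" using assms by (intro Gamma_real_pos) simp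
  have "0 \<le> integral {0..1} (\<lambda>u. (2 * u) powr (m + 1) / (1 + 2 * u))"
    by (rule integral_nonneg[OF weight_integrable(1)[OF assms]]) simp
  then show "0 \<le> upper_weight m" using G by (simp add: upper_weight_def)
  have "integral {0..1} (\<lambda>_::real. 1 / 3 :: real) \<le> integral {0..1} (\<lambda>u. 1 / (1 + 2 * u))"
    by (rule integral_le[OF _ weight_integrable(2)[OF assms]]) (auto intro!: divide_left_mono)
  then have "0 < integral {0..1} (\<lambda>u::real. 1 / (1 + 2 * u))" by simp
  then show "0 < lower_weight m" using G by (simp add: lower_weight_def)
qed

context standard_brownian_motion
begin

lemma positive_part_moment:
  assumes a: "0 < a" and m: "0 \<le> m"
  shows "gauss_moment m * (\<integral>\<^sup>+\<omega>. ennreal (hitting_time B a \<omega> powr (- (1 + m / 2))) * occupation (pos_power m) a \<omega> \<partial>M)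
    = ennreal (upper_weight m)"
proof -
  let ?K = "\<lambda>u. Gamma (m + 1) * (1/2) powr m * ((2 * u) powr (m + 1) / (1 + 2 * u))"
  have K: "Gamma (m + 1) * (u powr m * (2 * u / (1 + 2 * u))) = ?K u" if "0 < u" for u
  proof -
    have "(1/2) powr m * (2 * u) powr m = (1/2 * (2 * u)) powr m" by (rule powr_mult[symmetric])
    then have "(1/2) powr m * (2 * u) powr (m + 1) = u powr m * (2 * u)"
      using that by (simp add: powr_add mult.assoc[symmetric])
    then show ?thesis by (simp add: mult.assoc)
  qed
  have "gauss_moment m * (\<integral>\<^sup>+\<omega>. ennreal (hitting_time B a \<omega> powr (- (1 + m / 2))) * occupation (pos_power m) a \<omega> \<partial>M)
    = ennreal (integral {0..1} ?K)"
  proof (subst scaled_occupation_moment[OF a])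
    show "(\<integral>\<^sup>+r. indicator {0..} r * ennreal (exp (- r)) * (\<integral>\<^sup>+u. indicator {0..1} u * (\<integral>\<^sup>+v. indicator {0..} v * ennreal (exp (- v)) * ennreal (pos_power m (r * u - v / 2)) \<partial>lborel) \<partial>lborel) \<partial>lborel)
      = ennreal (integral {0..1} ?K)"
    proof (rule triple_integral_by_slices)
      show "?K integrable_on {0..1}" by (rule integrable_on_mult_right[OF weight_integrable(1)[OF m]])
      show "0 \<le> ?K u" if "u \<in> {0..1}" for u
        using that m Gamma_real_pos[of "m + 1"] by simp
    qed (simp_all only: positive_part_slice[OF m] K pos_power_nonneg measurable_pos_power)
  qed (simp_all add: pos_power_mult)
  then show ?thesis unfolding upper_weight_def by (simp only: Henstock_Kurzweil_Integration.integral_mult_right)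
qed

lemma negative_part_moment:
  assumes a: "0 < a" and m: "0 \<le> m"
  shows "gauss_moment m * (\<integral>\<^sup>+\<omega>. ennreal (hitting_time B a \<omega> powr (- (1 + m / 2))) * occupation (\<lambda>x. pos_power m (- x)) a \<omega> \<partial>M)
    = ennreal (lower_weight m)"
proof -
  let ?K = "\<lambda>u. Gamma (m + 1) * (1/2) powr m * (1 / (1 + 2 * u))"
  have K: "Gamma (m + 1) * ((1/2) powr m * (1 / (1 + 2 * u))) = ?K u" for u :: real
    by (rule mult.assoc[symmetric])
  have hom: "pos_power m (- (c * x)) = c powr m * pos_power m (- x)" if "0 < c" for c x
    using pos_power_mult[OF that, of m "- x"] by simp
  have "gauss_moment m * (\<integral>\<^sup>+\<omega>. ennreal (hitting_time B a \<omega> powr (- (1 + m / 2))) * occupation (\<lambda>x. pos_power m (- x)) a \<omega> \<partial>M)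
    = ennreal (integral {0..1} ?K)"
  proof (subst scaled_occupation_moment[OF a])
    show "(\<integral>\<^sup>+r. indicator {0..} r * ennreal (exp (- r)) * (\<integral>\<^sup>+u. indicator {0..1} u * (\<integral>\<^sup>+v. indicator {0..} v * ennreal (exp (- v)) * ennreal (pos_power m (- (r * u - v / 2))) \<partial>lborel) \<partial>lborel) \<partial>lborel)
      = ennreal (integral {0..1} ?K)"
    proof (rule triple_integral_by_slices)
      show "(\<lambda>x. pos_power m (- x)) \<in> borel_measurable borel" by measurable
      show "?K integrable_on {0..1}" by (rule integrable_on_mult_right[OF weight_integrable(2)[OF m]])
      show "0 \<le> ?K u" if "u \<in> {0..1}" for u
        using that m Gamma_real_pos[of "m + 1"] by simp
    qed (simp_all only: negative_part_slice[OF m less_imp_le] K pos_power_nonneg)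
  qed (simp_all add: hom)
  then show ?thesis unfolding lower_weight_def by (simp only: Henstock_Kurzweil_Integration.integral_mult_right)
qed

lemma measurable_signed_power_average:
  "signed_power_average B a m \<in> borel_measurable M"
proof -
  note [measurable] = measurable_hitting_time[of a] measurable_B_joint
  have "(\<lambda>p. indicat_real {0..hitting_time B a (fst p)} (snd p) *\<^sub>R
       (\<bar>B (max 0 (snd p)) (fst p)\<bar> powr m * sgn (B (max 0 (snd p)) (fst p)))) \<in> borel_measurable (M \<Otimes>\<^sub>M lborel)"
    by measurable
  then have meas: "(\<lambda>\<omega>. LINT s|lborel. indicat_real {0..hitting_time B a \<omega>} s *\<^sub>R
       (\<bar>B (max 0 s) \<omega>\<bar> powr m * sgn (B (max 0 s) \<omega>))) \<in> borel_measurable M"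
    by (intro lborel.borel_measurable_lebesgue_integral) (simp add: case_prod_beta)
  have eq: "(LINT s:{0..hitting_time B a \<omega>}|lborel. \<bar>B s \<omega>\<bar> powr m * sgn (B s \<omega>))
     = (LINT s|lborel. indicat_real {0..hitting_time B a \<omega>} s *\<^sub>R (\<bar>B (max 0 s) \<omega>\<bar> powr m * sgn (B (max 0 s) \<omega>)))" for \<omega>
    unfolding set_lebesgue_integral_def
    by (intro Bochner_Integration.integral_cong) (auto simp: indicator_def)
  show ?thesis unfolding signed_power_average_def[abs_def] eq using meas by measurable
qed

text \<open>
  On almost every path \<open>{0..T}\<close> is a compact interval on which the path is bounded, so both parts of the
  integrand are integrable and the extended nonnegative integrals are finite.
\<close>

lemma signed_power_average_decomposition:
  assumes a: "0 < a" and m: "0 \<le> m"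
  defines "T \<equiv> hitting_time B a"
  shows "AE \<omega> in M. signed_power_average B a m \<omega> =
      enn2real (ennreal (T \<omega> powr (- (1 + m / 2))) * occupation (pos_power m) a \<omega>)
    - enn2real (ennreal (T \<omega> powr (- (1 + m / 2))) * occupation (\<lambda>x. pos_power m (- x)) a \<omega>)"
  using AE_paths_hit[OF a]
proof eventually_elim
  case (elim \<omega>)
  define y where "y s = B (max 0 s) \<omega>" for s
  have y_cont: "continuous_on UNIV y"
    unfolding y_def using elim by (intro continuous_on_compose2[OF continuous_paths] continuous_intros) auto
  then have [measurable]: "y \<in> borel_measurable borel" by (rule borel_measurable_continuous_onI)
  have "compact (y ` {0..T \<omega>})"
    by (intro compact_continuous_image continuous_on_subset[OF y_cont]) auto
  then obtain R where "\<forall>s\<in>{0..T \<omega>}. \<bar>y s\<bar> \<le> R"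
    by (auto dest!: compact_imp_bounded simp: bounded_iff)
  then have R: "\<bar>y s\<bar> \<le> R" if "s \<in> {0..T \<omega>}" for s
    using that by blast
  define up where "up s = indicat_real {0..T \<omega>} s * pos_power m (y s)" for s
  define low where "low s = indicat_real {0..T \<omega>} s * pos_power m (- y s)" for s
  have pos_power_le: "pos_power m x \<le> R powr m" if "\<bar>x\<bar> \<le> R" for x
    using that m by (auto simp: pos_power_def intro!: powr_mono2)
  have window: "integrable lborel (\<lambda>s. R powr m * indicat_real {0..T \<omega>} s)"
    by (intro integrable_mult_right integrable_real_indicator) (auto simp: emeasure_lborel_Icc_eq)
  have [measurable]: "up \<in> borel_measurable lborel" "low \<in> borel_measurable lborel"
    unfolding up_def[abs_def] low_def[abs_def] by measurable
  have up_int: "integrable lborel up"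
    by (rule Bochner_Integration.integrable_bound[OF window]) (auto simp: up_def indicator_def intro!: pos_power_le R)
  have low_int: "integrable lborel low"
    by (rule Bochner_Integration.integrable_bound[OF window]) (use R in \<open>auto simp: low_def indicator_def intro!: pos_power_le\<close>)
  have occ: "enn2real (occupation (pos_power m) a \<omega>) = (LINT s|lborel. up s)"
    "enn2real (occupation (\<lambda>x. pos_power m (- x)) a \<omega>) = (LINT s|lborel. low s)"
    unfolding occupation_def T_def[symmetric] y_def[symmetric]
    by (subst integral_eq_nn_integral, simp, simp add: up_def low_def,
        auto intro!: arg_cong[where f=enn2real] nn_integral_cong simp: up_def low_def indicator_def)+
  have "(LINT s:{0..T \<omega>}|lborel. \<bar>B s \<omega>\<bar> powr m * sgn (B s \<omega>)) = (LINT s|lborel. up s - low s)"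
    unfolding set_lebesgue_integral_def
    by (intro Bochner_Integration.integral_cong)
       (auto simp: up_def low_def indicator_def y_def pos_power_def sgn_if max_def)
  also have "\<dots> = (LINT s|lborel. up s) - (LINT s|lborel. low s)"
    by (rule Bochner_Integration.integral_diff[OF up_int low_int])
  finally have "signed_power_average B a m \<omega> = T \<omega> powr (- (1 + m / 2)) * ((LINT s|lborel. up s) - (LINT s|lborel. low s))"
    unfolding signed_power_average_def T_def[symmetric] powr_minus by (simp add: inverse_eq_divide)
  then show ?case by (simp add: enn2real_mult occ right_diff_distrib)
qed

lemma expectation_enn2real:
  assumes [measurable]: "f \<in> borel_measurable M" and c: "0 < c" "0 \<le> w"
    and eq: "ennreal c * (\<integral>\<^sup>+\<omega>. f \<omega> \<partial>M) = ennreal w"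
  shows "integrable M (\<lambda>\<omega>. enn2real (f \<omega>))" "(LINT \<omega>|M. enn2real (f \<omega>)) = w / c"
proof -
  have fin: "(\<integral>\<^sup>+\<omega>. f \<omega> \<partial>M) \<noteq> \<infinity>"
    using eq c by (auto simp: ennreal_mult_top)
  then have "AE \<omega> in M. f \<omega> \<noteq> \<infinity>" by (intro nn_integral_noteq_infinite) auto
  then have cong: "(\<integral>\<^sup>+\<omega>. ennreal (enn2real (f \<omega>)) \<partial>M) = (\<integral>\<^sup>+\<omega>. f \<omega> \<partial>M)"
    by (intro nn_integral_cong_AE) (auto simp: less_top)
  have meas: "(\<lambda>\<omega>. enn2real (f \<omega>)) \<in> borel_measurable M" by measurable
  show "integrable M (\<lambda>\<omega>. enn2real (f \<omega>))"
    by (rule integrableI_nonneg[OF meas]) (use cong fin in \<open>auto simp: less_top\<close>)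
  have "(LINT \<omega>|M. enn2real (f \<omega>)) = enn2real (\<integral>\<^sup>+\<omega>. f \<omega> \<partial>M)"
    by (subst integral_eq_nn_integral[OF meas]) (auto simp: cong)
  moreover have "c * enn2real (\<integral>\<^sup>+\<omega>. f \<omega> \<partial>M) = w"
    using arg_cong[OF eq, of enn2real] c by (simp add: enn2real_mult)
  ultimately show "(LINT \<omega>|M. enn2real (f \<omega>)) = w / c" using c by (simp add: field_simps)
qed

text \<open>
  The constant \<open>gauss_moment m\<close> cannot be 0, because its product with the expectation of the negative part
  is the positive number \<open>lower_weight m\<close>.
\<close>

theorem expectation_signed_power_average:
  assumes a: "0 < a" and m: "0 \<le> m"
  shows "integrable M (signed_power_average B a m)"
    and "\<exists>k>0. expectation (signed_power_average B a m) = k * balance m"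
proof -
  let ?s = "\<lambda>\<omega>. ennreal (hitting_time B a \<omega> powr (- (1 + m / 2)))"
  let ?U = "\<lambda>\<omega>. ?s \<omega> * occupation (pos_power m) a \<omega>"
  let ?L = "\<lambda>\<omega>. ?s \<omega> * occupation (\<lambda>x. pos_power m (- x)) a \<omega>"
  define c where "c = enn2real (gauss_moment m)"
  have gm: "gauss_moment m = ennreal c"
    using gauss_moment_finite[OF m] by (simp add: c_def less_top)
  have U: "ennreal c * (\<integral>\<^sup>+\<omega>. ?U \<omega> \<partial>M) = ennreal (upper_weight m)"
    using positive_part_moment[OF a m] by (simp only: gm)
  have L: "ennreal c * (\<integral>\<^sup>+\<omega>. ?L \<omega> \<partial>M) = ennreal (lower_weight m)"
    using negative_part_moment[OF a m] by (simp only: gm)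
  have "c \<noteq> 0" using L weights_nonneg(2)[OF m] by auto
  then have c: "0 < c" by (simp add: c_def less_le)
  note [measurable] = measurable_hitting_time[of a]
  have meas: "?U \<in> borel_measurable M" "?L \<in> borel_measurable M" by measurable
  note EU = expectation_enn2real[OF meas(1) c weights_nonneg(1)[OF m] U]
  note EL = expectation_enn2real[OF meas(2) c less_imp_le[OF weights_nonneg(2)[OF m]] L]
  have D_int: "integrable M (\<lambda>\<omega>. enn2real (?U \<omega>) - enn2real (?L \<omega>))"
    by (rule Bochner_Integration.integrable_diff[OF EU(1) EL(1)])
  note dec = signed_power_average_decomposition[OF a m]
  show "integrable M (signed_power_average B a m)"
    by (rule integrable_cong_AE_imp[OF D_int measurable_signed_power_average]) (use dec in \<open>auto elim: eventually_mono\<close>)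
  have "expectation (signed_power_average B a m) = (LINT \<omega>|M. enn2real (?U \<omega>) - enn2real (?L \<omega>))"
    by (rule integral_cong_AE[OF measurable_signed_power_average borel_measurable_integrable[OF D_int] dec])
  also have "\<dots> = upper_weight m / c - lower_weight m / c"
    using EU EL by simp
  also have "\<dots> = Gamma (m + 1) * (1/2) powr m / c * balance m"
    using upper_minus_lower_weight[OF m] by (simp add: diff_divide_distrib[symmetric])
  finally show "\<exists>k>0. expectation (signed_power_average B a m) = k * balance m"
    using c m by (intro exI[of _ "Gamma (m + 1) * (1/2) powr m / c"]) (simp add: Gamma_real_pos)
qed

end

theorem mainTheorem1:
  fixes M :: "'w measure" and B :: "real \<Rightarrow> 'w \<Rightarrow> real" and a m :: real
  assumes "standard_brownian_motion M B"
    and "a > 0"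
    and "m \<ge> 0"
  shows "integrable M (signed_power_average B a m)
    \<and> (prob_space.expectation M (signed_power_average B a m) = 0 \<longleftrightarrow> m = 1)
    \<and> (m < 1 \<longrightarrow> prob_space.expectation M (signed_power_average B a m) < 0)
    \<and> (m = 1 \<longrightarrow> prob_space.expectation M (signed_power_average B a m) = 0)
    \<and> (m > 1 \<longrightarrow> prob_space.expectation M (signed_power_average B a m) > 0)"
proof -
  interpret standard_brownian_motion M B by fact
  obtain k where k: "0 < k" "expectation (signed_power_average B a m) = k * balance m"
    using expectation_signed_power_average(2)[OF assms(2,3)] by blast
  have neg: "expectation (signed_power_average B a m) < 0" if "m < 1"
    unfolding k(2) using k(1) balance_sign(1)[OF assms(3) that] by (rule mult_pos_neg)
  have zero: "expectation (signed_power_average B a m) = 0" if "m = 1"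
    unfolding k(2) using balance_sign(2)[OF assms(3) that] by simp
  have pos: "0 < expectation (signed_power_average B a m)" if "1 < m"
    unfolding k(2) using k(1) balance_sign(3)[OF assms(3) that] by (rule mult_pos_pos)
  have "m = 1" if "expectation (signed_power_average B a m) = 0"
    using neg pos that by (cases m "1::real" rule: linorder_cases) auto
  then show ?thesis
    using expectation_signed_power_average(1)[OF assms(2,3)] neg zero pos by blast
qed

end
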